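(* Let $\widetilde{\mathcal{W}}$ be the metric space obtained from the pseudo-metric space $(\mathcal{W},d_\triangle)$ of orderons by identifying $W,U\in\mathcal{W}$ whenever $d_\triangle(W,U)=0$. Then $\widetilde{\mathcal{W}}$ is compact with respect to $d_\triangle$.
   Context: An orderon is a (Lebesgue) measurable function $W:([0,1]^2)^2\to[0,1]$ that is symmetric, i.e. $W(u,v)=W(v,u)$ for all $u,v\in[0,1]^2$; $\mathcal{W}$ is the set of all orderons. A measure-preserving bijection of $[0,1]^2$ is a bijection $f:[0,1]^2\to[0,1]^2$ such that both $f$ and $f^{-1}$ are measure preserving for Lebesgue measure; $\mathcal{F}$ is the set of all of them. For $f\in\mathcal{F}$, $W^f(u,v)=W(f(u),f(v))$, and $\mathrm{Shift}(f)=\sup_{(x,a)\in[0,1]^2}|x-\pi_1(f(x,a))|$, where $\pi_1(y,b)=y$. The cut-norm of a symmetric measurable $V:([0,1]^2)^2\to\mathbb{R}$ is $\|V\|_\square=\sup_{S,T\subseteq[0,1]^2}\left|\int_{S\times T}V(u,v)\,du\,dv\right|$ over measurable $S,T$. The cut-shift distance is $d_\triangle(W,U)=\inf_{f\in\mathcal{F}}\left(\mathrm{Shift}(f)+\|W-U^f\|_\square\right)$; it is a pseudo-metric on $\mathcal{W}$. *)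

theory Defs
  imports "HOL-Analysis.Analysis"
begin

type_synonym point = "real \<times> real"

definition unit_square :: "point set" where
  "unit_square = {0..1} \<times> {0..1}"

abbreviation square_measure :: "point measure" where
  "square_measure \<equiv> lebesgue_on unit_square"

text \<open>The domain \<open>([0,1]\<^sup>2)\<^sup>2\<close> is encoded by pairs of points.  Extensionality makes an orderon
  a function on exactly that domain, with no freedom outside it.\<close>

definition orderons :: "(point \<times> point \<Rightarrow> real) set" where
  "orderons = {W \<in> unit_square \<times> unit_square \<rightarrow>\<^sub>E {0..1}.
     W \<in> borel_measurable (lebesgue_on (unit_square \<times> unit_square)) \<and>
     (\<forall>u\<in>unit_square. \<forall>v\<in>unit_square. W (u, v) = W (v, u))}"

text \<open>Measurability is with respect to Lebesgue (not merely Borel) measurable sets on both sides.\<close>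

definition measure_preserving :: "'a measure \<Rightarrow> ('a \<Rightarrow> 'a) \<Rightarrow> bool" where
  "measure_preserving M f \<longleftrightarrow> f \<in> M \<rightarrow>\<^sub>M M \<and>
     (\<forall>A\<in>sets M. emeasure M (f -` A \<inter> space M) = emeasure M A)"

text \<open>The values of these maps outside the unit square are irrelevant below.\<close>

definition mp_bijections :: "(point \<Rightarrow> point) set" where
  "mp_bijections = {f. bij_betw f unit_square unit_square \<and>
     measure_preserving square_measure f \<and>
     measure_preserving square_measure (the_inv_into unit_square f)}"

definition pullback :: "(point \<times> point \<Rightarrow> real) \<Rightarrow> (point \<Rightarrow> point) \<Rightarrow> (point \<times> point \<Rightarrow> real)" where
  "pullback W f = (\<lambda>(u, v). W (f u, f v))"

definition Shift :: "(point \<Rightarrow> point) \<Rightarrow> real" where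
  "Shift f = (SUP (x, a)\<in>unit_square. \<bar>x - fst (f (x, a))\<bar>)"

definition cut_norm :: "(point \<times> point \<Rightarrow> real) \<Rightarrow> real" where
  "cut_norm V = (SUP (S, T)\<in>sets square_measure \<times> sets square_measure.
     \<bar>LINT p:S \<times> T|lebesgue. V p\<bar>)"

definition cut_shift_dist :: "(point \<times> point \<Rightarrow> real) \<Rightarrow> (point \<times> point \<Rightarrow> real) \<Rightarrow> real" where
  "cut_shift_dist W U =
     (INF f\<in>mp_bijections. Shift f + cut_norm (\<lambda>p. W p - pullback U f p))"

definition orderon_rel :: "((point \<times> point \<Rightarrow> real) \<times> (point \<times> point \<Rightarrow> real)) set" where
  "orderon_rel = {(W, U). W \<in> orderons \<and> U \<in> orderons \<and> cut_shift_dist W U = 0}"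

definition orderon_classes :: "(point \<times> point \<Rightarrow> real) set set" where
  "orderon_classes = orderons // orderon_rel"

text \<open>The common value of the distance over all pairs of representatives; it is well defined because
  \<^const>\<open>cut_shift_dist\<close> is a pseudo-metric on \<^const>\<open>orderons\<close>.  The locale \<^locale>\<open>Metric_space\<close>
  demands symmetry and nonnegativity also off the carrier, hence the irrelevant value 0 there.\<close>

definition class_dist :: "(point \<times> point \<Rightarrow> real) set \<Rightarrow> (point \<times> point \<Rightarrow> real) set \<Rightarrow> real" where
  "class_dist A B =
     (if A \<in> orderon_classes \<and> B \<in> orderon_classes
      then the_elem ((\<lambda>(W, U). cut_shift_dist W U) ` (A \<times> B)) else 0)"

end

theory Submission
  imports Defs
begin

text \<open>
  The metric axioms come from the group structure of the measure preserving bijections; compactness is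
  proved as sequential compactness of orderons under the cut-shift distance.

  Given orderons \<open>W n\<close>, weak regularity is applied to each of them greedily: a partition with labels
  below \<open>4 ^ k\<close> is split by a rectangle \<open>S \<times> T\<close> that nearly attains the cut norm of the difference between
  \<open>W n\<close> and its averages over the products of cells.  Every such split raises the energy (the squared
  \<open>L\<^sup>2\<close> norm of the averages) by at least a quarter of the squared cut norm, and energies are at most 1.
  So in each window of \<open>K\<close> consecutive levels some level has squared cut norm at most \<open>4 / K\<close>
  (\<open>regular_filtration_window\<close>).

  Since the number of labels at a level does not depend on \<open>n\<close>, a diagonal subsequence makes two kinds
  of numbers converge: the distribution along the first coordinate of the area of each cell, and the
  integrals of \<open>W n\<close> over products of cells.  The limit distribution functions are Lipschitz with
  constant 1, hence have densities, and stacking the cells over each abscissa \<open>x\<close> with these densities as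
  heights gives partitions of the square with exactly the limit distributions, nested up to null sets
  (\<open>measure_limit_cell\<close>, \<open>limit_label_refines\<close>).  The limit integrals define step kernels on
  these partitions.  They form a martingale with bounded energy, so they converge in \<open>L\<^sup>1\<close>, and the
  limit \<open>V\<close> is the desired orderon (\<open>limit_orderon\<close>).

  It remains to move \<open>W n\<close> onto \<open>V\<close>.  In each of \<open>M\<close> vertical strips the cells of \<open>W n\<close> and the limit cells
  have almost the same areas.  Both partitions are almost unions of small squares, and a permutation of
  the small squares inside each strip matches them up to a small area.  This permutation is a bijection
  with shift at most \<open>1 / M\<close> (\<open>matching_bijection\<close>), and composing the approximations gives
  a cut-shift distance that tends to 0 (\<open>distance_estimate\<close>, \<open>converges\<close>).
\<close>

section \<open>Products of Lebesgue measurable sets\<close>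

text \<open>The default rule replaces the measure of a Lebesgue set by that of its Borel part, which hides
  the sets occurring below; it is kept only for Borel sets.\<close>

declare emeasure_completion [simp del]

lemma emeasure_lebesgue_borel [simp]: "S \<in> sets borel \<Longrightarrow> emeasure lebesgue S = emeasure lborel S"
  by (simp add: emeasure_completion)

abbreviation square2 :: "(point \<times> point) set" where
  "square2 \<equiv> unit_square \<times> unit_square"

abbreviation square2_measure :: "(point \<times> point) measure" where
  "square2_measure \<equiv> lebesgue_on square2"

abbreviation area :: "point set \<Rightarrow> real" where
  "area \<equiv> measure square_measure"

abbreviation L1_norm :: "(point \<times> point \<Rightarrow> real) \<Rightarrow> real" where
  "L1_norm V \<equiv> \<integral>z. \<bar>V z\<bar> \<partial>square2_measure"

text \<open>Each factor differs from a Borel set by a subset of a Borel null set, and strips over null sets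
  are null.\<close>

lemma lebesgue_times:
  fixes A :: "'a::euclidean_space set" and B :: "'b::euclidean_space set"
  assumes A: "A \<in> sets lebesgue" and B: "B \<in> sets lebesgue"
  shows "A \<times> B \<in> sets lebesgue" "emeasure lebesgue (A \<times> B) = emeasure lebesgue A * emeasure lebesgue B"
proof -
  obtain A1 A0 A2 where A1: "A = A1 \<union> A0" "A0 \<subseteq> A2" "A2 \<in> null_sets lborel" "A1 \<in> sets lborel"
    using sets_completionE[OF A] by metis
  obtain B1 B0 B2 where B1: "B = B1 \<union> B0" "B0 \<subseteq> B2" "B2 \<in> null_sets lborel" "B1 \<in> sets lborel"
    using sets_completionE[OF B] by metis
  have eA: "emeasure lebesgue A = emeasure lborel A1"
    using A1 null_sets_completion_subset[of A0 A2 lborel] null_sets_completionI[of A2 lborel]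
    by (simp add: emeasure_Un_null_set)
  have eB: "emeasure lebesgue B = emeasure lborel B1"
    using B1 null_sets_completion_subset[of B0 B2 lborel] null_sets_completionI[of B2 lborel]
    by (simp add: emeasure_Un_null_set)
  have "A2 \<times> UNIV \<in> null_sets (lborel \<Otimes>\<^sub>M lborel :: ('a \<times> 'b) measure)"
    "UNIV \<times> B2 \<in> null_sets (lborel \<Otimes>\<^sub>M lborel :: ('a \<times> 'b) measure)"
    using lborel.times_in_null_sets1[OF A1(3), of UNIV] lborel.times_in_null_sets2[OF _ B1(3), of UNIV lborel] by auto
  then have "A2 \<times> UNIV \<union> UNIV \<times> B2 \<in> null_sets (lborel :: ('a \<times> 'b) measure)"
    by (simp add: lborel_prod null_sets.Un)
  then have n: "(A \<times> B - A1 \<times> B1) \<in> null_sets (lebesgue :: ('a \<times> 'b) measure)"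
    using A1 B1 by (intro null_sets_completion_subset[OF _ null_sets_completionI]) auto
  have b: "A1 \<times> B1 \<in> sets (lborel :: ('a \<times> 'b) measure)"
    using A1(4) B1(4) lborel_prod[where ?'a='a and ?'b='b] by (metis pair_measureI)
  have eq: "A \<times> B = A1 \<times> B1 \<union> (A \<times> B - A1 \<times> B1)" using A1 B1 by auto
  show "A \<times> B \<in> sets lebesgue"
    by (subst eq) (use n b in \<open>auto simp del: Un_Diff_cancel\<close>)
  have "emeasure lebesgue (A \<times> B) = emeasure lebesgue (A1 \<times> B1)"
    by (subst eq) (use n b in \<open>auto simp: emeasure_Un_null_set  simp del: Un_Diff_cancel\<close>)
  also have "\<dots> = emeasure (lborel \<Otimes>\<^sub>M lborel) (A1 \<times> B1)" using b by (simp add: lborel_prod)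
  also have "\<dots> = emeasure lborel A1 * emeasure lborel B1"
    using A1(4) B1(4) by (intro lborel.emeasure_pair_measure_Times) auto
  finally show "emeasure lebesgue (A \<times> B) = emeasure lebesgue A * emeasure lebesgue B"
    using eA eB by simp
qed

lemma unit_square_lebesgue [simp]: "unit_square \<in> sets lebesgue"
  by (simp add: unit_square_def lebesgue_times)

lemma emeasure_unit_square: "emeasure lebesgue unit_square = 1"
  using lebesgue_times(2)[of "{0..1::real}" "{0..1::real}"] by (simp add: unit_square_def)

lemma unit_square2_lebesgue [simp]: "square2 \<in> sets lebesgue"
  by (simp add: lebesgue_times)

lemma sets_square_iff: "A \<in> sets square_measure \<longleftrightarrow> A \<in> sets lebesgue \<and> A \<subseteq> unit_square"
  using sets_restrict_space_iff[of unit_square lebesgue A] by auto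

lemma sets_pair_iff:
  "A \<in> sets square2_measure \<longleftrightarrow> A \<in> sets lebesgue \<and> A \<subseteq> square2"
  using sets_restrict_space_iff[of "square2" lebesgue A] by auto

lemma finite_measure_square: "finite_measure square_measure"
  by (rule finite_measureI) (simp add: emeasure_restrict_space emeasure_unit_square)

lemma emeasure_unit_square2: "emeasure lebesgue square2 = 1"
  using lebesgue_times(2)[OF unit_square_lebesgue unit_square_lebesgue] by (simp add: emeasure_unit_square)

lemma finite_measure_pair: "finite_measure square2_measure"
  by (rule finite_measureI) (simp add: emeasure_restrict_space emeasure_unit_square2)

interpretation L: finite_measure square_measure by (rule finite_measure_square)
interpretation M4: finite_measure square2_measure by (rule finite_measure_pair)

lemma measure_square_space [simp]: "area unit_square = 1"
  by (simp add: measure_def emeasure_restrict_space emeasure_unit_square)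

lemma measure_pair_space [simp]: "measure square2_measure square2 = 1"
  by (simp add: measure_def emeasure_restrict_space emeasure_unit_square2)

lemma pair_times:
  assumes "A \<in> sets square_measure" "B \<in> sets square_measure"
  shows "A \<times> B \<in> sets square2_measure"
    and "emeasure square2_measure (A \<times> B) = emeasure square_measure A * emeasure square_measure B"
    and "measure square2_measure (A \<times> B) = area A * area B"
proof -
  have *: "A \<in> sets lebesgue" "A \<subseteq> unit_square" "B \<in> sets lebesgue" "B \<subseteq> unit_square"
    using assms by (auto simp: sets_square_iff)
  show "A \<times> B \<in> sets square2_measure"
    unfolding sets_pair_iff using * lebesgue_times by blast
  have "A \<times> B \<subseteq> square2" using * by auto
  then show e: "emeasure square2_measure (A \<times> B) = emeasure square_measure A * emeasure square_measure B"
    using * lebesgue_times(2)[of A B] by (simp add: emeasure_restrict_space)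
  show "measure square2_measure (A \<times> B) = area A * area B"
    unfolding measure_def e by (simp add: enn2real_mult)
qed

lemma measurable_fst_square [measurable]: "fst \<in> square2_measure \<rightarrow>\<^sub>M square_measure"
proof (rule measurableI)
  fix A assume A: "A \<in> sets square_measure"
  have "fst -` A \<inter> space square2_measure = A \<times> unit_square"
    using A by (auto simp: sets_square_iff)
  then show "fst -` A \<inter> space square2_measure \<in> sets square2_measure"
    using pair_times(1)[OF A sets_lebesgue_on_refl] by simp
qed auto

lemma measurable_snd_square [measurable]: "snd \<in> square2_measure \<rightarrow>\<^sub>M square_measure"
proof (rule measurableI)
  fix A assume A: "A \<in> sets square_measure"
  have "snd -` A \<inter> space square2_measure = unit_square \<times> A"
    using A by (auto simp: sets_square_iff)
  then show "snd -` A \<inter> space square2_measure \<in> sets square2_measure"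
    using pair_times(1)[OF sets_lebesgue_on_refl A] by simp
qed auto

text \<open>On the uncompleted product of the two \<open>\<sigma>\<close>-algebras the Lebesgue measure agrees with the product
  measure, because it does so on rectangles.\<close>

lemma square_pair_eq_distr:
  "square_measure \<Otimes>\<^sub>M square_measure
     = distr square2_measure (square_measure \<Otimes>\<^sub>M square_measure) (\<lambda>z. z)"
proof (rule pair_measure_eqI)
  show "sigma_finite_measure square_measure" "sigma_finite_measure square_measure"
    by unfold_locales
  have m: "(\<lambda>z. z) \<in> square2_measure \<rightarrow>\<^sub>M square_measure \<Otimes>\<^sub>M square_measure"
    by (rule measurable_pair) (simp_all add: comp_def measurable_fst_square measurable_snd_square)
  fix A B assume AB: "A \<in> sets square_measure" "B \<in> sets square_measure"
  have "(\<lambda>z. z) -` (A \<times> B) \<inter> space square2_measure = A \<times> B"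
    using AB by (auto simp: sets_square_iff)
  then show "emeasure square_measure A * emeasure square_measure B =
    emeasure (distr square2_measure (square_measure \<Otimes>\<^sub>M square_measure) (\<lambda>z. z)) (A \<times> B)"
    using AB pair_times(2)[OF AB] by (subst emeasure_distr[OF m]) auto
qed simp

lemma pair_square_sets:
  assumes "A \<in> sets (square_measure \<Otimes>\<^sub>M square_measure)"
  shows "A \<in> sets square2_measure"
    and "emeasure square2_measure A = emeasure (square_measure \<Otimes>\<^sub>M square_measure) A"
proof -
  have m: "(\<lambda>z. z) \<in> square2_measure \<rightarrow>\<^sub>M square_measure \<Otimes>\<^sub>M square_measure"
    by (rule measurable_pair) (simp_all add: comp_def measurable_fst_square measurable_snd_square)
  have s: "(\<lambda>z. z) -` A \<inter> space square2_measure = A"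
    using sets.sets_into_space[OF assms] by (auto simp: space_pair_measure)
  show "A \<in> sets square2_measure"
    using measurable_sets[OF m assms] s by simp
  show "emeasure square2_measure A = emeasure (square_measure \<Otimes>\<^sub>M square_measure) A"
    by (subst square_pair_eq_distr, subst emeasure_distr[OF m assms], subst s, rule refl)
qed

lemma borel_pair_square_sets:
  fixes A :: "(point \<times> point) set"
  assumes "A \<in> sets borel"
  shows "A \<inter> square2 \<in> sets (square_measure \<Otimes>\<^sub>M square_measure)"
proof -
  have i: "(\<lambda>x. x) \<in> square_measure \<rightarrow>\<^sub>M (borel :: point measure)"
    by (rule measurable_restrict_space1) (simp add: measurable_completion)
  have "(\<lambda>z. (fst z, snd z)) \<in> square_measure \<Otimes>\<^sub>M square_measure \<rightarrow>\<^sub>M (borel \<Otimes>\<^sub>M borel :: (point \<times> point) measure)"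
    by (intro measurable_Pair measurable_compose[OF measurable_fst i] measurable_compose[OF measurable_snd i])
  then have m: "(\<lambda>z. z) \<in> square_measure \<Otimes>\<^sub>M square_measure \<rightarrow>\<^sub>M (borel :: (point \<times> point) measure)"
    by (simp add: borel_prod)
  show ?thesis
    using measurable_sets[OF m assms] by (simp add: space_pair_measure)
qed

text \<open>Lebesgue sets of \<open>([0,1]\<^sup>2)\<^sup>2\<close> are Borel sets up to subsets of Borel null sets, and the preimage of a
  Borel null set is null because it lies in the uncompleted product.\<close>

lemma measure_preserving_completion:
  assumes m: "g \<in> square_measure \<Otimes>\<^sub>M square_measure \<rightarrow>\<^sub>M square_measure \<Otimes>\<^sub>M square_measure"
    and d: "distr (square_measure \<Otimes>\<^sub>M square_measure) (square_measure \<Otimes>\<^sub>M square_measure) g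
      = square_measure \<Otimes>\<^sub>M square_measure"
  shows "g \<in> square2_measure \<rightarrow>\<^sub>M square2_measure"
    and "distr square2_measure square2_measure g = square2_measure"
proof -
  let ?P = "square_measure \<Otimes>\<^sub>M square_measure"
  let ?Q = "square2"
  have spP: "space ?P = ?Q" by (simp add: space_pair_measure)
  have into: "g z \<in> ?Q" if "z \<in> ?Q" for z
    using measurable_space[OF m] that by (simp add: spP)
  have pre: "g -` A \<inter> ?Q \<in> sets square2_measure \<and>
       emeasure square2_measure (g -` A \<inter> ?Q) = emeasure square2_measure A"
    if A: "A \<in> sets ?P" for A
  proof -
    have 1: "g -` A \<inter> ?Q \<in> sets ?P" using measurable_sets[OF m A] by (simp add: spP)
    have "emeasure ?P A = emeasure (distr ?P ?P (g)) A" by (simp add: d)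
    also have "\<dots> = emeasure ?P (g -` A \<inter> ?Q)"
      by (subst emeasure_distr[OF m A]) (simp add: spP)
    finally show ?thesis using pair_square_sets[OF 1] pair_square_sets[OF A] by simp
  qed
  have full: "g -` A \<inter> ?Q \<in> sets square2_measure \<and>
       emeasure square2_measure (g -` A \<inter> ?Q) = emeasure square2_measure A"
    if A: "A \<in> sets square2_measure" for A
  proof -
    obtain S N N' where SN: "A = S \<union> N" "N \<subseteq> N'" "N' \<in> null_sets lborel" "S \<in> sets lborel"
      using A sets_completionE[of A lborel] by (metis sets_pair_iff)
    have AQ: "A \<subseteq> ?Q" using A by (simp add: sets_pair_iff)
    have SP: "S \<in> sets ?P" using borel_pair_square_sets[of S] SN AQ
      by (metis Int_absorb2 le_supE sets_lborel)
    define Z where "Z = N' \<inter> ?Q"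
    have ZP: "Z \<in> sets ?P" unfolding Z_def using borel_pair_square_sets[of N'] SN by auto
    have Z0: "emeasure square2_measure Z = 0"
    proof -
      have "Z \<in> null_sets lebesgue"
        unfolding Z_def by (rule null_sets_completion_subset[OF Int_lower1 null_sets_completionI[OF SN(3)]])
      then show ?thesis by (simp add: Z_def emeasure_restrict_space null_setsD1)
    qed
    have Zn: "g -` Z \<inter> ?Q \<in> null_sets lebesgue"
    proof -
      have "g -` Z \<inter> ?Q \<in> null_sets square2_measure"
        using pre[OF ZP] Z0 by auto
      then show ?thesis using null_sets_restrict_space[of ?Q lebesgue] by auto
    qed
    have Nn: "g -` N \<inter> ?Q \<in> null_sets lebesgue"
      by (rule null_sets_completion_subset[OF _ Zn]) (use SN AQ into Z_def in auto)
    then have Nn': "g -` N \<inter> ?Q \<in> null_sets square2_measure"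
      by (subst null_sets_restrict_space) auto
    have "N \<in> null_sets lebesgue"
      by (rule null_sets_completion_subset[OF SN(2) null_sets_completionI[OF SN(3)]])
    then have N0: "N \<in> null_sets square2_measure"
      using AQ SN by (subst null_sets_restrict_space) auto
    have eq: "g -` A \<inter> ?Q = (g -` S \<inter> ?Q) \<union> (g -` N \<inter> ?Q)"
      using SN by auto
    show ?thesis
      unfolding eq unfolding SN(1)
      using pre[OF SP] Nn' N0 pair_square_sets(1)[OF SP]
      by (auto simp: emeasure_Un_null_set)
  qed
  show m4: "g \<in> square2_measure \<rightarrow>\<^sub>M square2_measure"
    by (rule measurableI) (use into full in auto)
  show "distr square2_measure square2_measure (g) = square2_measure"
    by (rule measure_eqI) (use full in \<open>auto simp: emeasure_distr[OF m4]\<close>)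
qed

definition square_map :: "(point \<Rightarrow> point) \<Rightarrow> point \<times> point \<Rightarrow> point \<times> point" where
  "square_map f = (\<lambda>(u, v). (f u, f v))"

lemma measure_preserving_square_map:
  assumes f: "measure_preserving square_measure f"
  shows "square_map f \<in> square2_measure \<rightarrow>\<^sub>M square2_measure"
    and "distr square2_measure square2_measure (square_map f) = square2_measure"
proof -
  let ?P = "square_measure \<Otimes>\<^sub>M square_measure"
  have fm [measurable]: "f \<in> square_measure \<rightarrow>\<^sub>M square_measure" and
    fe: "\<And>A. A \<in> sets square_measure \<Longrightarrow> emeasure square_measure (f -` A \<inter> unit_square) = emeasure square_measure A"
    using f by (auto simp: measure_preserving_def)
  have "distr square_measure square_measure f = square_measure"
    by (rule measure_eqI) (auto simp: emeasure_distr fe)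
  then have d: "distr ?P ?P (square_map f) = ?P"
    using pair_measure_distr[OF fm fm] unfolding square_map_def
    by (simp add: L.sigma_finite_measure_axioms)
  have m: "square_map f \<in> ?P \<rightarrow>\<^sub>M ?P" unfolding square_map_def by measurable
  show "square_map f \<in> square2_measure \<rightarrow>\<^sub>M square2_measure"
    "distr square2_measure square2_measure (square_map f) = square2_measure"
    by (rule measure_preserving_completion[OF m d])+
qed

lemma measure_preserving_swap:
  shows "(\<lambda>(u, v). (v, u)) \<in> square2_measure \<rightarrow>\<^sub>M square2_measure"
    and "distr square2_measure square2_measure (\<lambda>(u, v). (v, u)) = square2_measure"
proof -
  interpret pair_sigma_finite square_measure square_measure by unfold_locales
  let ?P = "square_measure \<Otimes>\<^sub>M square_measure"
  have m: "(\<lambda>(u, v). (v, u)) \<in> ?P \<rightarrow>\<^sub>M ?P" by measurable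
  have d: "distr ?P ?P (\<lambda>(u, v). (v, u)) = ?P" by (rule distr_pair_swap[symmetric])
  show "(\<lambda>(u, v). (v, u)) \<in> square2_measure \<rightarrow>\<^sub>M square2_measure"
    "distr square2_measure square2_measure (\<lambda>(u, v). (v, u)) = square2_measure"
    by (rule measure_preserving_completion[OF m d])+
qed

section \<open>Bounded kernels and the cut norm\<close>

definition kernel :: "(point \<times> point \<Rightarrow> real) \<Rightarrow> bool" where
  "kernel V \<longleftrightarrow> V \<in> borel_measurable square2_measure \<and>
     (\<exists>C. \<forall>z\<in>square2. \<bar>V z\<bar> \<le> C)"

lemma kernelI:
  assumes "V \<in> borel_measurable square2_measure" "\<And>z. z \<in> square2 \<Longrightarrow> \<bar>V z\<bar> \<le> C"
  shows "kernel V"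
  unfolding kernel_def using assms by blast

lemma kernel_measurable [measurable_dest]: "kernel V \<Longrightarrow> V \<in> borel_measurable square2_measure"
  by (simp add: kernel_def)

lemma kernel_integrable:
  assumes "kernel V" shows "integrable square2_measure V"
proof -
  obtain C where C: "\<And>z. z \<in> square2 \<Longrightarrow> \<bar>V z\<bar> \<le> C"
    using assms unfolding kernel_def by blast
  show ?thesis
  proof (rule M4.integrable_const_bound[of _ C])
    show "AE z in square2_measure. norm (V z) \<le> C" by (rule AE_I2) (use C in simp)
  qed (use assms in \<open>simp add: kernel_def\<close>)
qed

lemma kernelE:
  assumes "kernel V"
  obtains C where "\<And>z. z \<in> square2 \<Longrightarrow> \<bar>V z\<bar> \<le> C"
  using assms unfolding kernel_def by blast

lemma kernel_diff:
  assumes V: "kernel V" and U: "kernel U"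
  shows "kernel (\<lambda>z. V z - U z)"
proof -
  obtain C D where b: "\<And>z. z \<in> square2 \<Longrightarrow> \<bar>V z\<bar> \<le> C"
    "\<And>z. z \<in> square2 \<Longrightarrow> \<bar>U z\<bar> \<le> D"
    using kernelE[OF V] kernelE[OF U] by metis
  show ?thesis
  proof (rule kernelI[of _ "C + D"])
    show "(\<lambda>z. V z - U z) \<in> borel_measurable square2_measure"
      by (intro borel_measurable_diff kernel_measurable V U)
    show "\<bar>V z - U z\<bar> \<le> C + D" if "z \<in> square2" for z
      using b(1)[OF that] b(2)[OF that] by linarith
  qed
qed

lemma kernel_mult:
  assumes V: "kernel V" and U: "kernel U"
  shows "kernel (\<lambda>z. V z * U z)"
proof -
  obtain C D where b: "\<And>z. z \<in> square2 \<Longrightarrow> \<bar>V z\<bar> \<le> C"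
    "\<And>z. z \<in> square2 \<Longrightarrow> \<bar>U z\<bar> \<le> D"
    using kernelE[OF V] kernelE[OF U] by metis
  show ?thesis
  proof (rule kernelI[of _ "C * D"])
    show "(\<lambda>z. V z * U z) \<in> borel_measurable square2_measure"
      by (intro borel_measurable_times kernel_measurable V U)
    show "\<bar>V z * U z\<bar> \<le> C * D" if "z \<in> square2" for z
      unfolding abs_mult
      using mult_mono[OF b(1)[OF that] b(2)[OF that]] order_trans[OF abs_ge_zero b(1)[OF that]] by simp
  qed
qed

lemma kernel_abs: "kernel V \<Longrightarrow> kernel (\<lambda>z. \<bar>V z\<bar>)"
  by (auto simp: kernel_def)

lemma kernel_power2: "kernel V \<Longrightarrow> kernel (\<lambda>z. (V z)\<^sup>2)"
  using kernel_mult[of V V] by (simp add: power2_eq_square)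

lemma kernel_indicator: "A \<in> sets square2_measure \<Longrightarrow> kernel (indicator A)"
  by (rule kernelI[of _ 1]) (auto simp: indicator_def)

lemma orderon_kernel: "W \<in> orderons \<Longrightarrow> kernel W"
  by (rule kernelI[of _ 1]) (auto simp: orderons_def PiE_def Pi_def)

lemma rectangle_integral:
  fixes V :: "point \<times> point \<Rightarrow> real"
  assumes "S \<in> sets square_measure" "T \<in> sets square_measure"
  shows "(LINT z:S \<times> T|lebesgue. V z) = (\<integral>z. indicator (S \<times> T) z * V z \<partial>square2_measure)"
proof -
  have "S \<times> T \<subseteq> square2" using assms by (auto simp: sets_square_iff)
  then have "indicator (S \<times> T) z *\<^sub>R V z = indicator square2 z *\<^sub>R (indicator (S \<times> T) z * V z)" for z
    by (cases "z \<in> S \<times> T") auto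
  then show ?thesis
    unfolding set_lebesgue_integral_def
    by (subst integral_restrict_space) (auto intro: Bochner_Integration.integral_cong)
qed

lemma kernel_rectangle:
  assumes "kernel V" "S \<in> sets square_measure" "T \<in> sets square_measure"
  shows "kernel (\<lambda>z. indicator (S \<times> T) z * V z)"
  using assms by (intro kernel_mult kernel_indicator pair_times)

lemma rectangle_integral_le_L1:
  assumes V: "kernel V" and ST: "S \<in> sets square_measure" "T \<in> sets square_measure"
  shows "\<bar>LINT z:S \<times> T|lebesgue. V z\<bar> \<le> (\<integral>z. \<bar>V z\<bar> \<partial>square2_measure)"
proof -
  have "\<bar>\<integral>z. indicator (S \<times> T) z * V z \<partial>square2_measure\<bar> \<le> L1_norm (\<lambda>z. indicator (S \<times> T) z * V z)"
    by (rule integral_abs_bound)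
  also have "\<dots> \<le> (\<integral>z. \<bar>V z\<bar> \<partial>square2_measure)"
    by (intro integral_mono kernel_integrable kernel_abs kernel_rectangle V ST) (auto simp: indicator_def)
  finally show ?thesis by (simp add: rectangle_integral[OF ST])
qed

lemma cut_norm_upper:
  assumes V: "kernel V" and ST: "S \<in> sets square_measure" "T \<in> sets square_measure"
  shows "\<bar>LINT z:S \<times> T|lebesgue. V z\<bar> \<le> cut_norm V"
proof -
  have "bdd_above ((\<lambda>(S, T). \<bar>LINT z:S \<times> T|lebesgue. V z\<bar>) ` (sets square_measure \<times> sets square_measure))"
    by (rule bdd_aboveI[of _ "\<integral>z. \<bar>V z\<bar> \<partial>square2_measure"]) (auto intro: rectangle_integral_le_L1[OF V])
  from cSUP_upper[OF _ this, of "(S, T)"] show ?thesis using ST by (simp add: cut_norm_def)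
qed

lemma cut_norm_least:
  assumes "\<And>S T. S \<in> sets square_measure \<Longrightarrow> T \<in> sets square_measure \<Longrightarrow> \<bar>LINT z:S \<times> T|lebesgue. V z\<bar> \<le> c"
  shows "cut_norm V \<le> c"
  unfolding cut_norm_def by (rule cSUP_least) (use assms in auto)

lemma cut_norm_nonneg: "kernel V \<Longrightarrow> 0 \<le> cut_norm V"
  using cut_norm_upper[of V "{}" "{}"] by (simp add: set_lebesgue_integral_def)

lemma cut_norm_le_L1: "kernel V \<Longrightarrow> cut_norm V \<le> (\<integral>z. \<bar>V z\<bar> \<partial>square2_measure)"
  by (rule cut_norm_least) (rule rectangle_integral_le_L1)

text \<open>The supremum need not be attained; losing a factor of 2 gives a witness also when the norm is 0.\<close>

lemma cut_norm_near_sup: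
  assumes V: "kernel V"
  obtains S T where "S \<in> sets square_measure" "T \<in> sets square_measure"
    "cut_norm V \<le> 2 * \<bar>LINT z:S \<times> T|lebesgue. V z\<bar>"
proof (cases "cut_norm V > 0")
  case False
  then show ?thesis using that[of "{}" "{}"] by (simp add: set_lebesgue_integral_def)
next
  case True
  have "\<exists>S\<in>sets square_measure. \<exists>T\<in>sets square_measure. cut_norm V / 2 < \<bar>LINT z:S \<times> T|lebesgue. V z\<bar>"
  proof (rule ccontr)
    assume "\<not> ?thesis"
    then have "cut_norm V \<le> cut_norm V / 2" by (intro cut_norm_least) (meson not_le)
    then show False using True by simp
  qed
  then show ?thesis using that by force
qed

lemma cut_norm_cong:
  assumes "\<And>z. z \<in> square2 \<Longrightarrow> V z = U z"
  shows "cut_norm V = cut_norm U"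
proof -
  have "(LINT z:S \<times> T|lebesgue. V z) = (LINT z:S \<times> T|lebesgue. U z)"
    if "S \<in> sets square_measure" "T \<in> sets square_measure" for S T
    unfolding rectangle_integral[OF that] by (rule Bochner_Integration.integral_cong) (auto simp: assms)
  then show ?thesis unfolding cut_norm_def by (intro SUP_cong) auto
qed

lemma cut_norm_triangle:
  assumes V: "kernel V" and U: "kernel U" and W: "kernel W"
  shows "cut_norm (\<lambda>z. V z - W z) \<le> cut_norm (\<lambda>z. V z - U z) + cut_norm (\<lambda>z. U z - W z)"
proof (rule cut_norm_least)
  fix S T assume ST: "S \<in> sets square_measure" "T \<in> sets square_measure"
  have "(LINT z:S \<times> T|lebesgue. V z - W z) = (LINT z:S \<times> T|lebesgue. V z - U z) + (LINT z:S \<times> T|lebesgue. U z - W z)"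
    unfolding rectangle_integral[OF ST]
    by (subst Bochner_Integration.integral_add[symmetric])
       (auto intro!: kernel_integrable kernel_rectangle kernel_diff V U W ST Bochner_Integration.integral_cong
         simp: right_diff_distrib)
  then show "\<bar>LINT z:S \<times> T|lebesgue. V z - W z\<bar> \<le> cut_norm (\<lambda>z. V z - U z) + cut_norm (\<lambda>z. U z - W z)"
    using cut_norm_upper[OF kernel_diff[OF V U] ST] cut_norm_upper[OF kernel_diff[OF U W] ST] by linarith
qed

lemma cut_norm_minus_commute: "cut_norm (\<lambda>z. V z - U z) = cut_norm (\<lambda>z. U z - V z)"
proof -
  have "\<bar>LINT z:S \<times> T|lebesgue. V z - U z\<bar> = \<bar>LINT z:S \<times> T|lebesgue. U z - V z\<bar>" for S T
  proof -
    have "(LINT z:S \<times> T|lebesgue. V z - U z) = - (LINT z:S \<times> T|lebesgue. U z - V z)"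
      unfolding set_lebesgue_integral_def by (subst Bochner_Integration.integral_minus[symmetric]) (simp add: algebra_simps)
    then show ?thesis by simp
  qed
  then show ?thesis unfolding cut_norm_def by simp
qed

section \<open>Measure preserving bijections\<close>

lemma mp_bijectionsD:
  assumes "f \<in> mp_bijections"
  shows "bij_betw f unit_square unit_square" "measure_preserving square_measure f"
    "measure_preserving square_measure (the_inv_into unit_square f)"
    "f \<in> square_measure \<rightarrow>\<^sub>M square_measure"
    "\<And>p. p \<in> unit_square \<Longrightarrow> f p \<in> unit_square"
proof -
  show *: "bij_betw f unit_square unit_square" "measure_preserving square_measure f"
    "measure_preserving square_measure (the_inv_into unit_square f)"
    using assms by (simp_all add: mp_bijections_def)
  then show "f \<in> square_measure \<rightarrow>\<^sub>M square_measure"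
    by (simp add: measure_preserving_def)
  show "f p \<in> unit_square" if "p \<in> unit_square" for p
    using *(1) that by (rule bij_betwE[rule_format])
qed

lemma measure_preserving_cong:
  assumes "\<And>p. p \<in> space M \<Longrightarrow> f p = g p"
  shows "measure_preserving M f \<longleftrightarrow> measure_preserving M g"
proof -
  have "f -` A \<inter> space M = g -` A \<inter> space M" for A using assms by auto
  then show ?thesis
    using measurable_cong[OF assms, of M] by (simp add: measure_preserving_def)
qed

lemma measure_preserving_comp:
  assumes "measure_preserving M f" "measure_preserving M g"
  shows "measure_preserving M (g \<circ> f)"
proof -
  have m: "f \<in> M \<rightarrow>\<^sub>M M" "g \<in> M \<rightarrow>\<^sub>M M" using assms by (auto simp: measure_preserving_def)
  have "emeasure M ((g \<circ> f) -` A \<inter> space M) = emeasure M A" if "A \<in> sets M" for A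
  proof -
    have "(g \<circ> f) -` A \<inter> space M = f -` (g -` A \<inter> space M) \<inter> space M"
      using measurable_space[OF m(1)] by auto
    then show ?thesis using assms that measurable_sets[OF m(2) that]
      by (simp add: measure_preserving_def del: vimage_Int)
  qed
  then show ?thesis using m by (auto simp: measure_preserving_def intro: measurable_comp)
qed

text \<open>Any measure preserving left inverse agrees on the square with the canonical inverse of the definition.\<close>

lemma mp_bijectionsI:
  assumes "bij_betw f unit_square unit_square" "measure_preserving square_measure f"
    and "measure_preserving square_measure g" "\<And>p. p \<in> unit_square \<Longrightarrow> g (f p) = p"
  shows "f \<in> mp_bijections"
proof -
  have inj: "inj_on f unit_square" and im: "f ` unit_square = unit_square"
    using bij_betw_imp_inj_on[OF assms(1)] bij_betw_imp_surj_on[OF assms(1)] .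
  have "the_inv_into unit_square f p = g p" if p: "p \<in> unit_square" for p
  proof -
    obtain q where "q \<in> unit_square" "p = f q" using p im imageE[of p f unit_square] by metis
    then show ?thesis using assms(4) the_inv_into_f_f[OF inj] by simp
  qed
  then have "measure_preserving square_measure (the_inv_into unit_square f)"
    using assms(3) measure_preserving_cong[of square_measure "the_inv_into unit_square f" g] by simp
  then show ?thesis using assms by (simp add: mp_bijections_def)
qed

lemma mp_bijections_id: "(\<lambda>p. p) \<in> mp_bijections"
proof -
  have "measure_preserving square_measure (\<lambda>p. p)"
    by (auto simp: measure_preserving_def sets_square_iff Int_absorb2)
  then show ?thesis by (intro mp_bijectionsI[where g="\<lambda>p. p"]) (auto simp: bij_betw_id[unfolded id_def])
qed

lemma mp_bijections_inverse:
  assumes f: "f \<in> mp_bijections"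
  defines "g \<equiv> the_inv_into unit_square f"
  shows "g \<in> mp_bijections" "\<And>p. p \<in> unit_square \<Longrightarrow> g (f p) = p" "\<And>p. p \<in> unit_square \<Longrightarrow> f (g p) = p"
proof -
  have b: "bij_betw f unit_square unit_square" using mp_bijectionsD[OF f] by auto
  show gf: "\<And>p. p \<in> unit_square \<Longrightarrow> g (f p) = p"
    using the_inv_into_f_f[OF bij_betw_imp_inj_on[OF b]] by (simp add: g_def)
  show fg: "\<And>p. p \<in> unit_square \<Longrightarrow> f (g p) = p"
    using f_the_inv_into_f_bij_betw[OF b] by (simp add: g_def)
  show "g \<in> mp_bijections"
    using mp_bijectionsD[OF f] fg bij_betw_the_inv_into[OF b]
    by (intro mp_bijectionsI[where g=f]) (auto simp: g_def)
qed

lemma mp_bijections_comp: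
  assumes f: "f \<in> mp_bijections" and g: "g \<in> mp_bijections"
  shows "g \<circ> f \<in> mp_bijections"
proof (rule mp_bijectionsI[where g="the_inv_into unit_square f \<circ> the_inv_into unit_square g"])
  show "bij_betw (g \<circ> f) unit_square unit_square"
    using mp_bijectionsD[OF f] mp_bijectionsD[OF g] bij_betw_trans by blast
qed (use mp_bijectionsD[OF f] mp_bijectionsD[OF g] mp_bijections_inverse[OF f] mp_bijections_inverse[OF g]
     in \<open>auto intro: measure_preserving_comp\<close>)

lemma pullback_square_map: "pullback V f = V \<circ> square_map f"
  by (auto simp: pullback_def square_map_def)

lemma kernel_pullback:
  assumes f: "f \<in> mp_bijections" and V: "kernel V"
  shows "kernel (pullback V f)"
    and "(\<integral>z. pullback V f z \<partial>square2_measure) = (\<integral>z. V z \<partial>square2_measure)"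
proof -
  note m = measure_preserving_square_map[OF mp_bijectionsD(2)[OF f]]
  have into: "square_map f z \<in> square2" if "z \<in> square2" for z
    using measurable_space[OF m(1)] that by simp
  obtain C where "\<forall>z\<in>square2. \<bar>V z\<bar> \<le> C" using V unfolding kernel_def by blast
  then have "\<bar>(V \<circ> square_map f) z\<bar> \<le> C" if "z \<in> square2" for z
    using into[OF that] by (metis comp_apply)
  then show "kernel (pullback V f)"
    unfolding pullback_square_map
    by (rule kernelI[rotated]) (use V m(1) in \<open>auto simp: kernel_def intro: measurable_comp\<close>)
  have "(\<integral>z. V z \<partial>square2_measure) = (\<integral>z. V z \<partial>distr square2_measure square2_measure (square_map f))"
    by (simp add: m(2))
  also have "\<dots> = (\<integral>z. V (square_map f z) \<partial>square2_measure)"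
    using V m(1) by (intro integral_distr) (auto simp: kernel_def)
  finally show "(\<integral>z. pullback V f z \<partial>square2_measure) = (\<integral>z. V z \<partial>square2_measure)"
    by (simp add: pullback_square_map)
qed

text \<open>A bijection carries rectangles to rectangles, so the pulled back kernel sees no new rectangles.\<close>

lemma cut_norm_pullback_le:
  assumes f: "f \<in> mp_bijections" and V: "kernel V"
  shows "cut_norm (pullback V f) \<le> cut_norm V"
proof (rule cut_norm_least)
  fix S T assume ST: "S \<in> sets square_measure" "T \<in> sets square_measure"
  define g where "g = the_inv_into unit_square f"
  note g = mp_bijections_inverse[OF f, folded g_def]
  have gm: "g \<in> square_measure \<rightarrow>\<^sub>M square_measure" using mp_bijectionsD[OF g(1)] by simp
  define S' T' where "S' = g -` S \<inter> unit_square" and "T' = g -` T \<inter> unit_square"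
  have ST': "S' \<in> sets square_measure" "T' \<in> sets square_measure"
    using measurable_sets[OF gm] ST by (auto simp: S'_def T'_def)
  have eq: "indicator (S \<times> T) z * pullback V f z = pullback (\<lambda>z. indicator (S' \<times> T') z * V z) f z"
    if "z \<in> square2" for z
    using that g(2) mp_bijectionsD(5)[OF f] by (auto simp: pullback_def S'_def T'_def indicator_def)
  have "(LINT z:S \<times> T|lebesgue. pullback V f z)
      = (\<integral>z. pullback (\<lambda>z. indicator (S' \<times> T') z * V z) f z \<partial>square2_measure)"
    unfolding rectangle_integral[OF ST] by (rule Bochner_Integration.integral_cong) (auto simp: eq)
  also have "\<dots> = (LINT z:S' \<times> T'|lebesgue. V z)"
    unfolding rectangle_integral[OF ST'] using kernel_pullback(2)[OF f kernel_rectangle[OF V ST']] .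
  finally show "\<bar>LINT z:S \<times> T|lebesgue. pullback V f z\<bar> \<le> cut_norm V"
    using cut_norm_upper[OF V ST'] by simp
qed

lemma Shift_upper:
  assumes f: "f \<in> mp_bijections" and p: "p \<in> unit_square"
  shows "\<bar>fst p - fst (f p)\<bar> \<le> Shift f"
proof -
  have "\<bar>x - fst (f (x, a))\<bar> \<le> 1" if "(x, a) \<in> unit_square" for x a
    using mp_bijectionsD(5)[OF f that] that by (auto simp: unit_square_def mem_Times_iff abs_le_iff)
  then have "bdd_above ((\<lambda>(x, a). \<bar>x - fst (f (x, a))\<bar>) ` unit_square)"
    by (intro bdd_aboveI[of _ 1]) auto
  from cSUP_upper[OF p this] show ?thesis by (simp add: Shift_def case_prod_beta)
qed

lemma unit_square_nonempty: "unit_square \<noteq> {}"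
  by (auto simp: unit_square_def)

lemma Shift_least:
  assumes "\<And>p. p \<in> unit_square \<Longrightarrow> \<bar>fst p - fst (f p)\<bar> \<le> d"
  shows "Shift f \<le> d"
  unfolding Shift_def by (rule cSUP_least) (use assms unit_square_nonempty in force)+

lemma Shift_nonneg: "f \<in> mp_bijections \<Longrightarrow> 0 \<le> Shift f"
  using Shift_upper[of f "(0, 0)"] order_trans[OF abs_ge_zero] by (force simp: unit_square_def)

section \<open>The cut-shift distance is a pseudo-metric\<close>

lemma cut_shift_summand_nonneg:
  assumes "kernel W" "kernel U" "f \<in> mp_bijections"
  shows "0 \<le> Shift f + cut_norm (\<lambda>z. W z - pullback U f z)"
  using assms by (intro add_nonneg_nonneg Shift_nonneg cut_norm_nonneg kernel_diff kernel_pullback)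

lemma cut_shift_dist_upper:
  assumes "kernel W" "kernel U" "f \<in> mp_bijections"
  shows "cut_shift_dist W U \<le> Shift f + cut_norm (\<lambda>z. W z - pullback U f z)"
  unfolding cut_shift_dist_def
  by (rule cINF_lower[OF bdd_belowI2[of _ 0] assms(3)]) (rule cut_shift_summand_nonneg[OF assms(1,2)])

lemma cut_shift_dist_greatest:
  assumes "\<And>f. f \<in> mp_bijections \<Longrightarrow> c \<le> Shift f + cut_norm (\<lambda>z. W z - pullback U f z)"
  shows "c \<le> cut_shift_dist W U"
  unfolding cut_shift_dist_def using mp_bijections_id assms by (intro cINF_greatest) auto

lemma cut_shift_dist_nonneg: "kernel W \<Longrightarrow> kernel U \<Longrightarrow> 0 \<le> cut_shift_dist W U"
  by (intro cut_shift_dist_greatest cut_shift_summand_nonneg)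

lemma cut_shift_dist_refl:
  assumes W: "kernel W" shows "cut_shift_dist W W = 0"
proof -
  have "cut_norm (\<lambda>z. W z - pullback W (\<lambda>p. p) z) \<le> 0"
    by (rule cut_norm_least) (simp add: pullback_def set_lebesgue_integral_def)
  moreover have "Shift (\<lambda>p. p) \<le> 0" by (rule Shift_least) simp
  ultimately show ?thesis
    using cut_shift_dist_upper[OF W W mp_bijections_id] cut_shift_dist_nonneg[OF W W] by linarith
qed

text \<open>Replace a bijection by its inverse: the shift does not grow, and pulling back along the inverse
  exchanges the two kernels.\<close>

lemma cut_shift_dist_le_commute:
  assumes W: "kernel W" and U: "kernel U"
  shows "cut_shift_dist U W \<le> cut_shift_dist W U"
proof (rule cut_shift_dist_greatest)
  fix f assume f: "f \<in> mp_bijections"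
  define g where "g = the_inv_into unit_square f"
  note g = mp_bijections_inverse[OF f, folded g_def]
  have gu: "g p \<in> unit_square" if "p \<in> unit_square" for p using mp_bijectionsD(5)[OF g(1) that] .
  have "Shift g \<le> Shift f"
  proof (rule Shift_least)
    fix p assume p: "p \<in> unit_square"
    show "\<bar>fst p - fst (g p)\<bar> \<le> Shift f"
      using Shift_upper[OF f gu[OF p]] g(3)[OF p] by simp
  qed
  moreover have "cut_norm (\<lambda>z. U z - pullback W g z) \<le> cut_norm (\<lambda>z. W z - pullback U f z)"
  proof -
    have "cut_norm (\<lambda>z. U z - pullback W g z) = cut_norm (pullback (\<lambda>z. pullback U f z - W z) g)"
      by (rule cut_norm_cong) (auto simp: pullback_def g(3))
    also have "\<dots> \<le> cut_norm (\<lambda>z. pullback U f z - W z)"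
      by (intro cut_norm_pullback_le g kernel_diff kernel_pullback W U f)
    finally show ?thesis by (simp only: cut_norm_minus_commute)
  qed
  ultimately show "cut_shift_dist U W \<le> Shift f + cut_norm (\<lambda>z. W z - pullback U f z)"
    using cut_shift_dist_upper[OF U W g(1)] by linarith
qed

lemma cut_shift_dist_commute:
  "kernel W \<Longrightarrow> kernel U \<Longrightarrow> cut_shift_dist W U = cut_shift_dist U W"
  by (intro antisym cut_shift_dist_le_commute)

lemma cut_shift_dist_triangle:
  assumes W: "kernel W" and U: "kernel U" and Z: "kernel Z"
  shows "cut_shift_dist W Z \<le> cut_shift_dist W U + cut_shift_dist U Z"
proof -
  have le: "cut_shift_dist W Z \<le>
      (Shift f + cut_norm (\<lambda>z. W z - pullback U f z)) + (Shift g + cut_norm (\<lambda>z. U z - pullback Z g z))"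
    if f: "f \<in> mp_bijections" and g: "g \<in> mp_bijections" for f g
  proof -
    have h: "g \<circ> f \<in> mp_bijections" using f g by (rule mp_bijections_comp)
    note fu = mp_bijectionsD(5)[OF f] and gu = mp_bijectionsD(5)[OF g]
    have "Shift (g \<circ> f) \<le> Shift f + Shift g"
    proof (rule Shift_least)
      fix p assume p: "p \<in> unit_square"
      show "\<bar>fst p - fst ((g \<circ> f) p)\<bar> \<le> Shift f + Shift g"
        using Shift_upper[OF f p] Shift_upper[OF g fu[OF p]] by simp
    qed
    moreover have "cut_norm (\<lambda>z. W z - pullback Z (g \<circ> f) z)
        \<le> cut_norm (\<lambda>z. W z - pullback U f z) + cut_norm (\<lambda>z. U z - pullback Z g z)"
    proof -
      have "cut_norm (\<lambda>z. pullback U f z - pullback Z (g \<circ> f) z) = cut_norm (pullback (\<lambda>z. U z - pullback Z g z) f)"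
        by (rule cut_norm_cong) (auto simp: pullback_def)
      also have "\<dots> \<le> cut_norm (\<lambda>z. U z - pullback Z g z)"
        by (intro cut_norm_pullback_le f kernel_diff kernel_pullback U Z g)
      finally show ?thesis
        using cut_norm_triangle[OF W kernel_pullback(1)[OF f U] kernel_pullback(1)[OF h Z]] by linarith
    qed
    ultimately show ?thesis using cut_shift_dist_upper[OF W Z h] by linarith
  qed
  have "cut_shift_dist W Z - (Shift f + cut_norm (\<lambda>z. W z - pullback U f z)) \<le> cut_shift_dist U Z"
    if f: "f \<in> mp_bijections" for f
    by (rule cut_shift_dist_greatest) (use le[OF f] in force)
  then have "cut_shift_dist W Z - cut_shift_dist U Z \<le> cut_shift_dist W U"
    by (intro cut_shift_dist_greatest) force
  then show ?thesis by simp
qed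

section \<open>The quotient metric space\<close>

lemma equiv_orderon_rel: "equiv orderons orderon_rel"
proof (rule equivI)
  show "orderon_rel \<subseteq> orderons \<times> orderons" by (auto simp: orderon_rel_def)
  show "refl_on orderons orderon_rel"
    by (auto simp: refl_on_def orderon_rel_def cut_shift_dist_refl orderon_kernel)
  show "sym orderon_rel"
    by (auto simp: sym_def orderon_rel_def cut_shift_dist_commute orderon_kernel)
  show "trans orderon_rel"
  proof (rule transI)
    fix W U Z assume "(W, U) \<in> orderon_rel" "(U, Z) \<in> orderon_rel"
    then show "(W, Z) \<in> orderon_rel"
      using cut_shift_dist_triangle[of W U Z] cut_shift_dist_nonneg[of W Z]
      by (auto simp: orderon_rel_def orderon_kernel)
  qed
qed

lemma class_representative:
  assumes "A \<in> orderon_classes"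
  obtains W where "W \<in> A" "W \<in> orderons" "A = orderon_rel `` {W}"
  using assms equiv_class_self[OF equiv_orderon_rel]
  unfolding orderon_classes_def by (metis quotientE)

lemma class_subset: "A \<in> orderon_classes \<Longrightarrow> W \<in> A \<Longrightarrow> W \<in> orderons"
  by (auto simp: orderon_classes_def quotient_def orderon_rel_def)

lemma orderon_class: "W \<in> orderons \<Longrightarrow> orderon_rel `` {W} \<in> orderon_classes \<and> W \<in> orderon_rel `` {W}"
  using equiv_class_self[OF equiv_orderon_rel] by (auto simp: orderon_classes_def quotientI)

text \<open>The triangle inequality makes the distance independent of the representatives, so the image set in
  the definition is a singleton.\<close>

lemma class_dist_eq:
  assumes A: "A \<in> orderon_classes" and B: "B \<in> orderon_classes" and W: "W \<in> A" and U: "U \<in> B"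
  shows "class_dist A B = cut_shift_dist W U"
proof -
  have eq: "cut_shift_dist W' U' = cut_shift_dist W U" if W': "W' \<in> A" and U': "U' \<in> B" for W' U'
  proof -
    have k: "kernel W" "kernel W'" "kernel U" "kernel U'"
      using class_subset[OF A W] class_subset[OF A W'] class_subset[OF B U] class_subset[OF B U']
      by (auto intro: orderon_kernel)
    have "(W, W') \<in> orderon_rel" "(U, U') \<in> orderon_rel"
      using A B W W' U U' unfolding orderon_classes_def
      by (auto intro: in_quotient_imp_in_rel[OF equiv_orderon_rel])
    then have z: "cut_shift_dist W W' = 0" "cut_shift_dist U U' = 0" by (auto simp: orderon_rel_def)
    show ?thesis
      using cut_shift_dist_triangle[of W W' U] cut_shift_dist_triangle[of W' U' U]
        cut_shift_dist_triangle[of W' W U'] cut_shift_dist_triangle[of W U U'] k z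
        cut_shift_dist_commute[of W W'] cut_shift_dist_commute[of U U']
      by simp
  qed
  have "(\<lambda>(W, U). cut_shift_dist W U) ` (A \<times> B) = (\<lambda>_. cut_shift_dist W U) ` (A \<times> B)"
    by (intro image_cong refl) (simp only: mem_Times_iff case_prod_beta eq)
  also have "\<dots> = {cut_shift_dist W U}"
    by (rule image_constant[of "(W, U)"]) (simp add: W U)
  finally show ?thesis using A B by (simp add: class_dist_def)
qed

lemma Metric_space_orderon_classes: "Metric_space orderon_classes class_dist"
proof
  have rep: "\<exists>W U. class_dist A B = cut_shift_dist W U \<and> class_dist B A = cut_shift_dist U W \<and>
        W \<in> A \<and> U \<in> B \<and> kernel W \<and> kernel U"
    if AB: "A \<in> orderon_classes" "B \<in> orderon_classes" for A B
  proof -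
    obtain W U where "W \<in> A" "U \<in> B" using AB class_representative by metis
    then show ?thesis
      using AB class_dist_eq class_subset orderon_kernel by (intro exI[of _ W] exI[of _ U]) auto
  qed
  fix A B C
  show "0 \<le> class_dist A B"
  proof (cases "A \<in> orderon_classes \<and> B \<in> orderon_classes")
    case True
    then show ?thesis using rep[of A B] cut_shift_dist_nonneg by auto
  qed (auto simp: class_dist_def)
  show "class_dist A B = class_dist B A"
  proof (cases "A \<in> orderon_classes \<and> B \<in> orderon_classes")
    case True
    then show ?thesis using rep[of A B] cut_shift_dist_commute by auto
  qed (auto simp: class_dist_def)
  assume A: "A \<in> orderon_classes" and B: "B \<in> orderon_classes"
  show "class_dist A B = 0 \<longleftrightarrow> A = B"
  proof
    assume z: "class_dist A B = 0"
    obtain W U where WU: "W \<in> A" "U \<in> B" using A B class_representative by metis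
    then have "(W, U) \<in> orderon_rel"
      using z class_dist_eq[OF A B WU] class_subset[OF A] class_subset[OF B] by (auto simp: orderon_rel_def)
    then show "A = B"
      using A B WU quotient_eqI[OF equiv_orderon_rel] unfolding orderon_classes_def by metis
  next
    assume "A = B"
    then show "class_dist A B = 0"
      using A class_representative[OF A] class_dist_eq[OF A A] cut_shift_dist_refl orderon_kernel by metis
  qed
  assume C: "C \<in> orderon_classes"
  obtain W U Z where *: "W \<in> A" "U \<in> B" "Z \<in> C" using A B C class_representative by metis
  then show "class_dist A C \<le> class_dist A B + class_dist B C"
    using cut_shift_dist_triangle[of W U Z] class_subset[OF A *(1)] class_subset[OF B *(2)] class_subset[OF C *(3)]
    by (simp add: class_dist_eq[OF A B *(1,2)] class_dist_eq[OF A C *(1,3)] class_dist_eq[OF B C *(2,3)] orderon_kernel)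
qed

lemma compact_orderon_classes:
  assumes seq: "\<And>W :: nat \<Rightarrow> point \<times> point \<Rightarrow> real. (\<And>n. W n \<in> orderons) \<Longrightarrow>
      \<exists>V r. V \<in> orderons \<and> strict_mono r \<and> (\<lambda>n. cut_shift_dist (W (r n)) V) \<longlonglongrightarrow> 0"
  shows "compact_space (Metric_space.mtopology orderon_classes class_dist)"
proof -
  interpret Metric_space orderon_classes class_dist by (rule Metric_space_orderon_classes)
  show ?thesis
    unfolding compact_space_sequentially
  proof (intro allI impI)
    fix A :: "nat \<Rightarrow> (point \<times> point \<Rightarrow> real) set"
    assume "range A \<subseteq> orderon_classes"
    then have A: "A n \<in> orderon_classes" for n by auto
    have "\<forall>n. \<exists>W. W \<in> A n" using A class_representative by metis
    then obtain W where W: "W n \<in> A n" for n by metis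
    obtain V r where V: "V \<in> orderons" and r: "strict_mono r"
      and lim: "(\<lambda>n. cut_shift_dist (W (r n)) V) \<longlonglongrightarrow> 0"
      using seq[of W] class_subset[OF A W] by blast
    define B where "B = orderon_rel `` {V}"
    have B: "B \<in> orderon_classes" "V \<in> B" using orderon_class[OF V] by (auto simp: B_def)
    have "class_dist (A (r n)) B = cut_shift_dist (W (r n)) V" for n
      by (rule class_dist_eq[OF A B(1) W B(2)])
    then have "limitin mtopology (A \<circ> r) B sequentially"
      using lim A B(1) by (simp add: limitin_metric_dist_null comp_def)
    then show "\<exists>l r. l \<in> orderon_classes \<and> strict_mono r \<and> limitin mtopology (A \<circ> r) l sequentially"
      using B r by blast
  qed
qed

section \<open>Step kernels and their energy\<close>

text \<open>A finite measurable partition, given by the label of each point: cells may be empty, and refinement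
  becomes an equation between labels.\<close>

definition labelling :: "nat \<Rightarrow> (point \<Rightarrow> nat) \<Rightarrow> bool" where
  "labelling m c \<longleftrightarrow> c \<in> square_measure \<rightarrow>\<^sub>M count_space UNIV \<and> (\<forall>p\<in>unit_square. c p < m)"

definition cell :: "(point \<Rightarrow> nat) \<Rightarrow> nat \<Rightarrow> point set" where
  "cell c i = {p \<in> unit_square. c p = i}"

definition mass :: "(point \<Rightarrow> nat) \<Rightarrow> nat \<Rightarrow> real" where
  "mass c i = area (cell c i)"

definition step :: "(point \<Rightarrow> nat) \<Rightarrow> (nat \<Rightarrow> nat \<Rightarrow> real) \<Rightarrow> point \<times> point \<Rightarrow> real" where
  "step c \<alpha> = (\<lambda>(u, v). \<alpha> (c u) (c v))"

definition block :: "(point \<Rightarrow> nat) \<Rightarrow> (point \<times> point \<Rightarrow> real) \<Rightarrow> nat \<Rightarrow> nat \<Rightarrow> real" where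
  "block c V i j = (LINT z:cell c i \<times> cell c j|lebesgue. V z)"

definition average :: "(nat \<Rightarrow> real) \<Rightarrow> (nat \<Rightarrow> nat \<Rightarrow> real) \<Rightarrow> nat \<Rightarrow> nat \<Rightarrow> real" where
  "average \<mu> B i j = B i j / (\<mu> i * \<mu> j)"

definition energy :: "nat \<Rightarrow> (nat \<Rightarrow> real) \<Rightarrow> (nat \<Rightarrow> nat \<Rightarrow> real) \<Rightarrow> real" where
  "energy m \<mu> B = (\<Sum>i<m. \<Sum>j<m. average \<mu> B i j * B i j)"

text \<open>The constraints on the integrals of a kernel with values in \<open>[0,1]\<close>; in particular the integrals over
  null products vanish.\<close>

definition submass :: "nat \<Rightarrow> (nat \<Rightarrow> real) \<Rightarrow> (nat \<Rightarrow> nat \<Rightarrow> real) \<Rightarrow> bool" where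
  "submass m \<mu> B \<longleftrightarrow> (\<forall>i<m. 0 \<le> \<mu> i) \<and> (\<forall>i<m. \<forall>j<m. 0 \<le> B i j \<and> B i j \<le> \<mu> i * \<mu> j)"

lemma cell_sets: "labelling m c \<Longrightarrow> cell c i \<in> sets square_measure"
proof -
  assume "labelling m c"
  then have "c -` {i} \<inter> space square_measure \<in> sets square_measure"
    by (intro measurable_sets) (auto simp: labelling_def)
  moreover have "c -` {i} \<inter> space square_measure = cell c i" by (auto simp: cell_def)
  ultimately show ?thesis by simp
qed

lemma mass_nonneg [simp]: "0 \<le> mass c i"
  by (simp add: mass_def)

lemma step_kernel:
  assumes "labelling m c" shows "kernel (step c \<alpha>)"
proof -
  have c: "c \<in> square_measure \<rightarrow>\<^sub>M count_space UNIV" using assms by (simp add: labelling_def)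
  have "(\<lambda>z. (c (fst z), c (snd z))) \<in> square2_measure \<rightarrow>\<^sub>M count_space UNIV \<Otimes>\<^sub>M count_space UNIV"
    by (intro measurable_Pair measurable_compose[OF measurable_fst_square c] measurable_compose[OF measurable_snd_square c])
  then have "(\<lambda>z. (c (fst z), c (snd z))) \<in> square2_measure \<rightarrow>\<^sub>M count_space (UNIV :: (nat \<times> nat) set)"
    by (simp add: pair_measure_countable)
  then have "(\<lambda>z. (\<lambda>(i, j). \<alpha> i j) (c (fst z), c (snd z))) \<in> borel_measurable square2_measure"
    by (rule measurable_compose) simp
  then have m: "step c \<alpha> \<in> borel_measurable square2_measure"
    by (simp add: step_def case_prod_beta)
  have "\<bar>step c \<alpha> z\<bar> \<le> (\<Sum>i<m. \<Sum>j<m. \<bar>\<alpha> i j\<bar>)" if "z \<in> square2" for z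
  proof -
    have ij: "c (fst z) < m" "c (snd z) < m" using assms that by (auto simp: labelling_def)
    have "\<bar>\<alpha> (c (fst z)) (c (snd z))\<bar> \<le> (\<Sum>j<m. \<bar>\<alpha> (c (fst z)) j\<bar>)"
      using ij by (intro member_le_sum) auto
    also have "\<dots> \<le> (\<Sum>i<m. \<Sum>j<m. \<bar>\<alpha> i j\<bar>)"
      using ij by (intro member_le_sum[where f="\<lambda>i. \<Sum>j<m. \<bar>\<alpha> i j\<bar>"]) (auto intro: sum_nonneg)
    finally show ?thesis by (simp add: step_def case_prod_beta)
  qed
  then show ?thesis using m by (intro kernelI)
qed

lemma step_mult: "step c \<alpha> z * step c \<beta> z = step c (\<lambda>i j. \<alpha> i j * \<beta> i j) z"
  by (simp add: step_def case_prod_beta)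

text \<open>Integrating against a step kernel only sees the integrals over products of cells.\<close>

lemma integral_step_mult:
  assumes c: "labelling m c" and V: "kernel V"
  shows "(\<integral>z. step c \<alpha> z * V z \<partial>square2_measure) = (\<Sum>i<m. \<Sum>j<m. \<alpha> i j * block c V i j)"
proof -
  note cs = cell_sets[OF c]
  have "(\<integral>z. step c \<alpha> z * V z \<partial>square2_measure)
      = (\<integral>z. (\<Sum>i<m. \<Sum>j<m. \<alpha> i j * (indicator (cell c i \<times> cell c j) z * V z)) \<partial>square2_measure)"
  proof (rule Bochner_Integration.integral_cong[OF refl])
    fix z assume "z \<in> space square2_measure"
    then have z: "z \<in> square2" by simp
    then have ij: "c (fst z) < m" "c (snd z) < m" using c by (auto simp: labelling_def)
    have "indicator (cell c i \<times> cell c j) z = (if c (fst z) = i then if c (snd z) = j then 1 else 0 else 0 :: real)" for i j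
      using z by (simp add: indicator_def cell_def mem_Times_iff)
    then have "(\<Sum>i<m. \<Sum>j<m. \<alpha> i j * (indicator (cell c i \<times> cell c j) z * V z))
        = (\<Sum>i<m. \<Sum>j<m. if c (fst z) = i then if c (snd z) = j then \<alpha> i j * V z else 0 else 0)"
      by (intro sum.cong refl) simp
    also have "\<dots> = (\<Sum>i<m. if c (fst z) = i then \<Sum>j<m. if c (snd z) = j then \<alpha> i j * V z else 0 else 0)"
      by (intro sum.cong refl) simp
    also have "\<dots> = step c \<alpha> z * V z" using ij by (simp add: step_def case_prod_beta)
    finally show "step c \<alpha> z * V z = (\<Sum>i<m. \<Sum>j<m. \<alpha> i j * (indicator (cell c i \<times> cell c j) z * V z))"
      by simp
  qed
  also have "\<dots> = (\<Sum>i<m. \<Sum>j<m. \<alpha> i j * block c V i j)"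
    using kernel_integrable[OF kernel_rectangle[OF V cs cs]]
    by (simp add: Bochner_Integration.integral_sum block_def rectangle_integral[OF cs cs])
  finally show ?thesis .
qed

lemma block_one:
  assumes c: "labelling m c"
  shows "block c (\<lambda>_. 1) i j = mass c i * mass c j"
proof -
  note cs = cell_sets[OF c]
  have "block c (\<lambda>_. 1) i j = measure square2_measure (cell c i \<times> cell c j)"
    unfolding block_def rectangle_integral[OF cs cs]
    by (simp only: mult_1_right Bochner_Integration.integral_indicator sets.Int_space_eq2[OF pair_times(1)[OF cs cs]])
  then show ?thesis using pair_times(3)[OF cs cs] by (simp add: mass_def)
qed

lemma kernel_const: "kernel (\<lambda>_. C)"
  by (rule kernelI[of _ "\<bar>C\<bar>"]) auto

lemma integral_step:
  assumes c: "labelling m c"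
  shows "(\<integral>z. step c \<alpha> z \<partial>square2_measure) = (\<Sum>i<m. \<Sum>j<m. \<alpha> i j * (mass c i * mass c j))"
  using integral_step_mult[OF c kernel_const[of 1], of \<alpha>] by (simp add: block_one[OF c])

lemma sum_mass:
  assumes c: "labelling m c" shows "(\<Sum>i<m. mass c i) = 1"
proof -
  have "(\<Union>i<m. cell c i) = unit_square" using c by (auto simp: cell_def labelling_def)
  moreover have "area (\<Union>i<m. cell c i) = (\<Sum>i<m. mass c i)"
    unfolding mass_def
    by (rule L.finite_measure_finite_Union) (use cell_sets[OF c] in \<open>auto simp: disjoint_family_on_def cell_def\<close>)
  ultimately show ?thesis by simp
qed

text \<open>On null cells both sides vanish, which justifies the convention of dividing by 0 in the average.\<close>

lemma average_mult_mass:
  assumes "submass m \<mu> B" "i < m" "j < m"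
  shows "average \<mu> B i j * (\<mu> i * \<mu> j) = B i j"
proof (cases "\<mu> i * \<mu> j = 0")
  case True
  then have "B i j = 0" using assms by (metis submass_def order_antisym)
  then show ?thesis by (simp add: average_def)
qed (simp add: average_def)

lemma average_bounds:
  assumes "submass m \<mu> B" "i < m" "j < m"
  shows "0 \<le> average \<mu> B i j" "average \<mu> B i j \<le> 1"
proof -
  have *: "0 \<le> B i j" "B i j \<le> \<mu> i * \<mu> j" using assms by (auto simp: submass_def)
  then show "0 \<le> average \<mu> B i j" unfolding average_def by (meson divide_nonneg_nonneg order_trans)
  show "average \<mu> B i j \<le> 1"
  proof (cases "\<mu> i * \<mu> j = 0")
    case False
    then have "0 < \<mu> i * \<mu> j" using * by linarith
    then show ?thesis using * by (simp only: average_def divide_le_eq_1_pos)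
  qed (simp only: average_def, simp)
qed

lemma energy_bounds:
  assumes s: "submass m \<mu> B" and one: "(\<Sum>i<m. \<mu> i) = 1"
  shows "0 \<le> energy m \<mu> B" "energy m \<mu> B \<le> 1"
proof -
  have B: "0 \<le> B i j" "B i j \<le> \<mu> i * \<mu> j" if "i < m" "j < m" for i j
    using s that by (auto simp: submass_def)
  show "0 \<le> energy m \<mu> B"
    unfolding energy_def by (intro sum_nonneg mult_nonneg_nonneg) (use average_bounds[OF s] B in auto)
  have "energy m \<mu> B \<le> (\<Sum>i<m. \<Sum>j<m. \<mu> i * \<mu> j)"
    unfolding energy_def
  proof (intro sum_mono)
    fix i j assume "i \<in> {..<m}" "j \<in> {..<m}"
    then have ij: "i < m" "j < m" by auto
    have "average \<mu> B i j * B i j \<le> 1 * B i j"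
      using average_bounds[OF s ij] B[OF ij] by (intro mult_right_mono)
    then show "average \<mu> B i j * B i j \<le> \<mu> i * \<mu> j" using B[OF ij] by simp
  qed
  also have "\<dots> = 1" by (simp add: sum_distrib_left[symmetric] sum_distrib_right[symmetric] one)
  finally show "energy m \<mu> B \<le> 1" .
qed

text \<open>The matrix \<open>B\<close> arises from \<open>B'\<close> by merging the fine labels with the same image under \<open>r\<close>.\<close>

definition coarsens :: "nat \<Rightarrow> nat \<Rightarrow> (nat \<Rightarrow> nat) \<Rightarrow> (nat \<Rightarrow> nat \<Rightarrow> real) \<Rightarrow> (nat \<Rightarrow> nat \<Rightarrow> real) \<Rightarrow> bool" where
  "coarsens m n r B B' \<longleftrightarrow> (\<forall>i<n. r i < m) \<and>
     (\<forall>i<m. \<forall>j<m. B i j = (\<Sum>i'<n. \<Sum>j'<n. of_bool (r i' = i \<and> r j' = j) * B' i' j'))"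

text \<open>Sums with weights that depend on coarse labels may be evaluated on the fine level.\<close>

lemma sum_coarsens:
  assumes "coarsens m n r B B'"
  shows "(\<Sum>i<m. \<Sum>j<m. g i j * B i j) = (\<Sum>i'<n. \<Sum>j'<n. g (r i') (r j') * B' i' j')"
proof -
  have r: "r i < m" if "i < n" for i using assms that by (simp add: coarsens_def)
  have "(\<Sum>i<m. \<Sum>j<m. g i j * B i j)
      = (\<Sum>i<m. \<Sum>j<m. \<Sum>i'<n. \<Sum>j'<n. g i j * (of_bool (r i' = i \<and> r j' = j) * B' i' j'))"
  proof (intro sum.cong refl)
    fix i j assume "i \<in> {..<m}" "j \<in> {..<m}"
    then have "B i j = (\<Sum>i'<n. \<Sum>j'<n. of_bool (r i' = i \<and> r j' = j) * B' i' j')"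
      using assms unfolding coarsens_def by blast
    then show "g i j * B i j = (\<Sum>i'<n. \<Sum>j'<n. g i j * (of_bool (r i' = i \<and> r j' = j) * B' i' j'))"
      by (simp only: sum_distrib_left)
  qed
  also have "\<dots> = (\<Sum>i<m. \<Sum>i'<n. \<Sum>j<m. \<Sum>j'<n. g i j * (of_bool (r i' = i \<and> r j' = j) * B' i' j'))"
    by (intro sum.cong refl sum.swap)
  also have "\<dots> = (\<Sum>i'<n. \<Sum>i<m. \<Sum>j<m. \<Sum>j'<n. g i j * (of_bool (r i' = i \<and> r j' = j) * B' i' j'))"
    by (rule sum.swap)
  also have "\<dots> = (\<Sum>i'<n. \<Sum>i<m. \<Sum>j'<n. \<Sum>j<m. g i j * (of_bool (r i' = i \<and> r j' = j) * B' i' j'))"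
    by (intro sum.cong refl sum.swap)
  also have "\<dots> = (\<Sum>i'<n. \<Sum>j'<n. \<Sum>i<m. \<Sum>j<m. g i j * (of_bool (r i' = i \<and> r j' = j) * B' i' j'))"
    by (intro sum.cong refl sum.swap)
  also have "\<dots> = (\<Sum>i'<n. \<Sum>j'<n. g (r i') (r j') * B' i' j')"
  proof (intro sum.cong refl)
    fix i' j' assume "i' \<in> {..<n}" "j' \<in> {..<n}"
    then have ij: "r i' < m" "r j' < m" using r by auto
    have "(\<Sum>i<m. \<Sum>j<m. g i j * (of_bool (r i' = i \<and> r j' = j) * B' i' j'))
        = (\<Sum>i<m. \<Sum>j<m. if r i' = i then if r j' = j then g i j * B' i' j' else 0 else 0)"
      by (intro sum.cong refl) simp
    also have "\<dots> = (\<Sum>i<m. if r i' = i then \<Sum>j<m. if r j' = j then g i j * B' i' j' else 0 else 0)"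
      by (intro sum.cong refl) simp
    also have "\<dots> = g (r i') (r j') * B' i' j'" using ij by simp
    finally show "(\<Sum>i<m. \<Sum>j<m. g i j * (of_bool (r i' = i \<and> r j' = j) * B' i' j')) = g (r i') (r j') * B' i' j'" .
  qed
  finally show ?thesis .
qed

lemma AE_pair_square:
  assumes "AE p in square_measure. P p"
  shows "AE z in square2_measure. P (fst z) \<and> P (snd z)"
proof -
  obtain N where N: "{p \<in> space square_measure. \<not> P p} \<subseteq> N" "N \<in> null_sets square_measure"
    using assms by (auto simp: eventually_ae_filter)
  have NQ: "N \<in> sets square_measure" using N(2) by (rule null_setsD2)
  have 1: "N \<times> unit_square \<in> null_sets square2_measure" "unit_square \<times> N \<in> null_sets square2_measure"
    using N(2) pair_times[OF NQ sets_lebesgue_on_refl] pair_times[OF sets_lebesgue_on_refl NQ]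
    by (auto simp: null_sets_def)
  show ?thesis
    by (rule AE_I'[OF null_sets.Un[OF 1]]) (use N(1) in auto)
qed

text \<open>The variance of the absolute value is nonnegative.\<close>

lemma integral_abs_power2_le:
  assumes V: "kernel V"
  shows "(\<integral>z. \<bar>V z\<bar> \<partial>square2_measure)\<^sup>2 \<le> (\<integral>z. (V z)\<^sup>2 \<partial>square2_measure)"
proof -
  define a where "a = (\<integral>z. \<bar>V z\<bar> \<partial>square2_measure)"
  note int = kernel_integrable[OF kernel_power2[OF V]] kernel_integrable[OF kernel_abs[OF V]]
  have "0 \<le> (\<integral>z. (\<bar>V z\<bar> - a)\<^sup>2 \<partial>square2_measure)" by (rule integral_nonneg_AE) auto
  also have "\<dots> = (\<integral>z. (V z)\<^sup>2 - 2 * a * \<bar>V z\<bar> + a\<^sup>2 \<partial>square2_measure)"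
    by (intro Bochner_Integration.integral_cong refl) (simp add: power2_diff)
  also have "\<dots> = (\<integral>z. (V z)\<^sup>2 \<partial>square2_measure) - 2 * a * a + a\<^sup>2"
    using int by (simp add: a_def)
  finally show ?thesis by (simp add: a_def power2_eq_square)
qed

text \<open>Pythagoras: averages over the coarser products of cells are orthogonal to the difference of the two
  averages, so the squared \<open>L\<^sup>2\<close> norm of the difference is the difference of the energies.  This serves both
  the partitions of a given kernel and the limit partitions, which refine each other only almost
  everywhere; hence the refinement is assumed almost everywhere and the matrices are arbitrary.\<close>

lemma energy_increment:
  assumes c: "labelling m c" and c': "labelling n c'" and r: "AE p in square_measure. c p = r (c' p)"
    and s: "submass m (mass c) B" and s': "submass n (mass c') B'"
    and co: "coarsens m n r B B'"
  shows "(L1_norm (\<lambda>z. step c' (average (mass c') B') z - step c (average (mass c) B) z))\<^sup>2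
      \<le> energy n (mass c') B' - energy m (mass c) B"
proof -
  define \<alpha> where "\<alpha> = average (mass c) B"
  define \<alpha>' where "\<alpha>' = average (mass c') B'"
  have massr: "mass c i = (\<Sum>i'<n. of_bool (r i' = i) * mass c' i')" for i
  proof -
    have "mass c i = area (\<Union>i'\<in>{i'\<in>{..<n}. r i' = i}. cell c' i')"
      unfolding mass_def
    proof (rule measure_eq_AE)
      show "AE p in square_measure. (p \<in> cell c i) = (p \<in> (\<Union>i'\<in>{i' \<in> {..<n}. r i' = i}. cell c' i'))"
        using r AE_space by eventually_elim (use c' in \<open>auto simp: cell_def labelling_def\<close>)
    qed (use cell_sets[OF c] cell_sets[OF c'] in auto)
    also have "\<dots> = (\<Sum>i'\<in>{i'\<in>{..<n}. r i' = i}. mass c' i')"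
      unfolding mass_def
      by (rule L.finite_measure_finite_Union) (use cell_sets[OF c'] in \<open>auto simp: disjoint_family_on_def cell_def\<close>)
    also have "\<dots> = (\<Sum>i'<n. of_bool (r i' = i) * mass c' i')"
      by (intro sum.mono_neutral_cong_left) auto
    finally show ?thesis .
  qed
  have com: "coarsens m n r (\<lambda>i j. mass c i * mass c j) (\<lambda>i j. mass c' i * mass c' j)"
    using co unfolding coarsens_def massr sum_product
    by (auto intro!: sum.cong simp: of_bool_conj)
  let ?D = "\<lambda>i j. \<alpha>' i j - \<alpha> (r i) (r j)"
  have k: "kernel (\<lambda>z. step c' \<alpha>' z - step c \<alpha> z)" using c c' by (intro kernel_diff step_kernel)
  have "(\<integral>z. (step c' \<alpha>' z - step c \<alpha> z)\<^sup>2 \<partial>square2_measure)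
      = (\<integral>z. step c' (\<lambda>i j. (?D i j)\<^sup>2) z \<partial>square2_measure)"
  proof (rule integral_cong_AE)
    show "AE z in square2_measure. (step c' \<alpha>' z - step c \<alpha> z)\<^sup>2 = step c' (\<lambda>i j. (?D i j)\<^sup>2) z"
      using AE_pair_square[OF r] by eventually_elim (simp add: step_def case_prod_beta)
    show "(\<lambda>z. (step c' \<alpha>' z - step c \<alpha> z)\<^sup>2) \<in> borel_measurable square2_measure"
      using kernel_power2[OF k] by (rule kernel_measurable)
  qed (use kernel_measurable[OF step_kernel[OF c']] in auto)
  also have "\<dots> = (\<Sum>i<n. \<Sum>j<n. (?D i j)\<^sup>2 * (mass c' i * mass c' j))"
    by (rule integral_step[OF c'])
  also have "\<dots> = (\<Sum>i<n. \<Sum>j<n. \<alpha>' i j * B' i j - 2 * (\<alpha> (r i) (r j) * B' i j)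
      + (\<alpha> (r i) (r j))\<^sup>2 * (mass c' i * mass c' j))"
  proof (intro sum.cong refl)
    fix i j assume "i \<in> {..<n}" "j \<in> {..<n}"
    then have e: "B' i j = \<alpha>' i j * (mass c' i * mass c' j)"
      using average_mult_mass[OF s'] by (simp add: \<alpha>'_def)
    show "(?D i j)\<^sup>2 * (mass c' i * mass c' j) = \<alpha>' i j * B' i j - 2 * (\<alpha> (r i) (r j) * B' i j)
      + (\<alpha> (r i) (r j))\<^sup>2 * (mass c' i * mass c' j)"
      unfolding e by (simp add: power2_eq_square algebra_simps)
  qed
  also have "\<dots> = energy n (mass c') B' - 2 * (\<Sum>i<n. \<Sum>j<n. \<alpha> (r i) (r j) * B' i j)
      + (\<Sum>i<n. \<Sum>j<n. (\<alpha> (r i) (r j))\<^sup>2 * (mass c' i * mass c' j))"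
    by (simp add: energy_def \<alpha>'_def sum.distrib sum_subtractf sum_distrib_left)
  also have "(\<Sum>i<n. \<Sum>j<n. \<alpha> (r i) (r j) * B' i j) = energy m (mass c) B"
    unfolding energy_def \<alpha>_def[symmetric] by (rule sum_coarsens[OF co, symmetric])
  also have "(\<Sum>i<n. \<Sum>j<n. (\<alpha> (r i) (r j))\<^sup>2 * (mass c' i * mass c' j)) = energy m (mass c) B"
  proof -
    have "(\<Sum>i<n. \<Sum>j<n. (\<alpha> (r i) (r j))\<^sup>2 * (mass c' i * mass c' j))
        = (\<Sum>i<m. \<Sum>j<m. (\<alpha> i j)\<^sup>2 * (mass c i * mass c j))"
      by (rule sum_coarsens[OF com, symmetric])
    also have "\<dots> = energy m (mass c) B"
      unfolding energy_def
    proof (intro sum.cong refl)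
      fix i j assume "i \<in> {..<m}" "j \<in> {..<m}"
      then show "(\<alpha> i j)\<^sup>2 * (mass c i * mass c j) = average (mass c) B i j * B i j"
        using average_mult_mass[OF s, of i j] by (simp add: \<alpha>_def power2_eq_square mult.assoc)
    qed
    finally show ?thesis .
  qed
  finally show ?thesis
    using integral_abs_power2_le[OF k] by (simp add: \<alpha>_def \<alpha>'_def)
qed

section \<open>Weak regularity\<close>

definition unit_kernel :: "(point \<times> point \<Rightarrow> real) \<Rightarrow> bool" where
  "unit_kernel W \<longleftrightarrow> kernel W \<and> (\<forall>z\<in>square2. 0 \<le> W z \<and> W z \<le> 1)"

lemma orderon_unit_kernel:
  assumes W: "W \<in> orderons" shows "unit_kernel W"
proof -
  have "W \<in> square2 \<rightarrow>\<^sub>E {0..1}" using W by (simp add: orderons_def)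
  then have "W z \<in> {0..1}" if "z \<in> square2" for z
    using that by (rule PiE_mem)
  then show ?thesis using orderon_kernel[OF W] by (simp add: unit_kernel_def)
qed

lemma block_submass:
  assumes W: "unit_kernel W" and c: "labelling m c"
  shows "submass m (mass c) (block c W)"
proof -
  note cs = cell_sets[OF c]
  have k: "kernel W" using W by (simp add: unit_kernel_def)
  have W01: "0 \<le> W z" "W z \<le> 1" if "z \<in> square2" for z
    using W that unfolding unit_kernel_def by blast+
  have "0 \<le> block c W i j" for i j
    unfolding block_def rectangle_integral[OF cs cs]
    by (rule Bochner_Integration.integral_nonneg) (use W01 in \<open>auto simp: indicator_def\<close>)
  moreover have "block c W i j \<le> mass c i * mass c j" for i j
    unfolding block_one[OF c, symmetric] unfolding block_def rectangle_integral[OF cs cs]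
    by (intro integral_mono kernel_integrable kernel_rectangle[OF _ cs cs] k kernel_const)
      (use W01 in \<open>auto simp: indicator_def\<close>)
  ultimately show ?thesis by (simp add: submass_def)
qed

lemma block_coarsens:
  assumes W: "kernel W" and c: "labelling m c" and c': "labelling n c'"
    and r: "\<And>p. p \<in> unit_square \<Longrightarrow> c p = r (c' p)" and rm: "\<And>i. i < n \<Longrightarrow> r i < m"
  shows "coarsens m n r (block c W) (block c' W)"
proof -
  note cs = cell_sets[OF c]
  have "block c W i j = (\<Sum>i'<n. \<Sum>j'<n. of_bool (r i' = i \<and> r j' = j) * block c' W i' j')" for i j
  proof -
    have "block c W i j = (\<integral>z. step c' (\<lambda>i' j'. of_bool (r i' = i \<and> r j' = j)) z * W z \<partial>square2_measure)"
      unfolding block_def rectangle_integral[OF cs cs]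
      by (intro Bochner_Integration.integral_cong refl) (auto simp: step_def cell_def indicator_def r)
    then show ?thesis by (simp add: integral_step_mult[OF c' W])
  qed
  then show ?thesis using rm by (simp add: coarsens_def)
qed

abbreviation cell_energy :: "nat \<Rightarrow> (point \<Rightarrow> nat) \<Rightarrow> (point \<times> point \<Rightarrow> real) \<Rightarrow> real" where
  "cell_energy m c W \<equiv> energy m (mass c) (block c W)"

abbreviation projection :: "(point \<Rightarrow> nat) \<Rightarrow> (point \<times> point \<Rightarrow> real) \<Rightarrow> point \<times> point \<Rightarrow> real" where
  "projection c W \<equiv> step c (average (mass c) (block c W))"

text \<open>Split every cell by a pair \<open>S\<close>, \<open>T\<close> that nearly attains the cut norm.  On \<open>S \<times> T\<close> the kernel has
  the same integral as its new averages, so the cut norm is at most twice the \<open>L\<^sup>1\<close> distance of the old and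
  new averages, which the energy increment controls.  The two membership bits of a point become the last
  two binary digits of its new label, whence the division by 4.\<close>

lemma regularity_step:
  assumes W: "unit_kernel W" and c: "labelling m c"
  shows "\<exists>c'. labelling (4 * m) c' \<and> (\<forall>p. c' p div 4 = c p) \<and>
     (cut_norm (\<lambda>z. W z - projection c W z))\<^sup>2 \<le> 4 * (cell_energy (4 * m) c' W - cell_energy m c W)"
proof -
  have k: "kernel W" using W by (simp add: unit_kernel_def)
  have kd: "kernel (\<lambda>z. W z - projection c W z)" using k step_kernel[OF c] by (rule kernel_diff)
  obtain S T where ST: "S \<in> sets square_measure" "T \<in> sets square_measure"
    and near: "cut_norm (\<lambda>z. W z - projection c W z) \<le> 2 * \<bar>LINT z:S \<times> T|lebesgue. W z - projection c W z\<bar>"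
    using cut_norm_near_sup[OF kd] by blast
  define c' where "c' p = 4 * c p + (2 * of_bool (p \<in> S) + of_bool (p \<in> T))" for p
  have cm: "c \<in> square_measure \<rightarrow>\<^sub>M count_space UNIV" using c by (simp add: labelling_def)
  have meas: "c' \<in> square_measure \<rightarrow>\<^sub>M count_space UNIV"
  proof -
    have 1: "(\<lambda>p. p \<in> S) \<in> square_measure \<rightarrow>\<^sub>M count_space UNIV" "(\<lambda>p. p \<in> T) \<in> square_measure \<rightarrow>\<^sub>M count_space UNIV"
      using ST by (auto simp: pred_def sets.Int_space_eq2 Int_def[symmetric] intro!: predE)
    have "(\<lambda>p. (\<lambda>(i, s, t). 4 * i + (2 * of_bool s + of_bool t)) (c p, p \<in> S, p \<in> T)) \<in> square_measure \<rightarrow>\<^sub>M count_space (UNIV :: nat set)"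
      using cm 1 by (intro measurable_compose[OF measurable_Pair[OF _ measurable_Pair]])
        (auto simp: pair_measure_countable)
    then show ?thesis by (simp add: c'_def[abs_def])
  qed
  have c4: "c' p div 4 = c p" for p by (auto simp: c'_def)
  have lab': "labelling (4 * m) c'"
  proof -
    have "c' p < 4 * m" if "p \<in> unit_square" for p
    proof -
      have "c p + 1 \<le> m" using c that by (simp add: labelling_def Suc_le_eq)
      then show ?thesis by (auto simp: c'_def)
    qed
    then show ?thesis using meas by (simp add: labelling_def)
  qed
  have s: "submass m (mass c) (block c W)" and s': "submass (4 * m) (mass c') (block c' W)"
    using block_submass W c lab' by auto
  have inc: "(L1_norm (\<lambda>z. projection c' W z - projection c W z))\<^sup>2
      \<le> cell_energy (4 * m) c' W - cell_energy m c W"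
  proof (rule energy_increment[OF c lab' _ s s', of "\<lambda>i. i div 4"])
    show "coarsens m (4 * m) (\<lambda>i. i div 4) (block c W) (block c' W)"
      by (rule block_coarsens[OF k c lab']) (auto simp: c4)
  qed (simp add: c4)
  \<comment> \<open>The rectangle \<open>S \<times> T\<close> is a union of products of new cells, so averaging does not change the integral over it.\<close>
  define \<beta> :: "nat \<Rightarrow> nat \<Rightarrow> real" where "\<beta> i j = of_bool ((i div 2) mod 2 = 1 \<and> j mod 2 = 1)" for i j
  have bits: "c' p mod 2 = 1 \<longleftrightarrow> p \<in> T" "(c' p div 2) mod 2 = 1 \<longleftrightarrow> p \<in> S" for p
    unfolding c'_def by (cases "p \<in> S"; cases "p \<in> T"; simp; presburger)+
  have ind: "indicator (S \<times> T) z = step c' \<beta> z" for z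
    by (cases z) (simp only: step_def \<beta>_def case_prod_conv bits indicator_def mem_Times_iff fst_conv snd_conv)
  have "(\<integral>z. step c' \<beta> z * W z \<partial>square2_measure) = (\<Sum>i<4*m. \<Sum>j<4*m. \<beta> i j * block c' W i j)"
    by (rule integral_step_mult[OF lab' k])
  also have "\<dots> = (\<Sum>i<4*m. \<Sum>j<4*m. \<beta> i j * average (mass c') (block c' W) i j * (mass c' i * mass c' j))"
    using average_mult_mass[OF s'] by (intro sum.cong refl) (simp add: mult.assoc)
  also have "\<dots> = (\<integral>z. step c' \<beta> z * projection c' W z \<partial>square2_measure)"
    unfolding step_mult by (rule integral_step[OF lab', symmetric])
  finally have eq: "(\<integral>z. step c' \<beta> z * W z \<partial>square2_measure) = (\<integral>z. step c' \<beta> z * projection c' W z \<partial>square2_measure)" .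
  have "(LINT z:S \<times> T|lebesgue. W z - projection c W z)
      = (LINT z:S \<times> T|lebesgue. projection c' W z - projection c W z)"
    unfolding rectangle_integral[OF ST] ind right_diff_distrib
    using eq kernel_integrable[OF kernel_mult[OF step_kernel[OF lab', of \<beta>] k]]
      kernel_integrable[OF kernel_mult[OF step_kernel[OF lab', of \<beta>] step_kernel[OF lab']]]
      kernel_integrable[OF kernel_mult[OF step_kernel[OF lab', of \<beta>] step_kernel[OF c]]]
    by simp
  then have "\<bar>LINT z:S \<times> T|lebesgue. W z - projection c W z\<bar>
      \<le> L1_norm (\<lambda>z. projection c' W z - projection c W z)"
    using rectangle_integral_le_L1[OF kernel_diff[OF step_kernel[OF lab'] step_kernel[OF c]] ST] by simp
  then have "cut_norm (\<lambda>z. W z - projection c W z)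
      \<le> 2 * L1_norm (\<lambda>z. projection c' W z - projection c W z)"
    using near by linarith
  then have "(cut_norm (\<lambda>z. W z - projection c W z))\<^sup>2
      \<le> (2 * L1_norm (\<lambda>z. projection c' W z - projection c W z))\<^sup>2"
    by (intro power_mono cut_norm_nonneg kd)
  then show ?thesis using lab' c4 inc by (intro exI[of _ c']) (auto simp: power_mult_distrib)
qed

text \<open>A greedy sequence of refining partitions; the last clause charges the cut norm at each level to the
  energy gained in the next one.\<close>

definition regular_filtration :: "(point \<times> point \<Rightarrow> real) \<Rightarrow> (nat \<Rightarrow> point \<Rightarrow> nat) \<Rightarrow> bool" where
  "regular_filtration W c \<longleftrightarrow> (\<forall>k. labelling (4 ^ k) (c k)) \<and> (\<forall>k p. c (Suc k) p div 4 = c k p) \<and>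
     (\<forall>k. (cut_norm (\<lambda>z. W z - projection (c k) W z))\<^sup>2
        \<le> 4 * (cell_energy (4 ^ Suc k) (c (Suc k)) W - cell_energy (4 ^ k) (c k) W))"

lemma regular_filtration_exists:
  assumes W: "unit_kernel W"
  shows "\<exists>c. regular_filtration W c"
proof -
  have "\<exists>c. \<forall>k. labelling (4 ^ k) (c k) \<and> ((\<forall>p. c (Suc k) p div 4 = c k p) \<and>
     (cut_norm (\<lambda>z. W z - projection (c k) W z))\<^sup>2
        \<le> 4 * (cell_energy (4 ^ Suc k) (c (Suc k)) W - cell_energy (4 ^ k) (c k) W))"
  proof (rule dependent_nat_choice[where P="\<lambda>k c. labelling (4 ^ k) c" and
      Q="\<lambda>k c c'. (\<forall>p. c' p div 4 = c p) \<and> (cut_norm (\<lambda>z. W z - projection c W z))\<^sup>2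
        \<le> 4 * (cell_energy (4 ^ Suc k) c' W - cell_energy (4 ^ k) c W)"])
    show "\<exists>c. labelling (4 ^ 0) c"
      by (rule exI[of _ "\<lambda>_. 0"]) (simp add: labelling_def)
    fix c k assume "labelling (4 ^ k) c"
    then show "\<exists>c'. labelling (4 ^ Suc k) c' \<and> (\<forall>p. c' p div 4 = c p) \<and>
       (cut_norm (\<lambda>z. W z - projection c W z))\<^sup>2 \<le> 4 * (cell_energy (4 ^ Suc k) c' W - cell_energy (4 ^ k) c W)"
      using regularity_step[OF W] by simp
  qed
  then show ?thesis by (auto simp: regular_filtration_def)
qed

text \<open>The energy increments in the window telescope to at most 1.\<close>

lemma regular_filtration_window:
  assumes W: "unit_kernel W" and c: "regular_filtration W c" and K: "K > 0"
  shows "\<exists>k\<in>{K0..<K0+K}. (cut_norm (\<lambda>z. W z - projection (c k) W z))\<^sup>2 \<le> 4 / K"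
proof (rule ccontr)
  assume "\<not> ?thesis"
  then have big: "(cut_norm (\<lambda>z. W z - projection (c k) W z))\<^sup>2 > 4 / K" if "k \<in> {K0..<K0+K}" for k
    using that by force
  let ?e = "\<lambda>k. cell_energy (4 ^ k) (c k) W"
  have lab: "labelling (4 ^ k) (c k)" for k using c by (simp add: regular_filtration_def)
  note e = energy_bounds[OF block_submass[OF W lab] sum_mass[OF lab]]
  have "4 = (\<Sum>k\<in>{K0..<K0+K}. 4 / real K)" using K by simp
  also have "\<dots> < (\<Sum>k\<in>{K0..<K0+K}. 4 * (?e (Suc k) - ?e k))"
  proof (rule sum_strict_mono)
    fix k assume "k \<in> {K0..<K0+K}"
    then show "4 / real K < 4 * (?e (Suc k) - ?e k)"
      using big c unfolding regular_filtration_def by (smt (verit))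
  qed (use K in auto)
  also have "\<dots> = 4 * (?e (K0 + K) - ?e K0)"
    unfolding sum_distrib_left[symmetric] by (subst sum_Suc_diff') auto
  also have "\<dots> \<le> 4" using e[of "K0 + K"] e[of K0] by simp
  finally show False by simp
qed

section \<open>Matching two labellings by a permutation of small squares\<close>

text \<open>Match equally labelled elements as long as possible.  The subtraction of cardinals is truncated, so the
  sum counts the elements of \<open>X\<close> in excess of those with the same label in \<open>Y\<close>.\<close>

lemma combinatorial_matching:
  fixes a :: "'a \<Rightarrow> nat" and b :: "'b \<Rightarrow> nat"
  assumes "finite X" "finite Y" "card X = card Y" "\<And>x. x \<in> X \<Longrightarrow> a x < m"
  shows "\<exists>\<pi>. bij_betw \<pi> X Y \<and>
     card {x\<in>X. a x \<noteq> b (\<pi> x)} \<le> (\<Sum>i<m. card {x\<in>X. a x = i} - card {y\<in>Y. b y = i})"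
  using assms
proof (induction "card X" arbitrary: X Y)
  case 0
  then show ?case by (intro exI[of _ "\<lambda>_. undefined"]) (auto simp: bij_betw_def)
next
  case (Suc n)
  show ?case
  proof (cases "\<exists>x\<in>X. \<exists>y\<in>Y. a x = b y")
    case True
    then obtain x y where xy: "x \<in> X" "y \<in> Y" "a x = b y" by blast
    have cX: "card (X - {x}) = n" "card (Y - {y}) = n" using Suc xy by auto
    obtain \<pi> where \<pi>: "bij_betw \<pi> (X - {x}) (Y - {y})"
      and le: "card {z\<in>X - {x}. a z \<noteq> b (\<pi> z)}
        \<le> (\<Sum>i<m. card {z\<in>X - {x}. a z = i} - card {z\<in>Y - {y}. b z = i})"
      using Suc.hyps(1)[of "X - {x}" "Y - {y}"] cX Suc.prems by auto
    define \<rho> where "\<rho> = \<pi>(x := y)"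
    have "bij_betw \<rho> (X - {x}) (Y - {y})"
      using \<pi> by (rule bij_betw_cong[THEN iffD1, rotated]) (simp add: \<rho>_def)
    then have "bij_betw \<rho> (insert x (X - {x})) (insert y (Y - {y}))"
      using notIn_Un_bij_betw[of x "X - {x}" \<rho> "Y - {y}"] by (simp add: \<rho>_def)
    then have b: "bij_betw \<rho> X Y" using xy by (simp add: insert_absorb)
    have "{z\<in>X. a z \<noteq> b (\<rho> z)} = {z\<in>X - {x}. a z \<noteq> b (\<pi> z)}"
      using xy by (auto simp: \<rho>_def)
    moreover have "card {z\<in>X - {x}. a z = i} - card {z\<in>Y - {y}. b z = i}
        = card {z\<in>X. a z = i} - card {z\<in>Y. b z = i}" for i
    proof (cases "a x = i")
      case True
      have "{z\<in>X - {x}. a z = i} = {z\<in>X. a z = i} - {x}" "{z\<in>Y - {y}. b z = i} = {z\<in>Y. b z = i} - {y}"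
        by auto
      moreover have "x \<in> {z\<in>X. a z = i}" "y \<in> {z\<in>Y. b z = i}" using xy True by auto
      moreover have "card {z\<in>X. a z = i} > 0"
        using Suc.prems(1) xy True by (auto simp: card_gt_0_iff)
      moreover have "card {z\<in>Y. b z = i} > 0"
        using Suc.prems(2) xy True by (auto simp: card_gt_0_iff)
      ultimately show ?thesis using Suc.prems by simp
    next
      case False
      then have "{z\<in>X - {x}. a z = i} = {z\<in>X. a z = i}" "{z\<in>Y - {y}. b z = i} = {z\<in>Y. b z = i}"
        using xy by auto
      then show ?thesis by simp
    qed
    ultimately show ?thesis using b le by (intro exI[of _ \<rho>]) simp
  next
    case False
    obtain \<pi> where \<pi>: "bij_betw \<pi> X Y"
      using finite_same_card_bij[OF Suc.prems(1-3)] by blast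
    have "card {x\<in>X. a x \<noteq> b (\<pi> x)} \<le> card X" using Suc.prems(1) by (intro card_mono) auto
    also have "card X = card (\<Union>i<m. {x\<in>X. a x = i})"
      by (rule arg_cong[of _ _ card]) (use Suc.prems(4) in auto)
    also have "\<dots> = (\<Sum>i<m. card {x\<in>X. a x = i})"
      using Suc.prems(1) by (intro card_UN_disjoint) auto
    also have "\<dots> = (\<Sum>i<m. card {x\<in>X. a x = i} - card {y\<in>Y. b y = i})"
    proof (intro sum.cong refl)
      fix i
      have "{x\<in>X. a x = i} = {} \<or> {y\<in>Y. b y = i} = {}" using False by auto
      then show "card {x\<in>X. a x = i} = card {x\<in>X. a x = i} - card {y\<in>Y. b y = i}"
        by (elim disjE) (simp_all only: card.empty diff_0_eq_0 minus_nat.diff_0)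
    qed
    finally show ?thesis using \<pi> by blast
  qed
qed

text \<open>Left-open intervals, because distribution functions measure left-open intervals.\<close>

definition grid_cell :: "nat \<Rightarrow> nat \<times> nat \<Rightarrow> point set" where
  "grid_cell N g = {real (fst g) / N<..(real (fst g) + 1) / N} \<times> {real (snd g) / N<..(real (snd g) + 1) / N}"

definition grid_index :: "nat \<Rightarrow> point \<Rightarrow> nat \<times> nat" where
  "grid_index N p = (nat (\<lceil>N * fst p\<rceil> - 1), nat (\<lceil>N * snd p\<rceil> - 1))"

definition grid :: "nat \<Rightarrow> (nat \<times> nat) set" where
  "grid N = {..<N} \<times> {..<N}"

definition open_square :: "point set" where
  "open_square = {0<..1} \<times> {0<..1}"

text \<open>Translates the grid cell \<open>g\<close> to the grid cell \<open>\<pi> g\<close>; the edges where a coordinate is 0 stay fixed, which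
  makes the map a bijection of the closed square.\<close>

definition grid_map :: "nat \<Rightarrow> (nat \<times> nat \<Rightarrow> nat \<times> nat) \<Rightarrow> point \<Rightarrow> point" where
  "grid_map N \<pi> p = (if p \<in> open_square then
     let g = grid_index N p; h = \<pi> g in
       ((real (fst h) - real (fst g)) / N, (real (snd h) - real (snd g)) / N) + p else p)"

lemma finite_grid [simp]: "finite (grid N)" by (simp add: grid_def)

lemma open_square_subset: "open_square \<subseteq> unit_square"
  by (auto simp: open_square_def unit_square_def)

lemma grid_index_unique:
  assumes "N > 0" "p \<in> grid_cell N g" shows "grid_index N p = g"
proof -
  have *: "\<lceil>N * x\<rceil> = int i + 1" if "real i / N < x" "x \<le> (real i + 1) / N" for x :: real and i :: nat
    using that assms(1) by (intro ceiling_unique) (auto simp: field_simps)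
  obtain i j where g: "g = (i, j)" by (cases g)
  have "real i / N < fst p" "fst p \<le> (real i + 1) / N" "real j / N < snd p" "snd p \<le> (real j + 1) / N"
    using assms(2) by (auto simp: g grid_cell_def)
  then show ?thesis using *[of i "fst p"] *[of j "snd p"] by (simp add: grid_index_def g)
qed

lemma grid_index_cell:
  assumes N: "N > 0" and p: "p \<in> open_square"
  shows "grid_index N p \<in> grid N" "p \<in> grid_cell N (grid_index N p)"
proof -
  have *: "nat (\<lceil>N * x\<rceil> - 1) < N \<and> real (nat (\<lceil>N * x\<rceil> - 1)) / N < x \<and> x \<le> (real (nat (\<lceil>N * x\<rceil> - 1)) + 1) / N"
    if "0 < x" "x \<le> 1" for x :: real
  proof -
    have pos: "0 < N * x" using N that by simp
    then have c1: "1 \<le> \<lceil>N * x\<rceil>" by (simp add: less_ceiling_iff one_le_ceiling)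
    have cN: "\<lceil>N * x\<rceil> \<le> int N" using N that by (simp add: ceiling_le_iff mult_left_le)
    have r: "real (nat (\<lceil>N * x\<rceil> - 1)) = of_int \<lceil>N * x\<rceil> - 1" using c1 by simp
    have "of_int \<lceil>N * x\<rceil> - 1 < N * x" "N * x \<le> of_int \<lceil>N * x\<rceil>" using ceiling_correct[of "N * x"] by auto
    then have "real (nat (\<lceil>N * x\<rceil> - 1)) / N < x" "x \<le> (real (nat (\<lceil>N * x\<rceil> - 1)) + 1) / N"
      unfolding r using N by (auto simp: field_simps)
    then show ?thesis using c1 cN N by (auto simp: nat_less_iff)
  qed
  have "0 < fst p" "fst p \<le> 1" "0 < snd p" "snd p \<le> 1" using p by (auto simp: open_square_def)
  then show "grid_index N p \<in> grid N" "p \<in> grid_cell N (grid_index N p)"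
    using *[of "fst p"] *[of "snd p"] by (auto simp: grid_index_def grid_def grid_cell_def mem_Times_iff)
qed

lemma grid_cell_subset:
  assumes "N > 0" "g \<in> grid N" shows "grid_cell N g \<subseteq> open_square"
proof -
  have *: "{real i / N<..(real i + 1) / N} \<subseteq> {0<..1}" if "i < N" for i
  proof -
    have "0 \<le> real i / N" "(real i + 1) / N \<le> 1" using that assms(1) by (auto simp: field_simps)
    then show ?thesis unfolding subset_iff greaterThanAtMost_iff by linarith
  qed
  have "fst g < N" "snd g < N" using assms(2) by (auto simp: grid_def)
  then show ?thesis using *[of "fst g"] *[of "snd g"]
    unfolding grid_cell_def open_square_def by (intro Sigma_mono) auto
qed

lemma grid_cell_iff:
  assumes "N > 0" "g \<in> grid N"
  shows "p \<in> grid_cell N g \<longleftrightarrow> p \<in> open_square \<and> grid_index N p = g"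
  using grid_index_unique[OF assms(1)] grid_index_cell[OF assms(1)] grid_cell_subset[OF assms] by blast

lemma Ioc_times_sets: "{a<..b} \<times> {c<..d} \<in> sets (lebesgue :: (real \<times> real) measure)"
  by (rule lebesgue_times) auto

lemma grid_cell_sets:
  assumes "N > 0" "g \<in> grid N"
  shows "grid_cell N g \<in> sets square_measure" "area (grid_cell N g) = 1 / (real N)\<^sup>2"
proof -
  have sub: "grid_cell N g \<subseteq> unit_square" using grid_cell_subset[OF assms] open_square_subset by blast
  then show "grid_cell N g \<in> sets square_measure"
    by (simp add: sets_square_iff grid_cell_def Ioc_times_sets)
  have "emeasure lebesgue (grid_cell N g) = ennreal (1 / N) * ennreal (1 / N)"
  proof -
    have "emeasure lebesgue {real i / N<..(real i + 1) / N} = ennreal (1 / N)" for i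
      by (simp add: divide_right_mono diff_divide_distrib[symmetric])
    then show ?thesis unfolding grid_cell_def by (subst lebesgue_times(2)) simp_all
  qed
  also have "\<dots> = ennreal (1 / (real N)\<^sup>2)" by (simp add: ennreal_mult[symmetric] power2_eq_square)
  finally show "area (grid_cell N g) = 1 / (real N)\<^sup>2"
    using sub by (simp add: emeasure_restrict_space measure_def)
qed

lemma open_square_sets: "open_square \<in> sets square_measure"
  using open_square_subset by (auto simp: sets_square_iff open_square_def Ioc_times_sets)

lemma measure_unit_minus_open: "area (unit_square - open_square) = 0"
proof -
  have "emeasure lebesgue open_square = 1"
    unfolding open_square_def by (subst lebesgue_times(2)) auto
  then have "area open_square = 1"
    using open_square_subset by (simp add: emeasure_restrict_space measure_def)
  then show ?thesis
    using L.finite_measure_Diff[OF sets_lebesgue_on_refl open_square_sets open_square_subset] by simp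
qed

lemma AE_open_square: "AE p in square_measure. p \<notin> unit_square - open_square"
proof (rule AE_not_in)
  show "unit_square - open_square \<in> null_sets square_measure"
    using open_square_sets measure_unit_minus_open by (auto simp: null_sets_def L.emeasure_eq_measure)
qed

text \<open>The edges on the left and at the bottom are the part of the closed square outside all grid cells.\<close>

lemma grid_decomposition:
  assumes N: "N > 0" and sets: "A \<inter> (unit_square - open_square) \<in> sets square_measure"
    "\<And>g. g \<in> grid N \<Longrightarrow> A \<inter> grid_cell N g \<in> sets square_measure" and sub: "A \<subseteq> unit_square"
  shows "A \<in> sets square_measure"
    and "area A = area (A \<inter> (unit_square - open_square))
       + (\<Sum>g\<in>grid N. area (A \<inter> grid_cell N g))"
proof -
  have eq: "A = (A \<inter> (unit_square - open_square)) \<union> (\<Union>g\<in>grid N. A \<inter> grid_cell N g)"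
  proof (intro equalityI subsetI)
    fix p assume p: "p \<in> A"
    show "p \<in> (A \<inter> (unit_square - open_square)) \<union> (\<Union>g\<in>grid N. A \<inter> grid_cell N g)"
    proof (cases "p \<in> open_square")
      case True
      then show ?thesis using p grid_index_cell[OF N True] by blast
    qed (use p sub in blast)
  qed blast
  have U: "(\<Union>g\<in>grid N. A \<inter> grid_cell N g) \<in> sets square_measure"
    by (intro sets.finite_UN sets(2)) auto
  show "A \<in> sets square_measure" by (subst eq) (intro sets.Un sets(1) U)
  have "area A = area (A \<inter> (unit_square - open_square))
      + area (\<Union>g\<in>grid N. A \<inter> grid_cell N g)"
    by (subst eq, rule L.finite_measure_Union) (use sets(1) U grid_cell_subset[OF N] in auto)
  also have "area (\<Union>g\<in>grid N. A \<inter> grid_cell N g)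
      = (\<Sum>g\<in>grid N. area (A \<inter> grid_cell N g))"
    by (rule L.finite_measure_finite_Union)
      (use sets(2) grid_cell_iff[OF N] in \<open>auto simp: disjoint_family_on_def\<close>)
  finally show "area A = area (A \<inter> (unit_square - open_square))
       + (\<Sum>g\<in>grid N. area (A \<inter> grid_cell N g))" .
qed

lemma grid_map_cell:
  assumes N: "N > 0" and g: "g \<in> grid N" and h: "\<pi> g \<in> grid N" and p: "p \<in> grid_cell N g"
  shows "grid_map N \<pi> p = ((real (fst (\<pi> g)) - real (fst g)) / N, (real (snd (\<pi> g)) - real (snd g)) / N) + p"
    and "grid_map N \<pi> p \<in> grid_cell N (\<pi> g)"
proof -
  have "p \<in> open_square" "grid_index N p = g" using grid_cell_iff[OF N g] p by auto
  then show *: "grid_map N \<pi> p = ((real (fst (\<pi> g)) - real (fst g)) / N, (real (snd (\<pi> g)) - real (snd g)) / N) + p"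
    by (simp add: grid_map_def Let_def)
  show "grid_map N \<pi> p \<in> grid_cell N (\<pi> g)"
    unfolding * using p by (auto simp: grid_cell_def diff_divide_distrib add_divide_distrib)
qed

lemma grid_map_inverse:
  assumes N: "N > 0" and \<pi>: "\<And>g. g \<in> grid N \<Longrightarrow> \<pi> g \<in> grid N" and \<sigma>: "\<And>g. g \<in> grid N \<Longrightarrow> \<sigma> (\<pi> g) = g"
    and p: "p \<in> unit_square"
  shows "grid_map N \<pi> p \<in> unit_square" "grid_map N \<sigma> (grid_map N \<pi> p) = p"
proof -
  have "grid_map N \<pi> p \<in> unit_square \<and> grid_map N \<sigma> (grid_map N \<pi> p) = p"
  proof (cases "p \<in> open_square")
    case True
    define g where "g = grid_index N p"
    have g: "g \<in> grid N" "p \<in> grid_cell N g" using grid_index_cell[OF N True] by (auto simp: g_def)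
    note 1 = grid_map_cell[where \<pi>=\<pi>, OF N g(1) \<pi>[OF g(1)] g(2)]
    have s: "\<sigma> (\<pi> g) = g" using \<sigma>[OF g(1)] .
    note 2 = grid_map_cell(1)[where \<pi>=\<sigma>, OF N \<pi>[OF g(1)] _ 1(2), unfolded s, OF g(1)]
    have "grid_map N \<sigma> (grid_map N \<pi> p) = p"
      unfolding 2 unfolding 1(1) by (cases p) (simp add: diff_divide_distrib)
    moreover have "grid_map N \<pi> p \<in> unit_square"
      using 1(2) grid_cell_subset[OF N \<pi>[OF g(1)]] open_square_subset by blast
    ultimately show ?thesis by simp
  qed (use p in \<open>auto simp: grid_map_def\<close>)
  then show "grid_map N \<pi> p \<in> unit_square" "grid_map N \<sigma> (grid_map N \<pi> p) = p" by auto
qed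

lemma grid_map_measure_preserving:
  assumes N: "N > 0" and \<pi>: "bij_betw \<pi> (grid N) (grid N)"
  shows "measure_preserving square_measure (grid_map N \<pi>)"
proof -
  let ?f = "grid_map N \<pi>"
  have \<pi>g: "\<pi> g \<in> grid N" if "g \<in> grid N" for g using \<pi> that by (rule bij_betw_apply)
  have \<sigma>: "the_inv_into (grid N) \<pi> (\<pi> g) = g" if "g \<in> grid N" for g
    using the_inv_into_f_f[OF bij_betw_imp_inj_on[OF \<pi>] that] .
  have into: "?f p \<in> unit_square" if "p \<in> unit_square" for p
    using grid_map_inverse(1)[OF N \<pi>g \<sigma> that] .
  have main: "?f -` A \<inter> unit_square \<in> sets square_measure \<and>
      area (?f -` A \<inter> unit_square) = area A"
    if A: "A \<in> sets square_measure" for A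
  proof -
    define B where "B = ?f -` A \<inter> unit_square"
    define v where "v g = ((real (fst (\<pi> g)) - real (fst g)) / N, (real (snd (\<pi> g)) - real (snd g)) / N)" for g
    have AQ: "A \<subseteq> unit_square" using A by (simp add: sets_square_iff)
    have BE: "B \<inter> (unit_square - open_square) = A \<inter> (unit_square - open_square)"
      using AQ by (auto simp: B_def grid_map_def)
    have AE: "A \<inter> (unit_square - open_square) \<in> sets square_measure"
      using A open_square_sets by auto
    have Bg: "B \<inter> grid_cell N g = (+) (- v g) ` (A \<inter> grid_cell N (\<pi> g))" if g: "g \<in> grid N" for g
    proof (intro equalityI subsetI)
      fix p assume p: "p \<in> B \<inter> grid_cell N g"
      have "?f p = v g + p" "?f p \<in> grid_cell N (\<pi> g)"
        using grid_map_cell[of N g \<pi> p, OF N g \<pi>g[OF g]] p by (auto simp: v_def)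
      then have "v g + p \<in> A \<inter> grid_cell N (\<pi> g)" using p by (simp add: B_def)
      then show "p \<in> (+) (- v g) ` (A \<inter> grid_cell N (\<pi> g))" by (rule rev_image_eqI) simp
    next
      fix p assume "p \<in> (+) (- v g) ` (A \<inter> grid_cell N (\<pi> g))"
      then obtain q where q: "q \<in> A" "q \<in> grid_cell N (\<pi> g)" "p = - v g + q" by auto
      have "p \<in> grid_cell N g" using q(2) unfolding q(3)
        by (cases q) (simp add: grid_cell_def v_def diff_divide_distrib add_divide_distrib)
      moreover from this have "?f p = q" using grid_map_cell(1)[of N g \<pi> p, OF N g \<pi>g[OF g]]
        unfolding v_def[symmetric] by (simp add: q(3))
      moreover have "p \<in> unit_square" using calculation(1) grid_cell_subset[OF N g] open_square_subset by blast
      ultimately show "p \<in> B \<inter> grid_cell N g" using q(1) by (simp add: B_def)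
    qed
    have Ag: "A \<inter> grid_cell N g \<in> sets square_measure" if "g \<in> grid N" for g
      using A grid_cell_sets(1)[OF N that] by auto
    have BgQ: "B \<inter> grid_cell N g \<subseteq> unit_square" for g by (auto simp: B_def)
    have Bgm: "B \<inter> grid_cell N g \<in> sets square_measure" if g: "g \<in> grid N" for g
      unfolding sets_square_iff
    proof (rule conjI[OF _ BgQ])
      show "B \<inter> grid_cell N g \<in> sets lebesgue"
        unfolding Bg[OF g] using Ag[OF \<pi>g[OF g]] by (intro lebesgue_sets_translation) (simp add: sets_square_iff)
    qed
    have Bgmm: "area (B \<inter> grid_cell N g) = area (A \<inter> grid_cell N (\<pi> g))"
      if g: "g \<in> grid N" for g
    proof -
      have "area (B \<inter> grid_cell N g) = measure lebesgue (B \<inter> grid_cell N g)"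
        using BgQ by (intro measure_restrict_space) auto
      also have "\<dots> = measure lebesgue (A \<inter> grid_cell N (\<pi> g))"
        unfolding Bg[OF g] by (rule measure_translation)
      also have "\<dots> = area (A \<inter> grid_cell N (\<pi> g))"
        using AQ by (intro measure_restrict_space[symmetric]) auto
      finally show ?thesis .
    qed
    have BQ: "B \<subseteq> unit_square" by (simp add: B_def)
    have BEs: "B \<inter> (unit_square - open_square) \<in> sets square_measure" using AE BE by simp
    note dB = grid_decomposition[OF N BEs Bgm BQ]
    note dA = grid_decomposition[OF N AE Ag AQ]
    have "(\<Sum>g\<in>grid N. area (A \<inter> grid_cell N (\<pi> g)))
        = (\<Sum>g\<in>grid N. area (A \<inter> grid_cell N g))"
      by (rule sum.reindex_bij_betw[OF \<pi>])
    moreover have "(\<Sum>g\<in>grid N. area (B \<inter> grid_cell N g))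
        = (\<Sum>g\<in>grid N. area (A \<inter> grid_cell N (\<pi> g)))"
      by (intro sum.cong refl Bgmm)
    ultimately have "area B = area A"
      using dB(2) dA(2) BE by simp
    then show ?thesis using dB(1) by (simp add: B_def)
  qed
  have "?f \<in> square_measure \<rightarrow>\<^sub>M square_measure"
    by (rule measurableI) (use into main in auto)
  then show ?thesis using main by (simp add: measure_preserving_def L.emeasure_eq_measure)
qed

lemma grid_map_mp_bijection:
  assumes N: "N > 0" and \<pi>: "bij_betw \<pi> (grid N) (grid N)"
  shows "grid_map N \<pi> \<in> mp_bijections"
proof -
  define \<sigma> where "\<sigma> = the_inv_into (grid N) \<pi>"
  have \<sigma>: "bij_betw \<sigma> (grid N) (grid N)" unfolding \<sigma>_def by (rule bij_betw_the_inv_into[OF \<pi>])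
  have \<pi>g: "\<pi> g \<in> grid N" "\<sigma> g \<in> grid N" if "g \<in> grid N" for g
    using bij_betw_apply[OF \<pi> that] bij_betw_apply[OF \<sigma> that] .
  have 1: "\<sigma> (\<pi> g) = g" if "g \<in> grid N" for g
    unfolding \<sigma>_def using the_inv_into_f_f[OF bij_betw_imp_inj_on[OF \<pi>] that] .
  have 2: "\<pi> (\<sigma> g) = g" if "g \<in> grid N" for g
    unfolding \<sigma>_def using f_the_inv_into_f_bij_betw[OF \<pi>] that by blast
  note i1 = grid_map_inverse[where \<pi>=\<pi> and \<sigma>=\<sigma>, OF N \<pi>g(1) 1]
  note i2 = grid_map_inverse[where \<pi>=\<sigma> and \<sigma>=\<pi>, OF N \<pi>g(2) 2]
  show ?thesis
  proof (rule mp_bijectionsI[where g="grid_map N \<sigma>"])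
    show "bij_betw (grid_map N \<pi>) unit_square unit_square"
      by (rule bij_betw_byWitness[where f'="grid_map N \<sigma>"]) (use i1 i2 in blast)+
  qed (use grid_map_measure_preserving[OF N] \<pi> \<sigma> i1 in auto)
qed

lemma measure_grid_index:
  assumes N: "N > 0"
  shows "{p\<in>unit_square. P (grid_index N p)} \<in> sets square_measure"
    and "area {p\<in>unit_square. P (grid_index N p)} = card {g\<in>grid N. P g} / (real N)\<^sup>2"
proof -
  let ?A = "{p\<in>unit_square. P (grid_index N p)}"
  have Ag: "?A \<inter> grid_cell N g = (if P g then grid_cell N g else {})" if "g \<in> grid N" for g
    using grid_cell_iff[OF N that] open_square_subset by auto
  have null: "unit_square - open_square \<in> null_sets square_measure"
    using open_square_sets measure_unit_minus_open by (auto simp: null_sets_def L.emeasure_eq_measure)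
  have "unit_square - open_square \<in> null_sets lebesgue"
    using null null_sets_restrict_space[of unit_square lebesgue] by simp
  then have "?A \<inter> (unit_square - open_square) \<in> null_sets lebesgue"
    by (rule null_sets_completion_subset[OF Int_lower2])
  then have n: "?A \<inter> (unit_square - open_square) \<in> null_sets square_measure"
    by (subst null_sets_restrict_space) auto
  note d = grid_decomposition[OF N, of ?A]
  show "?A \<in> sets square_measure"
    by (rule d(1)) (use n Ag grid_cell_sets(1)[OF N] in \<open>auto intro: null_setsD2\<close>)
  have "area ?A = area (?A \<inter> (unit_square - open_square))
       + (\<Sum>g\<in>grid N. area (?A \<inter> grid_cell N g))"
    by (rule d(2)) (use n Ag grid_cell_sets(1)[OF N] in \<open>auto intro: null_setsD2\<close>)
  also have "area (?A \<inter> (unit_square - open_square)) = 0"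
    using n by (simp add: null_sets_def measure_def)
  also have "(\<Sum>g\<in>grid N. area (?A \<inter> grid_cell N g))
      = (\<Sum>g\<in>grid N. if P g then 1 / (real N)\<^sup>2 else 0)"
    by (intro sum.cong refl) (simp only: Ag if_distrib[of "area"] grid_cell_sets(2)[OF N] measure_empty)
  also have "\<dots> = card {g\<in>grid N. P g} / (real N)\<^sup>2"
    by (subst sum.inter_filter[symmetric]) auto
  finally show "area ?A = card {g\<in>grid N. P g} / (real N)\<^sup>2" by simp
qed

lemma grid_index_measurable [measurable]: "grid_index N \<in> square_measure \<rightarrow>\<^sub>M count_space UNIV"
proof -
  have i: "(\<lambda>x. x) \<in> square_measure \<rightarrow>\<^sub>M (borel :: point measure)"
    by (rule measurable_restrict_space1) (simp add: measurable_completion)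
  have "grid_index N \<in> (borel :: point measure) \<rightarrow>\<^sub>M count_space UNIV \<Otimes>\<^sub>M count_space UNIV"
    unfolding grid_index_def borel_prod[symmetric] by measurable
  then have "grid_index N \<in> (borel :: point measure) \<rightarrow>\<^sub>M count_space UNIV"
    by (simp add: pair_measure_countable)
  from measurable_compose[OF i this] show ?thesis .
qed

lemma mismatch_sets:
  assumes "c \<in> square_measure \<rightarrow>\<^sub>M count_space UNIV" "d \<in> square_measure \<rightarrow>\<^sub>M count_space UNIV"
  shows "{p\<in>unit_square. c p \<noteq> (d p :: nat)} \<in> sets square_measure"
proof -
  have "(\<lambda>p. (c p, d p)) \<in> square_measure \<rightarrow>\<^sub>M count_space (UNIV :: (nat \<times> nat) set)"
    using measurable_Pair[OF assms] by (simp add: pair_measure_countable)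
  from measurable_sets[OF this, of "{(i, j). i \<noteq> j}"]
  have "(\<lambda>p. (c p, d p)) -` {(i, j). i \<noteq> j} \<inter> unit_square \<in> sets square_measure" by simp
  also have "(\<lambda>p. (c p, d p)) -` {(i, j). i \<noteq> j} \<inter> unit_square = {p\<in>unit_square. c p \<noteq> d p}" by auto
  finally show ?thesis .
qed

text \<open>Inside every cell of a labelling lies a compact set that carries almost all its mass.  Finitely
  many disjoint compact sets have positive distance, so a small square meets at most one of them, and
  the labelling almost agrees with one that depends on the square only.\<close>

lemma grid_approximation:
  assumes c: "labelling m c" and \<eta>: "\<eta> > 0"
  shows "\<exists>N0. \<forall>N\<ge>N0. N > 0 \<longrightarrow> (\<exists>a. (\<forall>g. a g < m) \<and>
     area {p\<in>unit_square. c p \<noteq> a (grid_index N p)} \<le> \<eta>)"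
proof -
  have m: "m > 0" using c unit_square_nonempty by (auto simp: labelling_def)
  have "\<exists>K. closed K \<and> K \<subseteq> cell c i \<and> emeasure lebesgue (cell c i - K) < ennreal (\<eta> / m)" for i
    using sets_lebesgue_inner_closed[of "cell c i" "\<eta> / m"] cell_sets[OF c, of i] \<eta> m
    by (simp add: sets_square_iff) metis
  then obtain K where K: "\<And>i. closed (K i)" "\<And>i. K i \<subseteq> cell c i"
    "\<And>i. emeasure lebesgue (cell c i - K i) < ennreal (\<eta> / m)" by metis
  have cQ: "cell c i \<subseteq> unit_square" for i by (auto simp: cell_def)
  have "compact unit_square" by (auto simp: unit_square_def intro: compact_Times)
  then have comp: "compact (K i)" for i
    using K(1)[of i] K(2)[of i] cQ[of i] by (metis compact_Int_closed inf.absorb_iff2 order_trans)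
  have "\<exists>d>0. \<forall>x\<in>K i. \<forall>y\<in>K j. d \<le> dist x y" if "i \<noteq> j" for i j
    by (rule separate_compact_closed[OF comp K(1)]) (use K(2)[of i] K(2)[of j] that in \<open>auto simp: cell_def\<close>)
  then obtain d where d: "\<And>i j. i \<noteq> j \<Longrightarrow> d i j > 0"
    "\<And>i j x y. i \<noteq> j \<Longrightarrow> x \<in> K i \<Longrightarrow> y \<in> K j \<Longrightarrow> d i j \<le> dist x y" by metis
  define D where "D = Min (insert 1 ((\<lambda>(i, j). d i j) ` {(i, j). i < m \<and> j < m \<and> i \<noteq> j}))"
  have fin: "finite ((\<lambda>(i, j). d i j) ` {(i, j). i < m \<and> j < m \<and> i \<noteq> j})"
    by (rule finite_imageI, rule finite_subset[of _ "{..<m} \<times> {..<m}"]) auto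
  have D: "D > 0" unfolding D_def using fin d(1) by (subst Min_gr_iff) auto
  have Dd: "D \<le> dist x y" if "i < m" "j < m" "i \<noteq> j" "x \<in> K i" "y \<in> K j" for i j x y
  proof -
    have "D \<le> d i j" unfolding D_def using fin that by (intro Min_le) auto
    then show ?thesis using d(2)[OF that(3-5)] by simp
  qed
  obtain N0 :: nat where N0: "2 / D < N0" using reals_Archimedean2 by blast
  show ?thesis
  proof (intro exI[of _ N0] allI impI)
    fix N assume N: "N0 \<le> N" "0 < N"
    have small: "dist p q < D" if "p \<in> grid_cell N g" "q \<in> grid_cell N g" for p q g
    proof -
      have "\<bar>fst p - fst q\<bar> \<le> 1 / N" "\<bar>snd p - snd q\<bar> \<le> 1 / N"
        using that by (auto simp: grid_cell_def add_divide_distrib)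
      moreover have "dist p q \<le> \<bar>fst p - fst q\<bar> + \<bar>snd p - snd q\<bar>"
        using sqrt_sum_squares_le_sum_abs[of "fst p - fst q" "snd p - snd q"]
        by (simp add: dist_prod_def dist_real_def)
      moreover have "2 / real N < D"
      proof -
        have "2 < D * N0" using N0 D by (simp add: field_simps)
        also have "\<dots> \<le> D * N" using N D by simp
        finally show ?thesis using N by (simp add: field_simps)
      qed
      ultimately show ?thesis by simp
    qed
    define a where "a g = (if \<exists>i<m. K i \<inter> grid_cell N g \<noteq> {} then SOME i. i < m \<and> K i \<inter> grid_cell N g \<noteq> {} else 0)" for g
    have am: "a g < m" for g
    proof (cases "\<exists>i<m. K i \<inter> grid_cell N g \<noteq> {}")
      case True
      then show ?thesis using someI_ex[of "\<lambda>i. i < m \<and> K i \<inter> grid_cell N g \<noteq> {}"] by (auto simp: a_def)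
    qed (use m in \<open>auto simp: a_def\<close>)
    have aK: "a g = i" if i: "i < m" "p \<in> K i" "p \<in> grid_cell N g" for g i p
    proof (rule ccontr)
      assume ne: "a g \<noteq> i"
      have ex: "\<exists>i<m. K i \<inter> grid_cell N g \<noteq> {}" using i by blast
      then have "a g < m \<and> K (a g) \<inter> grid_cell N g \<noteq> {}"
        using someI_ex[of "\<lambda>i. i < m \<and> K i \<inter> grid_cell N g \<noteq> {}"] by (auto simp: a_def)
      then obtain q where q: "q \<in> K (a g)" "q \<in> grid_cell N g" "a g < m" by blast
      show False using Dd[OF q(3) i(1) ne q(1) i(2)] small[OF q(2) i(3)] by simp
    qed
    have sub: "{p\<in>unit_square. c p \<noteq> a (grid_index N p)} \<subseteq> (unit_square - open_square) \<union> (\<Union>i<m. cell c i - K i)"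
    proof
      fix p assume p: "p \<in> {p\<in>unit_square. c p \<noteq> a (grid_index N p)}"
      show "p \<in> (unit_square - open_square) \<union> (\<Union>i<m. cell c i - K i)"
      proof (cases "p \<in> open_square")
        case True
        have cm: "c p < m" using p c by (auto simp: labelling_def)
        have "p \<notin> K (c p)" using aK[OF cm _ grid_index_cell(2)[OF N(2) True]] p by auto
        then show ?thesis using p cm by (auto simp: cell_def)
      qed (use p in auto)
    qed
    have dm: "cell c i - K i \<in> sets square_measure" for i
      using cell_sets[OF c, of i] K(1)[of i] by (auto simp: sets_square_iff)
    have de: "area (cell c i - K i) \<le> \<eta> / m" for i
    proof -
      have "cell c i - K i \<subseteq> unit_square" using cQ by blast
      then have "emeasure square_measure (cell c i - K i) \<le> ennreal (\<eta> / m)"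
        using K(3)[of i] by (simp add: emeasure_restrict_space)
      then show ?thesis using \<eta> m by (simp add: L.emeasure_eq_measure)
    qed
    have "area {p\<in>unit_square. c p \<noteq> a (grid_index N p)}
        \<le> area ((unit_square - open_square) \<union> (\<Union>i<m. cell c i - K i))"
      by (rule L.finite_measure_mono[OF sub]) (use open_square_sets dm in auto)
    also have "\<dots> \<le> area (unit_square - open_square) + area (\<Union>i<m. cell c i - K i)"
      by (rule measure_Un_le) (use open_square_sets dm in auto)
    also have "\<dots> \<le> 0 + (\<Sum>i<m. area (cell c i - K i))"
      unfolding measure_unit_minus_open by (intro add_left_mono measure_UNION_le) (use dm in auto)
    also have "\<dots> \<le> (\<Sum>i<m. \<eta> / m)" unfolding add_0 by (rule sum_mono) (rule de)
    also have "\<dots> = \<eta>" using m by simp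
    finally show "\<exists>a. (\<forall>g. a g < m) \<and> area {p\<in>unit_square. c p \<noteq> a (grid_index N p)} \<le> \<eta>"
      using am by blast
  qed
qed

definition strip_cell :: "nat \<Rightarrow> (point \<Rightarrow> nat) \<Rightarrow> nat \<Rightarrow> nat \<Rightarrow> point set" where
  "strip_cell M c i j = {p\<in>cell c i. real j / M < fst p \<and> fst p \<le> (real j + 1) / M}"

lemma strip_cell_sets:
  assumes "labelling m c" shows "strip_cell M c i j \<in> sets square_measure"
proof -
  have "{real j / M<..(real j + 1) / M} \<times> UNIV \<in> sets (lebesgue :: point measure)"
    by (rule lebesgue_times) auto
  moreover have "strip_cell M c i j = cell c i \<inter> ({real j / M<..(real j + 1) / M} \<times> UNIV)"
    by (auto simp: strip_cell_def)
  ultimately show ?thesis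
    using cell_sets[OF assms, of i] by (auto simp: sets_square_iff)
qed

lemma strip_index:
  assumes "M > 0" "r > 0" "p \<in> open_square"
  shows "real j / M < fst p \<and> fst p \<le> (real j + 1) / M \<longleftrightarrow> fst (grid_index (M * r) p) div r = j"
proof -
  define i where "i = fst (grid_index (M * r) p)"
  have N: "M * r > 0" using assms by simp
  have b: "real i / (M * r) < fst p" "fst p \<le> (real i + 1) / (M * r)"
    using grid_index_cell(2)[OF N assms(3)] by (auto simp: grid_cell_def i_def mem_Times_iff)
  have b': "real i < fst p * (M * r)" "fst p * (M * r) \<le> real i + 1"
    using b N by (simp_all add: pos_divide_less_eq pos_le_divide_eq)
  have s: "real j / M < fst p \<longleftrightarrow> real (j * r) < fst p * (M * r)"
    "fst p \<le> (real j + 1) / M \<longleftrightarrow> fst p * (M * r) \<le> real ((j + 1) * r)"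
  proof -
    have "real j / M < fst p \<longleftrightarrow> real j < fst p * M" using assms(1) by (simp add: pos_divide_less_eq)
    also have "\<dots> \<longleftrightarrow> real j * r < fst p * M * r" using assms(2) by (simp add: mult_less_cancel_right_pos)
    finally show "real j / M < fst p \<longleftrightarrow> real (j * r) < fst p * (M * r)" by (simp add: mult.assoc)
    have "fst p \<le> (real j + 1) / M \<longleftrightarrow> fst p * M \<le> real j + 1" using assms(1) by (simp add: pos_le_divide_eq)
    also have "\<dots> \<longleftrightarrow> fst p * M * r \<le> (real j + 1) * r" using assms(2) by (simp add: mult_le_cancel_right_pos)
    also have "(real j + 1) * r = real ((j + 1) * r)" by (simp add: algebra_simps)
    finally show "fst p \<le> (real j + 1) / M \<longleftrightarrow> fst p * (M * r) \<le> real ((j + 1) * r)" by (simp add: mult.assoc)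
  qed
  have "i div r = j \<longleftrightarrow> j * r \<le> i \<and> i < (j + 1) * r"
  proof
    assume "i div r = j"
    then show "j * r \<le> i \<and> i < (j + 1) * r"
      using div_times_less_eq_dividend[of i r] dividend_less_div_times[OF assms(2), of i] by auto
  next
    assume *: "j * r \<le> i \<and> i < (j + 1) * r"
    show "i div r = j" by (rule div_nat_eqI) (use * in \<open>auto simp: mult.commute\<close>)
  qed
  also have "\<dots> \<longleftrightarrow> real (j * r) < fst p * (M * r) \<and> fst p * (M * r) \<le> real ((j + 1) * r)"
  proof (intro iffI conjI)
    assume *: "j * r \<le> i \<and> i < (j + 1) * r"
    have "real (j * r) \<le> real i" using * by (simp only: of_nat_le_iff)
    then show "real (j * r) < fst p * (M * r)" using b' by linarith
    have "real i + 1 \<le> real ((j + 1) * r)" using * by (metis Suc_leI of_nat_Suc of_nat_le_iff add.commute)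
    then show "fst p * (M * r) \<le> real ((j + 1) * r)" using b' by linarith
  next
    assume *: "real (j * r) < fst p * (M * r) \<and> fst p * (M * r) \<le> real ((j + 1) * r)"
    have "real (j * r) < real (i + 1)" using * b' by simp
    then show "j * r \<le> i" by (simp only: of_nat_less_iff)
    have "real i < real ((j + 1) * r)" using * b' by linarith
    then show "i < (j + 1) * r" by (simp only: of_nat_less_iff)
  qed
  finally show ?thesis unfolding s i_def by blast
qed

text \<open>Replace both labellings by labellings of the squares of a common fine grid whose columns subdivide the
  strips.  In each strip the numbers of squares with a given label almost agree, so a permutation inside
  the strip matches all but few of them; as it preserves strips, it moves abscissae by at most \<open>1 / M\<close>.\<close>

lemma matching_bijection:
  fixes M :: nat
  assumes M: "M > 0" and \<epsilon>: "\<epsilon> > 0"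
  shows "\<exists>\<delta>>0. \<forall>c c'. labelling m c \<and> labelling m c' \<and>
     (\<forall>i<m. \<forall>j<M. \<bar>area (strip_cell M c i j) - area (strip_cell M c' i j)\<bar> \<le> \<delta>)
     \<longrightarrow> (\<exists>f\<in>mp_bijections. Shift f \<le> 1 / M \<and> area {p\<in>unit_square. c p \<noteq> c' (f p)} \<le> \<epsilon>)"
proof -
  \<comment> \<open>Scaled by the area of a square, the counts per label and strip deviate by at most \<open>3 * \<delta>\<close>; the two grid approximations cost \<open>\<delta>\<close> each.\<close>
  define \<delta> where "\<delta> = \<epsilon> / (3 * m * M + 2)"
  have den: "0 < 3 * real m * real M + 2" by (simp add: add_nonneg_pos)
  then have \<delta>: "\<delta> > 0" using \<epsilon> by (simp add: \<delta>_def)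
  show ?thesis
  proof (intro exI[of _ \<delta>] conjI \<delta> allI impI, elim conjE)
    fix c c' assume c: "labelling m c" and c': "labelling m c'"
      and close: "\<forall>i<m. \<forall>j<M. \<bar>area (strip_cell M c i j) - area (strip_cell M c' i j)\<bar> \<le> \<delta>"
    obtain N1 where N1: "\<forall>N\<ge>N1. N > 0 \<longrightarrow> (\<exists>a. (\<forall>g. a g < m) \<and>
       area {p\<in>unit_square. c p \<noteq> a (grid_index N p)} \<le> \<delta>)"
      using grid_approximation[OF c \<delta>] by (rule exE)
    obtain N2 where N2: "\<forall>N\<ge>N2. N > 0 \<longrightarrow> (\<exists>a. (\<forall>g. a g < m) \<and>
       area {p\<in>unit_square. c' p \<noteq> a (grid_index N p)} \<le> \<delta>)"
      using grid_approximation[OF c' \<delta>] by (rule exE)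
    \<comment> \<open>\<open>r\<close> columns of the grid per strip, with a grid fine enough for both labellings\<close>
    define r where "r = Suc (N1 + N2)"
    define N where "N = M * r"
    have r: "r > 0" by (simp add: r_def)
    have N: "N > 0" using M r by (simp add: N_def)
    have "r \<le> N" using M by (simp add: N_def)
    then have NN: "N1 \<le> N" "N2 \<le> N" by (auto simp: r_def)
    obtain a where a: "\<And>g. a g < m" and ca: "area {p\<in>unit_square. c p \<noteq> a (grid_index N p)} \<le> \<delta>"
      using N1[rule_format, OF NN(1) N] by (elim exE conjE) blast
    obtain b where b: "\<And>g. b g < m" and cb: "area {p\<in>unit_square. c' p \<noteq> b (grid_index N p)} \<le> \<delta>"
      using N2[rule_format, OF NN(2) N] by (elim exE conjE) blast
    have mc: "c \<in> square_measure \<rightarrow>\<^sub>M count_space UNIV" "c' \<in> square_measure \<rightarrow>\<^sub>M count_space UNIV"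
      using c c' by (auto simp: labelling_def)
    have mcomp: "(\<lambda>p. d (grid_index N p)) \<in> square_measure \<rightarrow>\<^sub>M count_space UNIV" for d :: "nat \<times> nat \<Rightarrow> nat"
      by (rule measurable_compose[OF grid_index_measurable]) simp
    define X where "X j = {g\<in>grid N. fst g div r = j}" for j
    have X_sub: "X j \<subseteq> grid N" for j by (auto simp: X_def)
    have finX: "finite (X j)" for j using X_sub finite_grid by (rule finite_subset)
    have count: "\<bar>card {g\<in>X j. a g = i} / (real N)\<^sup>2 - area (strip_cell M c i j)\<bar> \<le> \<delta>"
      if ab: "area {p\<in>unit_square. c p \<noteq> a (grid_index N p)} \<le> \<delta>" and c: "labelling m c"
      for c a i j
    proof -
      define A where "A = {p\<in>unit_square. fst (grid_index N p) div r = j \<and> a (grid_index N p) = i}"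
      define D where "D = {p\<in>unit_square. c p \<noteq> a (grid_index N p)} \<union> (unit_square - open_square)"
      have Am: "A \<in> sets square_measure" "area A = card {g\<in>X j. a g = i} / (real N)\<^sup>2"
        unfolding A_def using measure_grid_index[OF N, of "\<lambda>g. fst g div r = j \<and> a g = i"]
        by (simp_all add: X_def conj_assoc)
      have c1: "{p\<in>unit_square. c p \<noteq> a (grid_index N p)} \<in> sets square_measure"
        using c by (intro mismatch_sets mcomp) (simp add: labelling_def)
      have Dm: "D \<in> sets square_measure" unfolding D_def using open_square_sets c1 by auto
      have "area D \<le> area {p\<in>unit_square. c p \<noteq> a (grid_index N p)}
          + area (unit_square - open_square)"
        unfolding D_def by (rule measure_Un_le) (use c1 open_square_sets in auto)
      then have D\<delta>: "area D \<le> \<delta>" using ab by (simp add: measure_unit_minus_open)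
      have S: "strip_cell M c i j \<in> sets square_measure" by (rule strip_cell_sets[OF c])
      have iff: "p \<in> A \<longleftrightarrow> p \<in> strip_cell M c i j" if "p \<notin> D" "p \<in> unit_square" for p
        using that strip_index[OF M r, of p j] by (auto simp: A_def D_def strip_cell_def cell_def N_def)
      have sub: "A \<subseteq> strip_cell M c i j \<union> D" "strip_cell M c i j \<subseteq> A \<union> D"
        using iff by (auto simp: A_def strip_cell_def cell_def)
      have "area A \<le> area (strip_cell M c i j) + area D"
        using L.finite_measure_mono[OF sub(1)] measure_Un_le[OF S Dm] S Dm by (meson order_trans sets.Un)
      moreover have "area (strip_cell M c i j) \<le> area A + area D"
        using L.finite_measure_mono[OF sub(2)] measure_Un_le[OF Am(1) Dm] Am(1) Dm by (meson order_trans sets.Un)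
      ultimately show ?thesis using D\<delta> Am(2) by simp
    qed
    have "\<exists>\<pi>. bij_betw \<pi> (X j) (X j) \<and> card {g\<in>X j. a g \<noteq> b (\<pi> g)}
        \<le> (\<Sum>i<m. card {g\<in>X j. a g = i} - card {g\<in>X j. b g = i})" for j
      by (rule combinatorial_matching) (use finX a in auto)
    then have "\<exists>\<pi>. \<forall>j. bij_betw (\<pi> j) (X j) (X j) \<and> card {g\<in>X j. a g \<noteq> b (\<pi> j g)}
        \<le> (\<Sum>i<m. card {g\<in>X j. a g = i} - card {g\<in>X j. b g = i})"
      by (intro choice allI)
    then obtain \<pi> where \<pi>_all: "\<forall>j. bij_betw (\<pi> j) (X j) (X j) \<and> card {g\<in>X j. a g \<noteq> b (\<pi> j g)}
        \<le> (\<Sum>i<m. card {g\<in>X j. a g = i} - card {g\<in>X j. b g = i})"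
      by (rule exE)
    have \<pi>: "bij_betw (\<pi> j) (X j) (X j)"
      and mis: "card {g\<in>X j. a g \<noteq> b (\<pi> j g)} \<le> (\<Sum>i<m. card {g\<in>X j. a g = i} - card {g\<in>X j. b g = i})" for j
      using \<pi>_all[rule_format, of j] by (rule conjunct1, rule conjunct2)
    have misj: "card {g\<in>X j. a g \<noteq> b (\<pi> j g)} / (real N)\<^sup>2 \<le> m * (3 * \<delta>)" if j: "j < M" for j
    proof -
      have "card {g\<in>X j. a g \<noteq> b (\<pi> j g)} / (real N)\<^sup>2
          \<le> real (\<Sum>i<m. card {g\<in>X j. a g = i} - card {g\<in>X j. b g = i}) / (real N)\<^sup>2"
        using mis[of j] by (intro divide_right_mono) (auto simp only: of_nat_le_iff zero_le_power2)
      also have "\<dots> = (\<Sum>i<m. real (card {g\<in>X j. a g = i} - card {g\<in>X j. b g = i}) / (real N)\<^sup>2)"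
        by (simp add: sum_divide_distrib)
      also have "\<dots> \<le> (\<Sum>i<m. 3 * \<delta>)"
      proof (rule sum_mono)
        fix i assume "i \<in> {..<m}"
        then have "\<bar>area (strip_cell M c i j) - area (strip_cell M c' i j)\<bar> \<le> \<delta>"
          using close j by simp
        then have "card {g\<in>X j. a g = i} / (real N)\<^sup>2 - card {g\<in>X j. b g = i} / (real N)\<^sup>2 \<le> 3 * \<delta>"
          using count[OF ca c, of j i] count[OF cb c', of j i] by linarith
        then show "real (card {g\<in>X j. a g = i} - card {g\<in>X j. b g = i}) / (real N)\<^sup>2 \<le> 3 * \<delta>"
          using \<delta> by (cases "card {g\<in>X j. b g = i} \<le> card {g\<in>X j. a g = i}") (auto simp: of_nat_diff diff_divide_distrib)
      qed
      finally show ?thesis by simp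
    qed
    define \<rho> where "\<rho> g = \<pi> (fst g div r) g" for g
    have \<rho>X: "\<rho> g \<in> X j" if "g \<in> X j" for g j
      using that bij_betw_apply[OF \<pi>[of j] that] by (simp add: \<rho>_def X_def)
    have gridX: "grid N = (\<Union>j<M. X j)"
      using r by (auto simp: X_def grid_def N_def less_mult_imp_div_less)
    have inj: "inj_on \<rho> (grid N)"
    proof (rule inj_onI)
      fix g h assume g: "g \<in> grid N" and h: "h \<in> grid N" and eq: "\<rho> g = \<rho> h"
      have gX: "g \<in> X (fst g div r)" "h \<in> X (fst h div r)" using g h by (auto simp: X_def)
      have "fst g div r = fst h div r" using \<rho>X[OF gX(1)] \<rho>X[OF gX(2)] eq by (simp add: X_def)
      then show "g = h" using gX eq bij_betw_imp_inj_on[OF \<pi>[of "fst g div r"]]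
        by (auto simp: \<rho>_def dest: inj_onD)
    qed
    have \<rho>: "bij_betw \<rho> (grid N) (grid N)"
      unfolding bij_betw_def
    proof
      show "\<rho> ` grid N = grid N"
        by (rule endo_inj_surj[OF finite_grid _ inj]) (use \<rho>X X_sub in \<open>auto simp: X_def\<close>)
    qed (rule inj)
    define f where "f = grid_map N \<rho>"
    have f: "f \<in> mp_bijections" unfolding f_def by (rule grid_map_mp_bijection[OF N \<rho>])
    have idx: "f p \<in> open_square \<and> grid_index N (f p) = \<rho> (grid_index N p)" if p: "p \<in> open_square" for p
    proof -
      have g: "grid_index N p \<in> grid N" "p \<in> grid_cell N (grid_index N p)" using grid_index_cell[OF N p] .
      have \<rho>g: "\<rho> (grid_index N p) \<in> grid N" by (rule bij_betw_apply[OF \<rho> g(1)])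
      show ?thesis
        using grid_map_cell(2)[where \<pi>=\<rho>, OF N g(1) \<rho>g g(2)] grid_cell_iff[OF N \<rho>g] unfolding f_def by blast
    qed
    have shift: "Shift f \<le> 1 / M"
    proof (rule Shift_least)
      fix p assume "p \<in> unit_square"
      show "\<bar>fst p - fst (f p)\<bar> \<le> 1 / M"
      proof (cases "p \<in> open_square")
        case True
        define j where "j = fst (grid_index N p) div r"
        have "grid_index N p \<in> X j" using grid_index_cell(1)[OF N True] by (simp add: X_def j_def)
        then have "\<rho> (grid_index N p) \<in> X j" by (rule \<rho>X)
        then have "fst (grid_index N (f p)) div r = j" using idx[OF True] by (simp add: X_def)
        then have "real j / M < fst p \<and> fst p \<le> (real j + 1) / M" "real j / M < fst (f p) \<and> fst (f p) \<le> (real j + 1) / M"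
          using strip_index[OF M r True, of j] strip_index[OF M r, of "f p" j] idx[OF True]
          by (auto simp: N_def j_def)
        then show ?thesis by (auto simp: add_divide_distrib abs_le_iff)
      qed (use M in \<open>auto simp: f_def grid_map_def\<close>)
    qed
    have "card {g\<in>grid N. a g \<noteq> b (\<rho> g)} \<le> (\<Sum>j<M. card {g\<in>X j. a g \<noteq> b (\<pi> j g)})"
    proof -
      have "{g\<in>grid N. a g \<noteq> b (\<rho> g)} = (\<Union>j<M. {g\<in>X j. a g \<noteq> b (\<pi> j g)})"
        unfolding gridX by (auto simp: X_def \<rho>_def)
      then show ?thesis using card_UN_le[of "{..<M}" "\<lambda>j. {g\<in>X j. a g \<noteq> b (\<pi> j g)}"] by simp
    qed
    then have "card {g\<in>grid N. a g \<noteq> b (\<rho> g)} / (real N)\<^sup>2 \<le> real (\<Sum>j<M. card {g\<in>X j. a g \<noteq> b (\<pi> j g)}) / (real N)\<^sup>2"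
      by (intro divide_right_mono) (auto simp only: of_nat_le_iff zero_le_power2)
    also have "\<dots> = (\<Sum>j<M. card {g\<in>X j. a g \<noteq> b (\<pi> j g)} / (real N)\<^sup>2)"
      by (simp add: sum_divide_distrib)
    also have "\<dots> \<le> (\<Sum>j<M. m * (3 * \<delta>))" using misj by (intro sum_mono) simp
    finally have mid: "area {p\<in>unit_square. a (grid_index N p) \<noteq> b (\<rho> (grid_index N p))} \<le> M * (m * (3 * \<delta>))"
      unfolding measure_grid_index(2)[OF N, of "\<lambda>g. a g \<noteq> b (\<rho> g)"] by simp
    let ?A = "{p\<in>unit_square. c p \<noteq> a (grid_index N p)}"
    let ?B = "{p\<in>unit_square. c' p \<noteq> b (grid_index N p)}"
    let ?C = "{p\<in>unit_square. a (grid_index N p) \<noteq> b (\<rho> (grid_index N p))}"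
    let ?F = "f -` ?B \<inter> space square_measure"
    have fm: "f \<in> square_measure \<rightarrow>\<^sub>M square_measure" and
      fe: "\<And>A. A \<in> sets square_measure \<Longrightarrow> emeasure square_measure (f -` A \<inter> space square_measure) = emeasure square_measure A"
      using mp_bijectionsD(2)[OF f] by (auto simp: measure_preserving_def)
    have sets: "?A \<in> sets square_measure" "?B \<in> sets square_measure" "?C \<in> sets square_measure"
      by (intro mismatch_sets mc mcomp)+
    have Fs: "?F \<in> sets square_measure" by (rule measurable_sets[OF fm sets(2)])
    have Fm: "area ?F \<le> \<delta>" using cb fe[OF sets(2)] by (simp add: measure_def)
    have E: "unit_square - open_square \<in> sets square_measure" using open_square_sets by auto
    have "{p\<in>unit_square. c p \<noteq> c' (f p)} \<subseteq> ?A \<union> (?C \<union> (?F \<union> (unit_square - open_square)))"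
    proof
      fix p assume p: "p \<in> {p\<in>unit_square. c p \<noteq> c' (f p)}"
      show "p \<in> ?A \<union> (?C \<union> (?F \<union> (unit_square - open_square)))"
      proof (cases "p \<in> open_square")
        case True
        then have "f p \<in> unit_square" "grid_index N (f p) = \<rho> (grid_index N p)"
          using idx[OF True] open_square_subset by auto
        moreover consider "c p \<noteq> a (grid_index N p)" | "c' (f p) \<noteq> b (\<rho> (grid_index N p))"
          | "a (grid_index N p) \<noteq> b (\<rho> (grid_index N p))"
          using p by fastforce
        ultimately show ?thesis using p by cases auto
      qed (use p in auto)
    qed
    then have "area {p\<in>unit_square. c p \<noteq> c' (f p)}
        \<le> area (?A \<union> (?C \<union> (?F \<union> (unit_square - open_square))))"
      by (rule L.finite_measure_mono) (intro sets.Un sets Fs E)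
    also have "\<dots> \<le> area ?A + area (?C \<union> (?F \<union> (unit_square - open_square)))"
      by (intro measure_Un_le sets.Un sets Fs E)
    also have "area (?C \<union> (?F \<union> (unit_square - open_square)))
        \<le> area ?C + area (?F \<union> (unit_square - open_square))"
      by (intro measure_Un_le sets.Un sets Fs E)
    also have "area (?F \<union> (unit_square - open_square))
        \<le> area ?F + area (unit_square - open_square)"
      by (intro measure_Un_le sets.Un sets Fs E)
    finally have "area {p\<in>unit_square. c p \<noteq> c' (f p)} \<le> \<delta> + (M * (m * (3 * \<delta>)) + (\<delta> + 0))"
      using ca mid Fm unfolding measure_unit_minus_open by linarith
    also have "\<dots> = \<delta> * (3 * m * M + 2)" by (simp add: algebra_simps)
    also have "\<dots> = \<epsilon>" using den unfolding \<delta>_def by simp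
    finally show "\<exists>f\<in>mp_bijections. Shift f \<le> 1 / M \<and> area {p\<in>unit_square. c p \<noteq> c' (f p)} \<le> \<epsilon>"
      using f shift by blast
  qed
qed

section \<open>Lipschitz distribution functions have densities\<close>

text \<open>Such an \<open>F\<close> distributes a mass on the line with density between 0 and 1.\<close>

definition distribution :: "(real \<Rightarrow> real) \<Rightarrow> bool" where
  "distribution F \<longleftrightarrow> (\<forall>x y. x \<le> y \<longrightarrow> 0 \<le> F y - F x \<and> F y - F x \<le> y - x)"

lemma measure_eqI_Ioc:
  fixes M N :: "real measure"
  assumes sets: "sets M = sets borel" "sets N = sets borel"
    and fin: "\<And>a b. emeasure M {a<..b} \<noteq> \<infinity>"
    and eq: "\<And>a b. a \<le> b \<Longrightarrow> emeasure M {a<..b} = emeasure N {a<..b}"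
  shows "M = N"
proof (rule measure_eqI_generator_eq[where E="range (\<lambda>(a, b). {a<..b})" and \<Omega>=UNIV and A="\<lambda>i. {- real i<..real i}"])
  have "{a<..b} \<inter> {c<..d} = {max a c<..min b d}" for a b c d :: real by auto
  then show "Int_stable (range (\<lambda>(a, b). {a<..b :: real}))"
    by (auto simp: Int_stable_def)
  show "emeasure M X = emeasure N X" if X: "X \<in> range (\<lambda>(a, b). {a<..b})" for X
  proof -
    obtain a b where ab: "X = {a<..b}" using X by auto
    show ?thesis
    proof (cases "a \<le> b")
      case False
      then have "X = {}" by (simp add: ab)
      then show ?thesis by simp
    qed (simp add: ab eq)
  qed
  have b: "sets borel = sigma_sets UNIV (range (\<lambda>(a, b). {a<..b :: real}))"
    by (subst borel_sigma_sets_Ioc) simp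
  show "sets M = sigma_sets UNIV (range (\<lambda>(a, b). {a<..b}))"
    "sets N = sigma_sets UNIV (range (\<lambda>(a, b). {a<..b}))"
    using sets b by auto
  show "(\<Union>i. {- real i<..real i}) = UNIV"
  proof (intro equalityI subsetI UNIV_I)
    fix x :: real
    obtain n :: nat where "\<bar>x\<bar> < n" using reals_Archimedean2 by blast
    then have "x \<in> {- real n<..real n}" by auto
    then show "x \<in> (\<Union>i. {- real i<..real i})" by blast
  qed
qed (use fin in auto)

lemma continuous_distribution:
  assumes "distribution F" shows "continuous_on UNIV F" "mono F"
proof -
  have d: "0 \<le> F y - F x" "F y - F x \<le> y - x" if "x \<le> y" for x y
    using assms that by (auto simp: distribution_def)
  have "\<bar>F y - F x\<bar> \<le> \<bar>y - x\<bar>" for x y using d[of x y] d[of y x] by linarith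
  then have "1-lipschitz_on UNIV F"
    by (intro lipschitz_onI) (auto simp: dist_real_def)
  then show "continuous_on UNIV F" by (rule lipschitz_on_continuous_on)
  show "mono F" using d by (auto simp: mono_def)
qed

lemma emeasure_interval_distribution:
  assumes "distribution F" "a \<le> b"
  shows "emeasure (interval_measure F) {a<..b} = ennreal (F b - F a)"
proof (rule emeasure_interval_measure_Ioc[OF assms(2)])
  show "F x \<le> F y" if "x \<le> y" for x y using continuous_distribution(2)[OF assms(1)] that by (rule monoD)
  show "continuous (at_right x) F" for x
    using continuous_distribution(1)[OF assms(1)]
    by (simp add: continuous_on_eq_continuous_at continuous_at_imp_continuous_at_within)
qed

text \<open>Both \<open>F\<close> and \<open>\<lambda>x. x - F x\<close> are distribution functions, and their interval measures add up to
  the Lebesgue measure.  Hence the interval measure of \<open>F\<close> is absolutely continuous.\<close>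

lemma distribution_density:
  assumes F: "distribution F"
  shows "\<exists>\<rho>. \<rho> \<in> borel_measurable borel \<and> (\<forall>x. 0 \<le> \<rho> x) \<and>
     (\<forall>a b. a \<le> b \<longrightarrow> (\<integral>\<^sup>+x\<in>{a<..b}. ennreal (\<rho> x) \<partial>lborel) = ennreal (F b - F a))"
proof -
  define G where "G x = x - F x" for x
  have G: "distribution G" using F unfolding distribution_def G_def by (auto simp: algebra_simps)
  define M1 where "M1 = interval_measure F"
  define M2 where "M2 = interval_measure G"
  define S where "S = measure_of UNIV (sets borel) (\<lambda>A. emeasure M1 A + emeasure M2 A)"
  have sets: "sets M1 = sets borel" "sets M2 = sets borel" by (auto simp: M1_def M2_def)
  have setsS: "sets S = sets borel"
    unfolding S_def using sets.sigma_sets_eq[of borel] by (simp add: sets_measure_of)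
  have eS: "emeasure S A = emeasure M1 A + emeasure M2 A" if "A \<in> sets borel" for A
  proof (rule emeasure_measure_of[OF S_def])
    show "countably_additive (sets S) (\<lambda>A. emeasure M1 A + emeasure M2 A)"
    proof (rule countably_additiveI)
      fix A :: "nat \<Rightarrow> real set"
      assume A: "range A \<subseteq> sets S" "disjoint_family A"
      have "(\<Sum>i. emeasure M1 (A i) + emeasure M2 (A i)) = (\<Sum>i. emeasure M1 (A i)) + (\<Sum>i. emeasure M2 (A i))"
        by (rule suminf_add[symmetric]) auto
      then show "(\<Sum>i. emeasure M1 (A i) + emeasure M2 (A i)) = emeasure M1 (\<Union> (range A)) + emeasure M2 (\<Union> (range A))"
        using A setsS sets suminf_emeasure[of A M1] suminf_emeasure[of A M2] by simp
    qed
    show "positive (sets S) (\<lambda>A. emeasure M1 A + emeasure M2 A)" by (simp add: positive_def)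
  qed (use that setsS in auto)
  have "lborel = S"
  proof (rule measure_eqI_Ioc)
    show "emeasure lborel {a<..b} = emeasure S {a<..b}" if "a \<le> b" for a b :: real
    proof -
      have "0 \<le> F b - F a" "0 \<le> G b - G a" using F G that by (auto simp: distribution_def)
      then have "ennreal (F b - F a) + ennreal (G b - G a) = ennreal (b - a)"
        by (subst ennreal_plus[symmetric]) (auto simp: G_def)
      then show ?thesis
        using that by (simp add: eS M1_def M2_def emeasure_interval_distribution[OF F] emeasure_interval_distribution[OF G])
    qed
    show "emeasure lborel {a<..b} \<noteq> \<infinity>" for a b :: real
      by (cases "a \<le> b") auto
  qed (simp_all add: setsS)
  then have ac: "absolutely_continuous lborel M1"
    unfolding absolutely_continuous_def
  proof (intro subsetI)
    fix N :: "real set" assume "N \<in> null_sets lborel"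
    then have N: "N \<in> sets borel" "emeasure S N = 0" using \<open>lborel = S\<close> by auto
    then show "N \<in> null_sets M1" using eS[OF N(1)] sets by auto
  qed
  obtain f where f: "f \<in> borel_measurable lborel" "density lborel f = M1"
    using sigma_finite_measure.Radon_Nikodym[OF sigma_finite_lborel ac] sets by auto
  have "sigma_finite_measure (density lborel f)"
    unfolding f(2) M1_def using continuous_distribution[OF F]
    by (intro sigma_finite_interval_measure)
      (auto simp: mono_def continuous_on_eq_continuous_at continuous_at_imp_continuous_at_within)
  then have fin: "AE x in lborel. f x \<noteq> \<infinity>"
    using sigma_finite_measure.sigma_finite_iff_density_finite[OF sigma_finite_lborel f(1)] by simp
  define \<rho> where "\<rho> x = enn2real (f x)" for x
  have m: "\<rho> \<in> borel_measurable borel" using f(1) unfolding \<rho>_def[abs_def] by simp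
  have "(\<integral>\<^sup>+x\<in>{a<..b}. ennreal (\<rho> x) \<partial>lborel) = ennreal (F b - F a)" if "a \<le> b" for a b
  proof -
    have "(\<integral>\<^sup>+x\<in>{a<..b}. ennreal (\<rho> x) \<partial>lborel) = (\<integral>\<^sup>+x\<in>{a<..b}. f x \<partial>lborel)"
      by (rule nn_integral_cong_AE, use fin in eventually_elim) (simp add: \<rho>_def less_top)
    also have "\<dots> = emeasure (density lborel f) {a<..b}"
      using f(1) by (subst emeasure_density) auto
    also have "\<dots> = ennreal (F b - F a)"
      unfolding f(2) M1_def by (rule emeasure_interval_distribution[OF F that])
    finally show ?thesis .
  qed
  then show ?thesis using m by (intro exI[of _ \<rho>]) (simp add: \<rho>_def)
qed

definition distribution_deriv :: "(real \<Rightarrow> real) \<Rightarrow> real \<Rightarrow> real" where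
  "distribution_deriv F = (SOME \<rho>. \<rho> \<in> borel_measurable borel \<and> (\<forall>x. 0 \<le> \<rho> x) \<and>
     (\<forall>a b. a \<le> b \<longrightarrow> (\<integral>\<^sup>+x\<in>{a<..b}. ennreal (\<rho> x) \<partial>lborel) = ennreal (F b - F a)))"

lemma distribution_deriv:
  assumes F: "distribution F"
  shows "distribution_deriv F \<in> borel_measurable borel" "0 \<le> distribution_deriv F x"
    "a \<le> b \<Longrightarrow> (\<integral>\<^sup>+x\<in>{a<..b}. ennreal (distribution_deriv F x) \<partial>lborel) = ennreal (F b - F a)"
  using someI_ex[OF distribution_density[OF F]] unfolding distribution_deriv_def by blast+

text \<open>Half-open intervals generate the Borel sets, so their integrals determine a density almost everywhere.\<close>

lemma density_unique_Ioc:
  fixes f g :: "real \<Rightarrow> ennreal"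
  assumes f: "f \<in> borel_measurable borel" and g: "g \<in> borel_measurable borel"
    and fin: "(\<integral>\<^sup>+x\<in>{0<..1}. f x \<partial>lborel) \<noteq> \<infinity>"
    and eq: "\<And>a b. 0 \<le> a \<Longrightarrow> a \<le> b \<Longrightarrow> b \<le> 1 \<Longrightarrow> (\<integral>\<^sup>+x\<in>{a<..b}. f x \<partial>lborel) = (\<integral>\<^sup>+x\<in>{a<..b}. g x \<partial>lborel)"
  shows "AE x in lborel. x \<in> {0<..1} \<longrightarrow> f x = g x"
proof -
  define f' g' where "f' x = f x * indicator {0<..1} x" and "g' x = g x * indicator {0<..1} x" for x
  have m: "f' \<in> borel_measurable lborel" "g' \<in> borel_measurable lborel"
    using f g by (auto simp: f'_def[abs_def] g'_def[abs_def])
  have e: "emeasure (density lborel (\<lambda>x. u x * indicator {0<..1} x)) {a<..b} = (\<integral>\<^sup>+x\<in>{max a 0<..min b 1}. u x \<partial>lborel)"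
    if "u \<in> borel_measurable borel" for u :: "real \<Rightarrow> ennreal" and a b
    using that by (subst emeasure_density) (auto intro!: nn_integral_cong simp: indicator_def)
  have "density lborel f' = density lborel g'"
  proof (rule measure_eqI_Ioc)
    fix a b :: real
    have "emeasure (density lborel f') {a<..b} \<le> (\<integral>\<^sup>+x\<in>{0<..1}. f x \<partial>lborel)"
      unfolding f'_def[abs_def] e[OF f] by (intro nn_integral_mono) (auto simp: indicator_def)
    then show "emeasure (density lborel f') {a<..b} \<noteq> \<infinity>" using fin by (auto simp: top_unique)
    show "emeasure (density lborel f') {a<..b} = emeasure (density lborel g') {a<..b}"
      unfolding f'_def[abs_def] g'_def[abs_def] e[OF f] e[OF g]
    proof (cases "max a 0 \<le> min b 1")
      case False
      then have e: "{max a 0<..min b 1} = {}" by (intro greaterThanAtMost_empty) linarith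
      then show "(\<integral>\<^sup>+x\<in>{max a 0<..min b 1}. f x \<partial>lborel) = (\<integral>\<^sup>+x\<in>{max a 0<..min b 1}. g x \<partial>lborel)"
        unfolding e by simp
    qed (rule eq; simp)
  qed auto
  then have "AE x in lborel. f' x = g' x" by (rule sigma_finite_measure.density_unique[OF sigma_finite_lborel m])
  then show ?thesis by eventually_elim (auto simp: f'_def g'_def indicator_def split: if_splits)
qed

section \<open>Realising limit distributions in the square\<close>

text \<open>The cells below \<open>i\<close> are stacked over the abscissa \<open>x\<close> up to this height.\<close>

definition threshold :: "(nat \<Rightarrow> real \<Rightarrow> real) \<Rightarrow> nat \<Rightarrow> real \<Rightarrow> real" where
  "threshold F i x = (\<Sum>j<i. distribution_deriv (F j) x)"

text \<open>Counting thresholds, rather than searching the interval that contains the point, assigns a label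
  below \<open>m\<close> to every point, including those over exceptional abscissae.\<close>

definition limit_label :: "nat \<Rightarrow> (nat \<Rightarrow> real \<Rightarrow> real) \<Rightarrow> point \<Rightarrow> nat" where
  "limit_label m F p = card {i\<in>{1..<m}. threshold F i (fst p) < snd p}"

text \<open>The distribution along the first coordinate of the areas of the cells of a partition of the square.\<close>

definition total_distribution :: "nat \<Rightarrow> (nat \<Rightarrow> real \<Rightarrow> real) \<Rightarrow> bool" where
  "total_distribution m F \<longleftrightarrow> m > 0 \<and> (\<forall>i<m. distribution (F i)) \<and>
     (\<forall>x\<in>{0..1}. (\<Sum>i<m. F i x) = x)"

lemma card_downset:
  assumes "\<And>i j. 1 \<le> i \<Longrightarrow> i \<le> j \<Longrightarrow> j < m \<Longrightarrow> P j \<Longrightarrow> P i" and i: "1 \<le> i" "i < m"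
  shows "i \<le> card {j\<in>{1..<m}. P j} \<longleftrightarrow> P i"
proof
  assume "P i"
  then have "{1..i} \<subseteq> {j\<in>{1..<m}. P j}" using assms by auto
  then have "card {1..i} \<le> card {j\<in>{1..<m}. P j}" by (intro card_mono) auto
  then show "i \<le> card {j\<in>{1..<m}. P j}" by simp
next
  assume le: "i \<le> card {j\<in>{1..<m}. P j}"
  show "P i"
  proof (rule ccontr)
    assume "\<not> P i"
    then have "{j\<in>{1..<m}. P j} \<subseteq> {1..<i}" using assms by (force simp: not_le[symmetric])
    then have "card {j\<in>{1..<m}. P j} \<le> card {1..<i}" by (intro card_mono) auto
    then show False using le i by simp
  qed
qed

lemma threshold_props:
  assumes F: "total_distribution m F" and i: "i \<le> m"
  shows "threshold F i \<in> borel_measurable borel" "0 \<le> threshold F i x"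
    "0 \<le> a \<Longrightarrow> a \<le> b \<Longrightarrow> (\<integral>\<^sup>+x\<in>{a<..b}. ennreal (threshold F i x) \<partial>lborel) = ennreal (\<Sum>j<i. F j b - F j a)"
    "j \<le> i \<Longrightarrow> threshold F j x \<le> threshold F i x"
proof -
  have D: "distribution (F j)" if "j < i" for j using F i that by (simp add: total_distribution_def)
  note d = distribution_deriv[OF D]
  show "threshold F i \<in> borel_measurable borel"
    unfolding threshold_def[abs_def] using d(1) by (intro borel_measurable_sum) auto
  show "0 \<le> threshold F i x" unfolding threshold_def using d(2) by (intro sum_nonneg) auto
  show "threshold F j x \<le> threshold F i x" if "j \<le> i"
    unfolding threshold_def using that d(2) by (intro sum_mono2) auto
  show "(\<integral>\<^sup>+x\<in>{a<..b}. ennreal (threshold F i x) \<partial>lborel) = ennreal (\<Sum>j<i. F j b - F j a)" if "a \<le> b"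
  proof -
    have "(\<integral>\<^sup>+x\<in>{a<..b}. ennreal (threshold F i x) \<partial>lborel)
        = (\<integral>\<^sup>+x. (\<Sum>j<i. ennreal (distribution_deriv (F j) x) * indicator {a<..b} x) \<partial>lborel)"
    proof (rule nn_integral_cong)
      fix x
      have "ennreal (threshold F i x) = (\<Sum>j<i. ennreal (distribution_deriv (F j) x))"
        unfolding threshold_def using d(2) by (intro sum_ennreal[symmetric]) auto
      then show "ennreal (threshold F i x) * indicator {a<..b} x
          = (\<Sum>j<i. ennreal (distribution_deriv (F j) x) * indicator {a<..b} x)"
        by (simp only: sum_distrib_right)
    qed
    also have "\<dots> = (\<Sum>j<i. (\<integral>\<^sup>+x\<in>{a<..b}. ennreal (distribution_deriv (F j) x) \<partial>lborel))"
      using d(1) by (intro nn_integral_sum) auto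
    also have "\<dots> = (\<Sum>j<i. ennreal (F j b - F j a))"
      using d(3)[OF _ that] by (intro sum.cong) auto
    also have "\<dots> = ennreal (\<Sum>j<i. F j b - F j a)"
      using D that by (intro sum_ennreal) (auto simp: distribution_def)
    finally show ?thesis .
  qed
qed

text \<open>The densities add up to the density of the uniform distribution.\<close>

lemma threshold_top:
  assumes F: "total_distribution m F"
  shows "AE x in lborel. x \<in> {0<..1} \<longrightarrow> threshold F m x = 1"
proof -
  note t = threshold_props[OF F order_refl]
  have s: "(\<Sum>j<m. F j b - F j a) = b - a" if "0 \<le> a" "a \<le> b" "b \<le> 1" for a b
    using F that by (auto simp: total_distribution_def sum_subtractf)
  have "AE x in lborel. x \<in> {0<..1} \<longrightarrow> ennreal (threshold F m x) = 1"
  proof (rule density_unique_Ioc)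
    show "(\<integral>\<^sup>+x\<in>{0<..1}. ennreal (threshold F m x) \<partial>lborel) \<noteq> \<infinity>" by (simp add: t(3))
    show "(\<integral>\<^sup>+x\<in>{a<..b}. ennreal (threshold F m x) \<partial>lborel) = (\<integral>\<^sup>+x\<in>{a<..b}. 1 \<partial>lborel)"
      if "0 \<le> a" "a \<le> b" "b \<le> 1" for a b
      using that by (simp add: t(3) s)
  qed (use t(1) in auto)
  then show ?thesis
    by eventually_elim (use t(2) in \<open>auto simp: ennreal_eq_1\<close>)
qed

lemma limit_label_ge:
  assumes F: "total_distribution m F" and i: "1 \<le> i" "i < m"
  shows "i \<le> limit_label m F p \<longleftrightarrow> threshold F i (fst p) < snd p"
  unfolding limit_label_def
proof (rule card_downset[OF _ i])
  fix i j assume "1 \<le> i" "i \<le> j" "j < m" "threshold F j (fst p) < snd p"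
  then show "threshold F i (fst p) < snd p"
    using threshold_props(4)[OF F, of j i "fst p"] by simp
qed

lemma limit_label_less: "m > 0 \<Longrightarrow> limit_label m F p < m"
proof -
  assume m: "m > 0"
  have "card {i\<in>{1..<m}. threshold F i (fst p) < snd p} \<le> card {1..<m}" by (rule card_mono) auto
  then show ?thesis using m by (simp add: limit_label_def)
qed

lemma limit_label_borel:
  assumes F: "total_distribution m F"
  shows "limit_label m F \<in> borel \<rightarrow>\<^sub>M count_space UNIV"
proof -
  have t: "threshold F i \<in> borel_measurable borel" if "i \<in> {1..<m}" for i
    using threshold_props(1)[OF F, of i] that by simp
  have fs: "fst \<in> borel_measurable (borel :: point measure)" "snd \<in> borel_measurable (borel :: point measure)"
    by (auto simp: borel_prod[symmetric])
  have s: "{p :: point. threshold F i (fst p) < snd p} \<in> sets borel" if "i \<in> {1..<m}" for i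
    using borel_measurable_less[OF measurable_compose[OF fs(1) t[OF that]] fs(2)] by simp
  have "(\<lambda>p. \<Sum>i\<in>{1..<m}. indicator {p. threshold F i (fst p) < snd p} p :: real) \<in> borel_measurable borel"
    by (intro borel_measurable_sum borel_measurable_indicator s)
  moreover have "(\<Sum>i\<in>{1..<m}. indicator {p. threshold F i (fst p) < snd p} p :: real) = real (limit_label m F p)" for p
    by (simp add: limit_label_def indicator_def sum.If_cases Int_def)
  ultimately have "(\<lambda>p. real (limit_label m F p)) \<in> borel_measurable borel" by simp
  then have "(\<lambda>p. nat \<lfloor>real (limit_label m F p)\<rfloor>) \<in> borel \<rightarrow>\<^sub>M count_space UNIV" by measurable
  then show ?thesis by simp
qed

lemma labelling_limit_label:
  assumes F: "total_distribution m F" shows "labelling m (limit_label m F)"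
proof -
  have "limit_label m F \<in> square_measure \<rightarrow>\<^sub>M count_space UNIV"
    by (rule measurable_restrict_space1) (simp add: measurable_completion limit_label_borel[OF F])
  then show ?thesis using F limit_label_less by (simp add: labelling_def total_distribution_def)
qed

lemma measure_square_borel:
  assumes "A \<in> sets borel" "A \<subseteq> unit_square"
  shows "emeasure square_measure A = (\<integral>\<^sup>+x. emeasure lborel (Pair x -` A) \<partial>lborel)"
proof -
  have "emeasure square_measure A = emeasure lborel A" using assms by (simp add: emeasure_restrict_space)
  also have "\<dots> = emeasure (lborel \<Otimes>\<^sub>M lborel) A" by (simp add: lborel_prod)
  also have "\<dots> = (\<integral>\<^sup>+x. emeasure lborel (Pair x -` A) \<partial>lborel)"
  proof (rule lborel.emeasure_pair_measure_alt)
    have "A \<in> sets (borel \<Otimes>\<^sub>M borel)" using assms(1) by (subst borel_prod)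
    also have "sets (borel \<Otimes>\<^sub>M borel) = sets (lborel \<Otimes>\<^sub>M lborel :: point measure)"
      by (rule sets_pair_measure_cong) simp_all
    finally show "A \<in> sets (lborel \<Otimes>\<^sub>M lborel)" .
  qed
  finally show ?thesis .
qed

text \<open>Over almost every abscissa \<open>x\<close> the cell \<open>i\<close> is a vertical interval between the consecutive thresholds,
  whose length is the derivative of \<open>F i\<close> at \<open>x\<close>.  Counting the points with label at least \<open>i\<close> avoids treating the
  last cell, which also collects points above all thresholds, separately.\<close>

lemma measure_limit_cell:
  assumes F: "total_distribution m F" and i: "i < m" and st: "0 \<le> s" "s \<le> t" "t \<le> 1"
  shows "area {p\<in>unit_square. limit_label m F p = i \<and> s < fst p \<and> fst p \<le> t} = F i t - F i s"
proof -
  define R where "R = {s<..t} \<times> {0<..1::real}"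
  define C where "C i = {p\<in>R. snd p \<le> threshold F i (fst p)}" for i
  define G where "G i = {p\<in>R. i \<le> limit_label m F p}" for i
  have m: "m > 0" using F by (simp add: total_distribution_def)
  have RQ: "R \<subseteq> unit_square" using st by (auto simp: R_def unit_square_def)
  have Rb: "R \<in> sets borel" unfolding R_def borel_prod[symmetric] by auto
  have Rm: "area R = t - s"
  proof -
    have "emeasure square_measure R = (\<integral>\<^sup>+x\<in>{s<..t}. 1 \<partial>lborel)"
      unfolding measure_square_borel[OF Rb RQ]
    proof (rule nn_integral_cong)
      fix x
      have "Pair x -` R = (if x \<in> {s<..t} then {0<..1} else {})" by (auto simp: R_def)
      then show "emeasure lborel (Pair x -` R) = 1 * indicator {s<..t} x" by (simp add: indicator_def)
    qed
    also have "\<dots> = ennreal (t - s)" using st by simp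
    finally show ?thesis using st by (simp add: measure_def)
  qed
  have Rs: "R \<in> sets square_measure" using Rb RQ by (simp add: sets_square_iff)
  have fs: "fst \<in> borel_measurable (borel :: point measure)" "snd \<in> borel_measurable (borel :: point measure)"
    by (auto simp: borel_prod[symmetric])
  have Cb: "C i \<in> sets borel" if "i \<le> m" for i
  proof -
    have "{p :: point. snd p \<le> threshold F i (fst p)} \<in> sets borel"
      using borel_measurable_le[OF fs(2) measurable_compose[OF fs(1) threshold_props(1)[OF F that]]] by simp
    moreover have "C i = R \<inter> {p. snd p \<le> threshold F i (fst p)}" by (auto simp: C_def)
    ultimately show ?thesis using Rb by auto
  qed
  have CQ: "C i \<subseteq> R" for i by (auto simp: C_def)
  have Cm: "area (C i) = (\<Sum>j<i. F j t - F j s)" if "i \<le> m" for i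
  proof -
    note th = threshold_props[OF F that]
    have "emeasure square_measure (C i) = (\<integral>\<^sup>+x. emeasure lborel (Pair x -` C i) \<partial>lborel)"
      using CQ RQ by (intro measure_square_borel[OF Cb[OF that]]) blast
    also have "\<dots> = (\<integral>\<^sup>+x\<in>{s<..t}. ennreal (threshold F i x) \<partial>lborel)"
    proof (rule nn_integral_cong_AE, use threshold_top[OF F] in eventually_elim)
      fix x assume x: "x \<in> {0<..1} \<longrightarrow> threshold F m x = 1"
      show "emeasure lborel (Pair x -` C i) = ennreal (threshold F i x) * indicator {s<..t} x"
      proof (cases "x \<in> {s<..t}")
        case True
        have "threshold F i x \<le> 1"
          using x True st threshold_props(4)[OF F order_refl that, of x] by auto
        then have "Pair x -` C i = {0<..threshold F i x}" using True by (auto simp: C_def R_def)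
        then show ?thesis using True th(2)[of x] by simp
      next
        case False
        then have "Pair x -` C i = {}" by (auto simp: C_def R_def)
        then show ?thesis using False by simp
      qed
    qed
    also have "\<dots> = ennreal (\<Sum>j<i. F j t - F j s)" by (rule th(3)[OF st(1,2)])
    finally show ?thesis
    proof -
      assume e: "emeasure square_measure (C i) = ennreal (\<Sum>j<i. F j t - F j s)"
      have "0 \<le> (\<Sum>j<i. F j t - F j s)"
        using F that st by (intro sum_nonneg) (auto simp: total_distribution_def distribution_def)
      then show ?thesis using e by (simp add: measure_def)
    qed
  qed
  have Gm: "G i \<in> sets square_measure \<and> area (G i) = (t - s) - (\<Sum>j<i. F j t - F j s)" if "i \<le> m" for i
  proof (cases "i < m")
    case True
    have "G i = R - C i"
    proof (cases "i = 0")
      case True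
      then show ?thesis by (auto simp: G_def C_def threshold_def R_def)
    next
      case False
      then show ?thesis using limit_label_ge[OF F _ True] by (auto simp: G_def C_def)
    qed
    moreover have "C i \<in> sets square_measure"
      using Cb[OF that] order_trans[OF CQ[of i] RQ] by (simp add: sets_square_iff)
    ultimately show ?thesis
      using Rs Rm Cm[OF that] L.finite_measure_Diff[OF Rs _ CQ] by auto
  next
    case False
    then have "i = m" using that by simp
    moreover have "G m = {}" using limit_label_less[OF m] by (auto simp: G_def not_le)
    moreover have "(\<Sum>j<m. F j t - F j s) = t - s"
      using F st by (auto simp: total_distribution_def sum_subtractf)
    ultimately show ?thesis by simp
  qed
  have "area (G i - G (Suc i)) = F i t - F i s"
  proof -
    have "G (Suc i) \<subseteq> G i" by (auto simp: G_def)
    then show ?thesis using Gm[of i] Gm[of "Suc i"] i L.finite_measure_Diff[of "G i" "G (Suc i)"] by simp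
  qed
  moreover have "area {p\<in>unit_square. limit_label m F p = i \<and> s < fst p \<and> fst p \<le> t}
      = area (G i - G (Suc i))"
  proof (rule measure_eq_AE)
    from AE_open_square show "AE p in square_measure. (p \<in> {p\<in>unit_square. limit_label m F p = i \<and> s < fst p \<and> fst p \<le> t}) = (p \<in> G i - G (Suc i))"
      using AE_space
      by eventually_elim (auto simp: G_def R_def open_square_def)
    have "{p\<in>unit_square. limit_label m F p = i \<and> s < fst p \<and> fst p \<le> t} = cell (limit_label m F) i \<inter> ({s<..t} \<times> UNIV)"
      by (auto simp: cell_def)
    moreover have "{s<..t} \<times> UNIV \<in> sets (lebesgue :: point measure)" by (rule lebesgue_times) auto
    ultimately show "{p\<in>unit_square. limit_label m F p = i \<and> s < fst p \<and> fst p \<le> t} \<in> sets square_measure"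
      using cell_sets[OF labelling_limit_label[OF F], of i] by (auto simp: sets_square_iff)
    show "G i - G (Suc i) \<in> sets square_measure" using Gm[of i] Gm[of "Suc i"] i by auto
  qed
  ultimately show ?thesis by simp
qed

lemma AE_square_fst:
  assumes "AE x in lborel. P x"
  shows "AE p in square_measure. P (fst p)"
proof -
  obtain N where N: "{x \<in> space lborel. \<not> P x} \<subseteq> N" "N \<in> null_sets lborel"
    using assms by (auto simp: eventually_ae_filter)
  have "N \<times> UNIV \<in> null_sets (lborel \<Otimes>\<^sub>M lborel :: point measure)"
    by (rule lborel.times_in_null_sets1[OF N(2)]) simp
  then have "N \<times> UNIV \<in> null_sets (lborel :: point measure)" by (simp add: lborel_prod)
  then have "AE p in (lborel :: point measure). P (fst p)" by (rule AE_I') (use N(1) in auto)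
  then have "AE p in (lebesgue :: point measure). P (fst p)" by (rule AE_completion)
  then show ?thesis by (subst AE_restrict_space_iff) auto
qed

lemma sum_div4:
  fixes g :: "nat \<Rightarrow> real"
  assumes "n \<le> m"
  shows "(\<Sum>i<n. \<Sum>j<4 * m. of_bool (j div 4 = i) * g j) = (\<Sum>j<4 * n. g j)"
proof -
  have "(\<Sum>i<n. \<Sum>j<4 * m. of_bool (j div 4 = i) * g j) = (\<Sum>j<4 * m. \<Sum>i<n. if j div 4 = i then g j else 0)"
    by (subst sum.swap) (auto intro!: sum.cong)
  also have "\<dots> = (\<Sum>j<4 * m. if j div 4 < n then g j else 0)" by simp
  also have "\<dots> = (\<Sum>j\<in>{j\<in>{..<4 * m}. j div 4 < n}. g j)"
    by (rule sum.inter_filter[symmetric]) simp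
  also have "{j\<in>{..<4 * m}. j div 4 < n} = {..<4 * n}" using assms by auto
  finally show ?thesis .
qed

text \<open>By uniqueness of densities, every fourth threshold of the finer level is almost everywhere a threshold
  of the coarser level.\<close>

lemma limit_label_refines:
  assumes F: "total_distribution m F" and F': "total_distribution (4 * m) F'"
    and sum: "\<And>i x. i < m \<Longrightarrow> F i x = (\<Sum>j<4 * m. of_bool (j div 4 = i) * F' j x)"
  shows "AE p in square_measure. limit_label m F p = limit_label (4 * m) F' p div 4"
proof -
  have m: "m > 0" using F by (simp add: total_distribution_def)
  have "AE x in lborel. x \<in> {0<..1} \<longrightarrow> threshold F i x = threshold F' (4 * i) x" if i: "i < m" for i
  proof -
    have i': "i \<le> m" "4 * i \<le> 4 * m" using i by auto
    note t = threshold_props[OF F i'(1)] and t' = threshold_props[OF F' i'(2)]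
    have s: "(\<Sum>j<i. F j b - F j a) = (\<Sum>j<4 * i. F' j b - F' j a)" for a b
    proof -
      have "(\<Sum>j<i. F j b - F j a) = (\<Sum>j<i. \<Sum>l<4 * m. of_bool (l div 4 = j) * (F' l b - F' l a))"
        using i by (intro sum.cong refl) (simp add: sum sum_subtractf right_diff_distrib)
      then show ?thesis using sum_div4[OF i'(1), of "\<lambda>j. F' j b - F' j a"] by simp
    qed
    have "AE x in lborel. x \<in> {0<..1} \<longrightarrow> ennreal (threshold F i x) = ennreal (threshold F' (4 * i) x)"
    proof (rule density_unique_Ioc)
      show "(\<integral>\<^sup>+x\<in>{0<..1}. ennreal (threshold F i x) \<partial>lborel) \<noteq> \<infinity>" by (simp add: t(3))
      show "(\<integral>\<^sup>+x\<in>{a<..b}. ennreal (threshold F i x) \<partial>lborel) = (\<integral>\<^sup>+x\<in>{a<..b}. ennreal (threshold F' (4 * i) x) \<partial>lborel)"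
        if "0 \<le> a" "a \<le> b" "b \<le> 1" for a b
        using that by (simp add: t(3) t'(3) s)
    qed (use t(1) t'(1) in auto)
    then show ?thesis by eventually_elim (use t(2) t'(2) in auto)
  qed
  then have "AE x in lborel. \<forall>i\<in>{..<m}. x \<in> {0<..1} \<longrightarrow> threshold F i x = threshold F' (4 * i) x"
    by (subst AE_finite_all) auto
  then have ae: "AE p in square_measure. \<forall>i\<in>{..<m}. fst p \<in> {0<..1} \<longrightarrow> threshold F i (fst p) = threshold F' (4 * i) (fst p)"
    by (rule AE_square_fst)
  from AE_open_square show ?thesis
    using ae AE_space
  proof eventually_elim
    fix p assume p: "p \<notin> unit_square - open_square" "p \<in> space square_measure"
      and eq: "\<forall>i\<in>{..<m}. fst p \<in> {0<..1} \<longrightarrow> threshold F i (fst p) = threshold F' (4 * i) (fst p)"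
    have p1: "fst p \<in> {0<..1}" using p by (auto simp: open_square_def)
    have iff: "i \<le> limit_label m F p \<longleftrightarrow> i \<le> limit_label (4 * m) F' p div 4" if i: "1 \<le> i" "i < m" for i
    proof -
      have "i \<le> limit_label m F p \<longleftrightarrow> threshold F' (4 * i) (fst p) < snd p"
        using limit_label_ge[OF F i] eq p1 i by simp
      also have "\<dots> \<longleftrightarrow> 4 * i \<le> limit_label (4 * m) F' p"
        using limit_label_ge[OF F', of "4 * i"] i by simp
      also have "\<dots> \<longleftrightarrow> i \<le> limit_label (4 * m) F' p div 4" by (simp add: less_eq_div_iff_mult_less_eq mult.commute)
      finally show ?thesis .
    qed
    have less: "limit_label m F p < m" "limit_label (4 * m) F' p div 4 < m"
      using limit_label_less[of m F p] limit_label_less[of "4 * m" F' p] m by auto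
    show "limit_label m F p = limit_label (4 * m) F' p div 4"
    proof (rule antisym)
      show "limit_label m F p \<le> limit_label (4 * m) F' p div 4"
        using iff[of "limit_label m F p"] less by (cases "limit_label m F p = 0") auto
      show "limit_label (4 * m) F' p div 4 \<le> limit_label m F p"
        using iff[of "limit_label (4 * m) F' p div 4"] less by (cases "limit_label (4 * m) F' p div 4 = 0") auto
    qed
  qed
qed

section \<open>Compactness of profiles\<close>

text \<open>Countable products of intervals are compact and metrizable.\<close>

lemma common_subsequence:
  fixes X :: "nat \<Rightarrow> 'i::countable \<Rightarrow> real"
  assumes X: "\<And>n i. 0 \<le> X n i \<and> X n i \<le> 1"
  shows "\<exists>r L. strict_mono r \<and> (\<forall>i. (\<lambda>n. X (r n) i) \<longlonglongrightarrow> L i)"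
proof -
  define S :: "('i \<Rightarrow> real) set" where "S = PiE UNIV (\<lambda>_. {0..1})"
  have "compactin (product_topology (\<lambda>_. euclideanreal) UNIV) S"
    unfolding S_def by (subst compactin_PiE) simp
  then have "compact S" by (simp add: euclidean_product_topology)
  then have "seq_compact S" by (rule compact_imp_seq_compact)
  moreover have "X n \<in> S" for n using X by (auto simp: S_def)
  ultimately obtain L r where r: "strict_mono (r :: nat \<Rightarrow> nat)" and lim: "(X \<circ> r) \<longlonglongrightarrow> L"
    unfolding seq_compact_def by blast
  have "(\<lambda>n. X (r n) i) \<longlonglongrightarrow> L i" for i
  proof -
    have "isCont (\<lambda>f :: 'i \<Rightarrow> real. f i) L"
    proof -
      have "continuous_on UNIV (\<lambda>f :: 'i \<Rightarrow> real. f i)" by (rule continuous_on_product_coordinates)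
      then show ?thesis using continuous_on_eq_continuous_at[OF open_UNIV] by blast
    qed
    from isCont_tendsto_compose[OF this lim] show ?thesis by (simp add: comp_def)
  qed
  then show ?thesis using r by blast
qed

text \<open>Equicontinuity turns convergence at the rationals into convergence everywhere.\<close>

lemma lipschitz_convergent:
  fixes G :: "nat \<Rightarrow> real \<Rightarrow> real"
  assumes G: "\<And>n. distribution (G n)" and rat: "\<And>q. convergent (\<lambda>n. G n (real_of_rat q))"
  shows "convergent (\<lambda>n. G n x)"
proof -
  have "Cauchy (\<lambda>n. G n x)"
  proof (rule CauchyI)
    fix e :: real assume e: "0 < e"
    obtain q where q: "x < real_of_rat q" "real_of_rat q < x + e / 3"
      using of_rat_dense[of x "x + e / 3"] e by auto
    have near: "\<bar>G n x - G n (real_of_rat q)\<bar> \<le> e / 3" for n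
    proof -
      have "0 \<le> G n (real_of_rat q) - G n x \<and> G n (real_of_rat q) - G n x \<le> real_of_rat q - x"
        using G[of n] q(1) by (simp add: distribution_def)
      then show ?thesis using q by linarith
    qed
    have "Cauchy (\<lambda>n. G n (real_of_rat q))" using rat by (rule convergent_Cauchy)
    then obtain M where M: "\<And>m n. m \<ge> M \<Longrightarrow> n \<ge> M \<Longrightarrow> norm (G m (real_of_rat q) - G n (real_of_rat q)) < e / 3"
      using CauchyD[of "\<lambda>n. G n (real_of_rat q)" "e / 3"] e by auto
    have "norm (G m x - G n x) < e" if "m \<ge> M" "n \<ge> M" for m n
      using M[OF that] near[of m] near[of n] unfolding real_norm_def by linarith
    then show "\<exists>M. \<forall>m\<ge>M. \<forall>n\<ge>M. norm (G m x - G n x) < e" by blast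
  qed
  then show ?thesis by (simp add: Cauchy_convergent_iff)
qed

definition cell_cdf :: "(point \<Rightarrow> nat) \<Rightarrow> nat \<Rightarrow> real \<Rightarrow> real" where
  "cell_cdf c i x = area {p\<in>unit_square. c p = i \<and> fst p \<le> x}"

lemma vertical_sets:
  assumes "labelling m c" and A: "A \<in> sets borel"
  shows "{p\<in>unit_square. c p = i \<and> fst p \<in> A} \<in> sets square_measure"
proof -
  have "A \<times> UNIV \<in> sets (lebesgue :: point measure)"
    by (rule lebesgue_times) (use A in auto)
  moreover have "{p\<in>unit_square. c p = i \<and> fst p \<in> A} = cell c i \<inter> (A \<times> UNIV)"
    by (auto simp: cell_def)
  ultimately show ?thesis
    using cell_sets[OF assms(1), of i] by (auto simp: sets_square_iff)
qed

lemma vertical_strip_measure: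
  fixes A :: "real set"
  assumes "A \<in> sets borel" "A \<subseteq> {0..1}"
  shows "A \<times> {0..1} \<in> sets square_measure" "area (A \<times> {0..1}) = measure lborel A"
proof -
  have sub: "A \<times> {0..1} \<subseteq> unit_square" using assms by (auto simp: unit_square_def)
  have l: "A \<times> {0..1::real} \<in> sets lebesgue" "emeasure lebesgue (A \<times> {0..1::real}) = emeasure lborel A"
    using lebesgue_times[of A "{0..1::real}"] assms by simp_all
  show "A \<times> {0..1} \<in> sets square_measure" using l sub by (simp add: sets_square_iff)
  show "area (A \<times> {0..1}) = measure lborel A"
    using l sub by (simp add: emeasure_restrict_space measure_def)
qed

lemma cell_cdf_diff:
  assumes c: "labelling m c" and st: "s \<le> t"
  shows "area {p\<in>unit_square. c p = i \<and> s < fst p \<and> fst p \<le> t} = cell_cdf c i t - cell_cdf c i s"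
proof -
  have m: "{p\<in>unit_square. c p = i \<and> fst p \<le> x} \<in> sets square_measure" for x
    using vertical_sets[OF c, of "{..x}" i] by simp
  have "{p\<in>unit_square. c p = i \<and> s < fst p \<and> fst p \<le> t}
      = {p\<in>unit_square. c p = i \<and> fst p \<le> t} - {p\<in>unit_square. c p = i \<and> fst p \<le> s}" by auto
  moreover have "{p\<in>unit_square. c p = i \<and> fst p \<le> s} \<subseteq> {p\<in>unit_square. c p = i \<and> fst p \<le> t}" using st by auto
  ultimately show ?thesis unfolding cell_cdf_def using L.finite_measure_Diff[OF m m] by simp
qed

lemma distribution_cell_cdf:
  assumes c: "labelling m c" shows "distribution (cell_cdf c i)"
  unfolding distribution_def
proof (intro allI impI)
  fix s t :: real assume st: "s \<le> t"
  have v: "({s<..t} \<inter> {0..1}) \<times> {0..1} \<in> sets square_measure"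
    "area (({s<..t} \<inter> {0..1}) \<times> {0..1}) = measure lborel ({s<..t} \<inter> {0..1})"
    using vertical_strip_measure[of "{s<..t} \<inter> {0..1}"] by simp_all
  have "{p\<in>unit_square. c p = i \<and> s < fst p \<and> fst p \<le> t} \<subseteq> ({s<..t} \<inter> {0..1}) \<times> {0..1}"
    by (auto simp: unit_square_def)
  then have "area {p\<in>unit_square. c p = i \<and> s < fst p \<and> fst p \<le> t}
      \<le> measure lborel ({s<..t} \<inter> {0..1})"
    unfolding v(2)[symmetric] using v(1) by (rule L.finite_measure_mono)
  also have "\<dots> \<le> measure lborel {s<..t}"
    using st by (intro measure_mono_fmeasurable) (auto simp: fmeasurable_def)
  finally show "0 \<le> cell_cdf c i t - cell_cdf c i s \<and> cell_cdf c i t - cell_cdf c i s \<le> t - s"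
    using st cell_cdf_diff[OF c st, of i, symmetric] by simp
qed

lemma cell_cdf_bounds: "0 \<le> cell_cdf c i x" "cell_cdf c i x \<le> 1"
  using L.bounded_measure[of "{p\<in>unit_square. c p = i \<and> fst p \<le> x}"] by (auto simp: cell_cdf_def)

lemma sum_cell_cdf:
  assumes c: "labelling m c" and x: "x \<in> {0..1}"
  shows "(\<Sum>i<m. cell_cdf c i x) = x"
proof -
  have m: "{p\<in>unit_square. c p = i \<and> fst p \<le> x} \<in> sets square_measure" for i
    using vertical_sets[OF c, of "{..x}" i] by simp
  have "(\<Sum>i<m. cell_cdf c i x) = area (\<Union>i<m. {p\<in>unit_square. c p = i \<and> fst p \<le> x})"
    unfolding cell_cdf_def
    by (rule L.finite_measure_finite_Union[symmetric]) (use m in \<open>auto simp: disjoint_family_on_def\<close>)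
  also have "(\<Union>i<m. {p\<in>unit_square. c p = i \<and> fst p \<le> x}) = {0..x} \<times> {0..1}"
    using c x by (auto simp: labelling_def unit_square_def)
  also have "area \<dots> = x"
    using vertical_strip_measure(2)[of "{0..x}"] x by simp
  finally show ?thesis .
qed

lemma cell_cdf_refines:
  assumes c': "labelling n c'" and r: "\<And>p. c p = r (c' p)"
  shows "cell_cdf c i x = (\<Sum>j<n. of_bool (r j = i) * cell_cdf c' j x)"
proof -
  have m: "{p\<in>unit_square. c' p = j \<and> fst p \<le> x} \<in> sets square_measure" for j
    using vertical_sets[OF c', of "{..x}" j] by simp
  have "{p\<in>unit_square. c p = i \<and> fst p \<le> x} = (\<Union>j\<in>{j\<in>{..<n}. r j = i}. {p\<in>unit_square. c' p = j \<and> fst p \<le> x})"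
    using c' by (auto simp: labelling_def r)
  then have "cell_cdf c i x = (\<Sum>j\<in>{j\<in>{..<n}. r j = i}. cell_cdf c' j x)"
    unfolding cell_cdf_def
    by (simp only:) (rule L.finite_measure_finite_Union, use m in \<open>auto simp: disjoint_family_on_def\<close>)
  also have "\<dots> = (\<Sum>j<n. of_bool (r j = i) * cell_cdf c' j x)"
    by (intro sum.mono_neutral_cong_left) auto
  finally show ?thesis .
qed

lemma mass_cell_cdf:
  assumes c: "labelling m c" shows "mass c i = cell_cdf c i 1 - cell_cdf c i 0"
proof -
  have "mass c i = area {p\<in>unit_square. c p = i \<and> 0 < fst p \<and> fst p \<le> 1}"
    unfolding mass_def
  proof (rule measure_eq_AE)
    from AE_open_square show "AE p in square_measure. (p \<in> cell c i) = (p \<in> {p\<in>unit_square. c p = i \<and> 0 < fst p \<and> fst p \<le> 1})"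
      by eventually_elim (auto simp: cell_def open_square_def)
    show "{p\<in>unit_square. c p = i \<and> 0 < fst p \<and> fst p \<le> 1} \<in> sets square_measure"
      using vertical_sets[OF c, of "{0<..1}" i] by simp
  qed (rule cell_sets[OF c])
  then show ?thesis using cell_cdf_diff[OF c, of 0 1 i] by simp
qed

lemma strip_cell_cdf:
  assumes c: "labelling m c" and M: "M > 0"
  shows "area (strip_cell M c i j) = cell_cdf c i ((real j + 1) / M) - cell_cdf c i (real j / M)"
proof -
  have "strip_cell M c i j = {p\<in>unit_square. c p = i \<and> real j / M < fst p \<and> fst p \<le> (real j + 1) / M}"
    by (auto simp: strip_cell_def cell_def)
  then show ?thesis using cell_cdf_diff[OF c] by (simp add: divide_right_mono)
qed

text \<open>The exchange of the two points preserves the measure.\<close>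

lemma block_commute:
  assumes W: "kernel W" and sym: "\<And>u v. u \<in> unit_square \<Longrightarrow> v \<in> unit_square \<Longrightarrow> W (u, v) = W (v, u)"
    and c: "labelling m c"
  shows "block c W i j = block c W j i"
proof -
  note cs = cell_sets[OF c] and sw = measure_preserving_swap
  have "block c W i j = (\<integral>z. indicator (cell c i \<times> cell c j) z * W z \<partial>distr square2_measure square2_measure (\<lambda>(u, v). (v, u)))"
    unfolding block_def rectangle_integral[OF cs cs] by (simp add: sw(2))
  also have "\<dots> = (\<integral>z. indicator (cell c i \<times> cell c j) ((\<lambda>(u, v). (v, u)) z) * W ((\<lambda>(u, v). (v, u)) z) \<partial>square2_measure)"
    by (rule integral_distr[OF sw(1)]) (rule kernel_measurable[OF kernel_rectangle[OF W cs cs]])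
  also have "\<dots> = block c W j i"
    unfolding block_def rectangle_integral[OF cs cs]
  proof (rule Bochner_Integration.integral_cong[OF refl])
    fix z assume "z \<in> space square2_measure"
    then obtain u v where z: "z = (u, v)" "u \<in> unit_square" "v \<in> unit_square" by auto
    show "indicator (cell c i \<times> cell c j) ((\<lambda>(u, v). (v, u)) z) * W ((\<lambda>(u, v). (v, u)) z)
        = indicator (cell c j \<times> cell c i) z * W z"
      using sym[OF z(2,3)] by (simp add: z(1) indicator_def conj_commute)
  qed
  finally show ?thesis .
qed

section \<open>Completeness in the mean\<close>

text \<open>The truncation keeps the values in \<open>[0,1]\<close> where the limit does not exist.\<close>

definition truncated_limit :: "(nat \<Rightarrow> point \<times> point \<Rightarrow> real) \<Rightarrow> point \<times> point \<Rightarrow> real" where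
  "truncated_limit U z = max 0 (min 1 (lim (\<lambda>i. U i z)))"

lemma unit_kernel_truncated_limit:
  assumes "\<And>i. unit_kernel (U i)" shows "unit_kernel (truncated_limit U)"
proof -
  have "U i \<in> borel_measurable square2_measure" for i
    using assms by (auto simp: unit_kernel_def kernel_def)
  then have "truncated_limit U \<in> borel_measurable square2_measure"
    unfolding truncated_limit_def[abs_def] by measurable
  then have "kernel (truncated_limit U)" by (rule kernelI[of _ 1]) (auto simp: truncated_limit_def)
  then show ?thesis by (simp add: unit_kernel_def truncated_limit_def)
qed

text \<open>Along a subsequence with summable \<open>L\<^sup>1\<close> distances the kernels converge almost everywhere.  The limit is
  given explicitly as a function of the kernels, so that it inherits their symmetry at every point.\<close>

lemma L1_Cauchy_limit:
  assumes U: "\<And>k. unit_kernel (U k)"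
    and Cauchy: "\<And>e. e > 0 \<Longrightarrow> \<exists>K. \<forall>k\<ge>K. \<forall>l\<ge>K. L1_norm (\<lambda>z. U k z - U l z) \<le> e"
  shows "\<exists>r. strict_mono r \<and>
     (\<lambda>k. L1_norm (\<lambda>z. U k z - truncated_limit (\<lambda>i. U (r i)) z)) \<longlonglongrightarrow> 0"
proof -
  have k: "kernel (U k)" for k using U by (simp add: unit_kernel_def)
  have U01: "0 \<le> U k z" "U k z \<le> 1" if "z \<in> square2" for k z
    using U[of k] that unfolding unit_kernel_def by blast+
  have "\<forall>i. \<exists>K. \<forall>k\<ge>K. \<forall>l\<ge>K. L1_norm (\<lambda>z. U k z - U l z) \<le> (1/2) ^ i"
    using Cauchy by simp
  then obtain K where K: "\<And>i k l. k \<ge> K i \<Longrightarrow> l \<ge> K i \<Longrightarrow> L1_norm (\<lambda>z. U k z - U l z) \<le> (1/2) ^ i"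
    by (auto dest!: choice)
  \<comment> \<open>strictly increasing and at least \<open>K i\<close>\<close>
  define r where "r i = (\<Sum>j\<le>i. K j) + i" for i
  have r: "strict_mono r" by (rule strict_monoI_Suc) (simp add: r_def)
  have rK: "K i \<le> r i" for i
  proof -
    have "K i \<le> (\<Sum>j\<le>i. K j)" by (rule member_le_sum) auto
    then show ?thesis by (simp add: r_def)
  qed
  have Kr: "L1_norm (\<lambda>z. U (r i) z - U l z) \<le> (1/2) ^ i" if "l \<ge> r i" for i l
    using K[of i "r i" l] rK[of i] that by linarith
  define D where "D i z = \<bar>U (r (Suc i)) z - U (r i) z\<bar>" for i z
  have kD: "kernel (D i)" for i unfolding D_def[abs_def] by (intro kernel_abs kernel_diff k)
  have "(\<integral>\<^sup>+z. (\<Sum>i. ennreal (D i z)) \<partial>square2_measure) = (\<Sum>i. \<integral>\<^sup>+z. ennreal (D i z) \<partial>square2_measure)"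
    using kernel_measurable[OF kD] by (intro nn_integral_suminf) auto
  also have "\<dots> \<le> (\<Sum>i. ennreal ((1/2) ^ i))"
  proof (intro suminf_le)
    fix i
    have "(\<integral>\<^sup>+z. ennreal (D i z) \<partial>square2_measure) = ennreal (\<integral>z. D i z \<partial>square2_measure)"
      by (rule nn_integral_eq_integral[OF kernel_integrable[OF kD]]) (simp add: D_def)
    also have "(\<integral>z. D i z \<partial>square2_measure) \<le> (1/2) ^ i"
      using Kr[of i "r (Suc i)"] strict_mono_leD[OF r, of i "Suc i"] unfolding D_def by (simp add: abs_minus_commute)
    finally show "(\<integral>\<^sup>+z. ennreal (D i z) \<partial>square2_measure) \<le> ennreal ((1/2) ^ i)"
      by (simp add: ennreal_leI)
  qed auto
  also have "\<dots> = ennreal (\<Sum>i. (1/2) ^ i)" by (intro suminf_ennreal2) auto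
  also have "\<dots> < \<infinity>" by simp
  finally have "AE z in square2_measure. (\<Sum>i. ennreal (D i z)) \<noteq> \<infinity>"
    using kernel_measurable[OF kD] by (intro nn_integral_PInf_AE) auto
  then have conv: "AE z in square2_measure. (\<lambda>i. U (r i) z) \<longlonglongrightarrow> truncated_limit (\<lambda>i. U (r i)) z"
    using AE_space
  proof eventually_elim
    fix z assume fin: "(\<Sum>i. ennreal (D i z)) \<noteq> \<infinity>" and z: "z \<in> space square2_measure"
    have "summable (\<lambda>i. D i z)"
      by (rule summable_suminf_not_top) (use fin in \<open>auto simp: D_def\<close>)
    then have "summable (\<lambda>i. U (r (Suc i)) z - U (r i) z)"
      unfolding D_def by (rule summable_rabs_cancel)
    then have "convergent (\<lambda>n. (\<Sum>i<n. U (r (Suc i)) z - U (r i) z))"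
      by (simp add: summable_iff_convergent)
    then have "convergent (\<lambda>n. U (r n) z - U (r 0) z)"
      unfolding sum_lessThan_telescope[of "\<lambda>i. U (r i) z"] .
    then have "convergent (\<lambda>n. (U (r n) z - U (r 0) z) + U (r 0) z)"
      by (intro convergent_add convergent_const)
    then obtain L where L: "(\<lambda>n. U (r n) z) \<longlonglongrightarrow> L" by (auto simp: convergent_def)
    have "0 \<le> L" "L \<le> 1"
      using U01[of z] z by (auto intro: LIMSEQ_le_const[OF L] LIMSEQ_le_const2[OF L])
    then show "(\<lambda>i. U (r i) z) \<longlonglongrightarrow> truncated_limit (\<lambda>i. U (r i)) z"
      using L limI[OF L] by (simp add: truncated_limit_def)
  qed
  define V where "V = truncated_limit (\<lambda>i. U (r i))"
  have "unit_kernel V" unfolding V_def by (rule unit_kernel_truncated_limit) (rule U)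
  then have kV: "kernel V" by (simp add: unit_kernel_def)
  have le: "L1_norm (\<lambda>z. U l z - V z) \<le> (1/2) ^ i" if l: "l \<ge> r i" for i l
  proof -
    have "(\<lambda>j. L1_norm (\<lambda>z. U l z - U (r j) z)) \<longlonglongrightarrow> L1_norm (\<lambda>z. U l z - V z)"
    proof (rule integral_dominated_convergence[where w="\<lambda>_. 1"])
      show "AE z in square2_measure. (\<lambda>j. \<bar>U l z - U (r j) z\<bar>) \<longlonglongrightarrow> \<bar>U l z - V z\<bar>"
        using conv by eventually_elim (unfold V_def, intro tendsto_intros)
      show "AE z in square2_measure. norm \<bar>U l z - U (r j) z\<bar> \<le> 1" for j
        using AE_space
      proof eventually_elim
        fix z assume "z \<in> space square2_measure"
        then have "z \<in> square2" by simp
        from U01[OF this, of l] U01[OF this, of "r j"] show "norm \<bar>U l z - U (r j) z\<bar> \<le> 1" by (simp add: abs_le_iff)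
      qed
      show "integrable square2_measure (\<lambda>_. 1 :: real)" by (rule kernel_integrable[OF kernel_const])
    qed (intro kernel_measurable kernel_abs kernel_diff k kV)+
    moreover have "L1_norm (\<lambda>z. U l z - U (r j) z) \<le> (1/2) ^ i" if "j \<ge> i" for j
      using K[of i l "r j"] rK[of i] l strict_mono_leD[OF r that] by linarith
    ultimately show ?thesis using LIMSEQ_le_const2 by blast
  qed
  have "(\<lambda>k. L1_norm (\<lambda>z. U k z - V z)) \<longlonglongrightarrow> 0"
  proof (rule LIMSEQ_I)
    fix e :: real assume "e > 0"
    then obtain i where i: "(1/2) ^ i < e" using real_arch_pow_inv[of e "1/2"] by auto
    show "\<exists>no. \<forall>n\<ge>no. norm (L1_norm (\<lambda>z. U n z - V z) - 0) < e"
    proof (intro exI[of _ "r i"] allI impI)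
      fix n assume "r i \<le> n"
      then have "L1_norm (\<lambda>z. U n z - V z) < e" using le[of i n] i by linarith
      then show "norm (L1_norm (\<lambda>z. U n z - V z) - 0) < e" by simp
    qed
  qed
  then show ?thesis using r unfolding V_def by blast
qed

section \<open>Comparing step kernels along a bijection\<close>

text \<open>Where the labels agree along \<open>f\<close>, only the values on equal labels matter; on the remaining set, and its
  counterpart for the second point, the values in \<open>[0,1]\<close> differ by at most 1.\<close>

lemma step_comparison:
  assumes c: "labelling m c" and c': "labelling m c'" and f: "f \<in> mp_bijections"
    and s: "submass m (mass c) B" and \<alpha>: "\<And>i j. i < m \<Longrightarrow> j < m \<Longrightarrow> 0 \<le> \<alpha> i j \<and> \<alpha> i j \<le> 1"
  shows "L1_norm (\<lambda>z. step c (average (mass c) B) z - pullback (step c' \<alpha>) f z)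
    \<le> (\<Sum>i<m. \<Sum>j<m. \<bar>B i j - \<alpha> i j * (mass c i * mass c j)\<bar>)
      + 2 * area {p\<in>unit_square. c p \<noteq> c' (f p)}"
proof -
  define Z where "Z = {p\<in>unit_square. c p \<noteq> c' (f p)}"
  define \<beta> where "\<beta> = average (mass c) B"
  have fm: "f \<in> square_measure \<rightarrow>\<^sub>M square_measure" by (rule mp_bijectionsD(4)[OF f])
  have Zs: "Z \<in> sets square_measure"
    unfolding Z_def using c c' by (intro mismatch_sets measurable_compose[OF fm]) (auto simp: labelling_def)
  note ZQ = pair_times[OF Zs sets_lebesgue_on_refl] and QZ = pair_times[OF sets_lebesgue_on_refl Zs]
  have k1: "kernel (step c (\<lambda>i j. \<bar>\<beta> i j - \<alpha> i j\<bar>))" by (rule step_kernel[OF c])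
  have k2: "kernel (indicator (Z \<times> unit_square))" "kernel (indicator (unit_square \<times> Z))"
    by (rule kernel_indicator[OF ZQ(1)], rule kernel_indicator[OF QZ(1)])
  have pt: "\<bar>step c \<beta> z - pullback (step c' \<alpha>) f z\<bar>
      \<le> step c (\<lambda>i j. \<bar>\<beta> i j - \<alpha> i j\<bar>) z + (indicator (Z \<times> unit_square) z + indicator (unit_square \<times> Z) z)"
    if z: "z \<in> square2" for z
  proof -
    obtain u v where uv: "z = (u, v)" "u \<in> unit_square" "v \<in> unit_square" using z by auto
    show ?thesis
    proof (cases "u \<in> Z \<or> v \<in> Z")
      case False
      then have "c u = c' (f u)" "c v = c' (f v)" using uv by (auto simp: Z_def)
      then show ?thesis by (simp add: uv(1) step_def pullback_def)
    next
      case True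
      have l: "c u < m" "c v < m" "c' (f u) < m" "c' (f v) < m"
        using c c' uv mp_bijectionsD(5)[OF f] by (auto simp: labelling_def)
      have "\<bar>\<beta> (c u) (c v) - \<alpha> (c' (f u)) (c' (f v))\<bar> \<le> 1"
        using average_bounds[OF s l(1,2)] \<alpha>[OF l(3,4)] unfolding \<beta>_def by (simp add: abs_le_iff)
      moreover have "1 \<le> (indicator (Z \<times> unit_square) z + indicator (unit_square \<times> Z) z :: real)"
        using True uv by (auto simp: indicator_def)
      ultimately show ?thesis by (simp add: uv(1) step_def pullback_def)
    qed
  qed
  have "L1_norm (\<lambda>z. step c \<beta> z - pullback (step c' \<alpha>) f z)
      \<le> (\<integral>z. step c (\<lambda>i j. \<bar>\<beta> i j - \<alpha> i j\<bar>) z + (indicator (Z \<times> unit_square) z + indicator (unit_square \<times> Z) z) \<partial>square2_measure)"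
    by (rule integral_mono)
      (use pt kernel_integrable[OF k1] kernel_integrable[OF k2(1)] kernel_integrable[OF k2(2)] in
       \<open>auto intro!: kernel_integrable kernel_abs kernel_diff step_kernel[OF c] kernel_pullback(1)[OF f] step_kernel[OF c']\<close>)
  also have "\<dots> = (\<integral>z. step c (\<lambda>i j. \<bar>\<beta> i j - \<alpha> i j\<bar>) z \<partial>square2_measure)
      + ((\<integral>z. indicator (Z \<times> unit_square) z \<partial>square2_measure) + (\<integral>z. indicator (unit_square \<times> Z) z \<partial>square2_measure))"
    using kernel_integrable[OF k1] kernel_integrable[OF k2(1)] kernel_integrable[OF k2(2)]
    by (simp only: Bochner_Integration.integral_add Bochner_Integration.integrable_add)
  also have "(\<integral>z. indicator (Z \<times> unit_square) z \<partial>square2_measure) = area Z"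
    using ZQ by (simp only: Bochner_Integration.integral_indicator sets.Int_space_eq2) simp
  also have "(\<integral>z. indicator (unit_square \<times> Z) z \<partial>square2_measure) = area Z"
    using QZ by (simp only: Bochner_Integration.integral_indicator sets.Int_space_eq2) simp
  also have "(\<integral>z. step c (\<lambda>i j. \<bar>\<beta> i j - \<alpha> i j\<bar>) z \<partial>square2_measure)
      = (\<Sum>i<m. \<Sum>j<m. \<bar>\<beta> i j - \<alpha> i j\<bar> * (mass c i * mass c j))"
    by (rule integral_step[OF c])
  also have "\<dots> = (\<Sum>i<m. \<Sum>j<m. \<bar>B i j - \<alpha> i j * (mass c i * mass c j)\<bar>)"
  proof (intro sum.cong refl)
    fix i j assume "i \<in> {..<m}" "j \<in> {..<m}"
    then have "B i j = \<beta> i j * (mass c i * mass c j)"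
      using average_mult_mass[OF s, of i j] by (simp add: \<beta>_def)
    moreover have "0 \<le> mass c i * mass c j" by simp
    ultimately show "\<bar>\<beta> i j - \<alpha> i j\<bar> * (mass c i * mass c j) = \<bar>B i j - \<alpha> i j * (mass c i * mass c j)\<bar>"
      by (simp add: abs_mult left_diff_distrib[symmetric])
  qed
  finally show ?thesis by (simp add: \<beta>_def Z_def)
qed

section \<open>The limit orderon\<close>

lemma profile_subsequence:
  fixes c :: "nat \<Rightarrow> nat \<Rightarrow> point \<Rightarrow> nat" and W :: "nat \<Rightarrow> point \<times> point \<Rightarrow> real"
  assumes lab: "\<And>n k. labelling (4 ^ k) (c n k)" and W: "\<And>n. unit_kernel (W n)"
  shows "\<exists>r F B. strict_mono r \<and> (\<forall>k i x. (\<lambda>n. cell_cdf (c (r n) k) i x) \<longlonglongrightarrow> F k i x) \<and>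
     (\<forall>k. \<forall>i<4 ^ k. \<forall>j<4 ^ k. (\<lambda>n. block (c (r n) k) (W (r n)) i j) \<longlonglongrightarrow> B k i j)"
proof -
  define X :: "nat \<Rightarrow> (nat \<times> nat \<times> rat) + (nat \<times> nat \<times> nat) \<Rightarrow> real" where
    "X n = case_sum (\<lambda>(k, i, q). cell_cdf (c n k) i (real_of_rat q))
       (\<lambda>(k, i, j). if i < 4 ^ k \<and> j < 4 ^ k then block (c n k) (W n) i j else 0)" for n
  have block01: "0 \<le> block (c n k) (W n) i j \<and> block (c n k) (W n) i j \<le> 1" if "i < 4 ^ k" "j < 4 ^ k" for n k i j
  proof -
    have "mass (c n k) i * mass (c n k) j \<le> 1 * 1"
      by (rule mult_mono) (use L.bounded_measure in \<open>auto simp: mass_def\<close>)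
    then show ?thesis using block_submass[OF W lab, of k n n] that by (fastforce simp: submass_def)
  qed
  have "0 \<le> X n s \<and> X n s \<le> 1" for n s
    by (cases s) (auto simp: X_def cell_cdf_bounds block01)
  from common_subsequence[of X, OF this] obtain r L where r: "strict_mono r"
    and lim: "\<And>s. (\<lambda>n. X (r n) s) \<longlonglongrightarrow> L s" by blast
  have rat: "convergent (\<lambda>n. cell_cdf (c (r n) k) i (real_of_rat q))" for k i q
    using lim[of "Inl (k, i, q)"] by (auto simp: X_def convergent_def)
  have "convergent (\<lambda>n. cell_cdf (c (r n) k) i x)" for k i x
    by (rule lipschitz_convergent[OF distribution_cell_cdf[OF lab] rat])
  then have F: "(\<lambda>n. cell_cdf (c (r n) k) i x) \<longlonglongrightarrow> lim (\<lambda>n. cell_cdf (c (r n) k) i x)" for k i x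
    by (simp add: convergent_LIMSEQ_iff)
  have B: "(\<lambda>n. block (c (r n) k) (W (r n)) i j) \<longlonglongrightarrow> L (Inr (k, i, j))" if "i < 4 ^ k" "j < 4 ^ k" for k i j
    using lim[of "Inr (k, i, j)"] that by (simp add: X_def)
  show ?thesis
    by (intro exI[of _ r] exI[of _ "\<lambda>k i x. lim (\<lambda>n. cell_cdf (c (r n) k) i x)"]
        exI[of _ "\<lambda>k i j. L (Inr (k, i, j))"]) (use r F B in blast)
qed

text \<open>The locale fixes a sequence, already thinned out, whose profiles converge, and constructs its limit.\<close>

locale profile_limit =
  fixes W :: "nat \<Rightarrow> point \<times> point \<Rightarrow> real" and c :: "nat \<Rightarrow> nat \<Rightarrow> point \<Rightarrow> nat"
    and F :: "nat \<Rightarrow> nat \<Rightarrow> real \<Rightarrow> real" and B :: "nat \<Rightarrow> nat \<Rightarrow> nat \<Rightarrow> real"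
  assumes orderon: "W n \<in> orderons"
    and filtration: "regular_filtration (W n) (c n)"
    and cdf_tendsto: "(\<lambda>n. cell_cdf (c n k) i x) \<longlonglongrightarrow> F k i x"
    and block_tendsto: "i < 4 ^ k \<Longrightarrow> j < 4 ^ k \<Longrightarrow> (\<lambda>n. block (c n k) (W n) i j) \<longlonglongrightarrow> B k i j"
begin

lemma unit: "unit_kernel (W n)" using orderon by (rule orderon_unit_kernel)

lemma kernel_W: "kernel (W n)" using orderon by (rule orderon_kernel)

lemma lab: "labelling (4 ^ k) (c n k)"
  using filtration[of n] by (simp add: regular_filtration_def)

lemma refines: "k \<le> l \<Longrightarrow> c n k p = c n l p div 4 ^ (l - k)"
proof (induction l rule: dec_induct)
  case (step l)
  have "c n l p = c n (Suc l) p div 4" using filtration[of n] unfolding regular_filtration_def by metis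
  then show ?case using step by (simp add: Suc_diff_le div_mult2_eq)
qed simp

lemma distribution_F: "distribution (F k i)"
  unfolding distribution_def
proof (intro allI impI)
  fix x y :: real assume xy: "x \<le> y"
  have t: "(\<lambda>n. cell_cdf (c n k) i y - cell_cdf (c n k) i x) \<longlonglongrightarrow> F k i y - F k i x"
    by (intro tendsto_diff cdf_tendsto)
  have "0 \<le> cell_cdf (c n k) i y - cell_cdf (c n k) i x" "cell_cdf (c n k) i y - cell_cdf (c n k) i x \<le> y - x" for n
    using distribution_cell_cdf[OF lab, of n k i] xy by (auto simp: distribution_def)
  then show "0 \<le> F k i y - F k i x \<and> F k i y - F k i x \<le> y - x"
    using LIMSEQ_le_const[OF t] LIMSEQ_le_const2[OF t] by blast
qed

lemma total_F: "total_distribution (4 ^ k) (F k)"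
  unfolding total_distribution_def
proof (intro conjI allI impI ballI distribution_F)
  fix x :: real assume x: "x \<in> {0..1}"
  have "(\<lambda>n. \<Sum>i<4 ^ k. cell_cdf (c n k) i x) \<longlonglongrightarrow> (\<Sum>i<4 ^ k. F k i x)"
    by (intro tendsto_sum cdf_tendsto)
  then show "(\<Sum>i<4 ^ k. F k i x) = x"
    using sum_cell_cdf[OF lab x] by (simp add: LIMSEQ_const_iff)
qed simp

definition limit_cells :: "nat \<Rightarrow> point \<Rightarrow> nat" where
  "limit_cells k = limit_label (4 ^ k) (F k)"

lemma lab_limit: "labelling (4 ^ k) (limit_cells k)"
  unfolding limit_cells_def by (rule labelling_limit_label[OF total_F])

lemma limit_cells_cdf:
  assumes "i < 4 ^ k" "0 \<le> s" "s \<le> t" "t \<le> 1"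
  shows "cell_cdf (limit_cells k) i t - cell_cdf (limit_cells k) i s = F k i t - F k i s"
  using measure_limit_cell[OF total_F assms] cell_cdf_diff[OF lab_limit assms(3), of k i]
  by (simp add: limit_cells_def)

lemma mass_tendsto:
  assumes "i < 4 ^ k" shows "(\<lambda>n. mass (c n k) i) \<longlonglongrightarrow> mass (limit_cells k) i"
  unfolding mass_cell_cdf[OF lab] mass_cell_cdf[OF lab_limit] limit_cells_cdf[OF assms order_refl zero_le_one order_refl]
  by (intro tendsto_diff cdf_tendsto)

lemma strip_tendsto:
  assumes i: "i < 4 ^ k" and j: "j < M"
  shows "(\<lambda>n. area (strip_cell M (c n k) i j)) \<longlonglongrightarrow> area (strip_cell M (limit_cells k) i j)"
proof -
  have M: "M > 0" using j by simp
  have b: "0 \<le> real j / M" "real j / M \<le> (real j + 1) / M" "(real j + 1) / M \<le> 1"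
    using j by (auto simp: divide_right_mono divide_le_eq_1)
  show ?thesis
    unfolding strip_cell_cdf[OF lab M] strip_cell_cdf[OF lab_limit M] limit_cells_cdf[OF i b]
    by (intro tendsto_diff cdf_tendsto)
qed

lemma submass_B: "submass (4 ^ k) (mass (limit_cells k)) (B k)"
  unfolding submass_def
proof (intro conjI allI impI)
  fix i j :: nat assume ij: "i < 4 ^ k" "j < 4 ^ k"
  have s: "0 \<le> block (c n k) (W n) i j" "block (c n k) (W n) i j \<le> mass (c n k) i * mass (c n k) j" for n
    using block_submass[OF unit lab, of k n n] ij by (auto simp: submass_def)
  show "0 \<le> B k i j" using LIMSEQ_le_const[OF block_tendsto[OF ij]] s by blast
  show "B k i j \<le> mass (limit_cells k) i * mass (limit_cells k) j"
    by (rule LIMSEQ_le[OF block_tendsto[OF ij] tendsto_mult[OF mass_tendsto[OF ij(1)] mass_tendsto[OF ij(2)]]])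
      (use s in blast)
qed simp

lemma div_power_less: "k \<le> l \<Longrightarrow> i < 4 ^ l \<Longrightarrow> i div 4 ^ (l - k) < (4 ^ k :: nat)"
  by (rule less_mult_imp_div_less) (simp add: power_add[symmetric])

lemma coarsens_B:
  assumes kl: "k \<le> l"
  shows "coarsens (4 ^ k) (4 ^ l) (\<lambda>i. i div 4 ^ (l - k)) (B k) (B l)"
  unfolding coarsens_def
proof (intro conjI allI impI)
  fix i j :: nat assume ij: "i < 4 ^ k" "j < 4 ^ k"
  let ?r = "\<lambda>i. i div 4 ^ (l - k) :: nat"
  have "block (c n k) (W n) i j = (\<Sum>i'<4 ^ l. \<Sum>j'<4 ^ l. of_bool (?r i' = i \<and> ?r j' = j) * block (c n l) (W n) i' j')" for n
    using block_coarsens[OF kernel_W[of n] lab[of k n] lab[of l n] refines[OF kl] div_power_less[OF kl]] ij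
    unfolding coarsens_def by blast
  then have "(\<lambda>n. block (c n k) (W n) i j) \<longlonglongrightarrow> (\<Sum>i'<4 ^ l. \<Sum>j'<4 ^ l. of_bool (?r i' = i \<and> ?r j' = j) * B l i' j')"
    by (simp only:) (intro tendsto_sum tendsto_mult tendsto_const block_tendsto, auto)
  then show "B k i j = (\<Sum>i'<4 ^ l. \<Sum>j'<4 ^ l. of_bool (?r i' = i \<and> ?r j' = j) * B l i' j')"
    using block_tendsto[OF ij] LIMSEQ_unique by blast
qed (rule div_power_less[OF kl])

text \<open>The distribution functions of the finer cells add up to those of the coarser cells for every \<open>n\<close>, hence
  also in the limit.\<close>

lemma refines_limit:
  "k \<le> l \<Longrightarrow> AE p in square_measure. limit_cells k p = limit_cells l p div 4 ^ (l - k)"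
proof (induction l rule: dec_induct)
  case (step l)
  have "F l i x = (\<Sum>j<4 * 4 ^ l. of_bool (j div 4 = i) * F (Suc l) j x)" for i x
  proof -
    have "cell_cdf (c n l) i x = (\<Sum>j<4 * 4 ^ l. of_bool (j div 4 = i) * cell_cdf (c n (Suc l)) j x)" for n
      using cell_cdf_refines[OF lab[of "Suc l" n], of "c n l" "\<lambda>j. j div 4" i x] refines[of l "Suc l" n] by simp
    then have "(\<lambda>n. cell_cdf (c n l) i x) \<longlonglongrightarrow> (\<Sum>j<4 * 4 ^ l. of_bool (j div 4 = i) * F (Suc l) j x)"
      by (simp only:) (intro tendsto_sum tendsto_mult tendsto_const cdf_tendsto)
    then show ?thesis using cdf_tendsto LIMSEQ_unique by blast
  qed
  moreover have "total_distribution (4 * 4 ^ l) (F (Suc l))" using total_F[of "Suc l"] by simp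
  ultimately have "AE p in square_measure. limit_cells l p = limit_cells (Suc l) p div 4"
    using limit_label_refines[OF total_F, of l "F (Suc l)"] by (simp add: limit_cells_def)
  then show ?case using step.IH
    by eventually_elim (use step.hyps in \<open>simp add: Suc_diff_le div_mult2_eq\<close>)
qed simp

lemma B_commute:
  assumes ij: "i < 4 ^ k" "j < 4 ^ k" shows "B k i j = B k j i"
proof -
  have "W n (u, v) = W n (v, u)" if "u \<in> unit_square" "v \<in> unit_square" for n u v
    using orderon[of n] that by (simp add: orderons_def)
  then have "block (c n k) (W n) i j = block (c n k) (W n) j i" for n
    using block_commute[OF kernel_W _ lab] by blast
  then have "(\<lambda>n. block (c n k) (W n) i j) \<longlonglongrightarrow> B k j i" using block_tendsto[OF ij(2,1)] by simp
  then show ?thesis using block_tendsto[OF ij] LIMSEQ_unique by blast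
qed

definition weight :: "nat \<Rightarrow> nat \<Rightarrow> nat \<Rightarrow> real" where
  "weight k = average (mass (limit_cells k)) (B k)"

definition approx :: "nat \<Rightarrow> point \<times> point \<Rightarrow> real" where
  "approx k = step (limit_cells k) (weight k)"

lemma weight_bounds: "i < 4 ^ k \<Longrightarrow> j < 4 ^ k \<Longrightarrow> 0 \<le> weight k i j \<and> weight k i j \<le> 1"
  unfolding weight_def using average_bounds[OF submass_B] by blast

lemma limit_cells_less: "p \<in> unit_square \<Longrightarrow> limit_cells k p < 4 ^ k"
  using lab_limit[of k] by (simp add: labelling_def)

lemma approx_unit: "unit_kernel (approx k)"
  unfolding unit_kernel_def
proof (intro conjI ballI)
  show "kernel (approx k)" unfolding approx_def by (rule step_kernel[OF lab_limit])
  fix z assume "z \<in> square2"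
  then have "limit_cells k (fst z) < 4 ^ k" "limit_cells k (snd z) < 4 ^ k" by (auto intro: limit_cells_less)
  from weight_bounds[OF this] show "0 \<le> approx k z" "approx k z \<le> 1"
    by (auto simp: approx_def step_def case_prod_beta)
qed

lemma approx_kernel: "kernel (approx k)"
  using approx_unit by (simp add: unit_kernel_def)

text \<open>The energies increase with the level and are at most 1; their differences bound the squared \<open>L\<^sup>1\<close>
  distances.\<close>

lemma approx_Cauchy:
  assumes e: "e > 0"
  shows "\<exists>K. \<forall>k\<ge>K. \<forall>l\<ge>K. L1_norm (\<lambda>z. approx k z - approx l z) \<le> e"
proof -
  define E where "E k = energy (4 ^ k) (mass (limit_cells k)) (B k)" for k
  have inc: "(L1_norm (\<lambda>z. approx l z - approx k z))\<^sup>2 \<le> E l - E k" if kl: "k \<le> l" for k l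
    unfolding E_def approx_def weight_def
    by (rule energy_increment[OF lab_limit lab_limit refines_limit[OF kl] submass_B submass_B coarsens_B[OF kl]])
  have mono: "incseq E"
  proof (rule incseq_SucI)
    fix k show "E k \<le> E (Suc k)" using inc[of k "Suc k"] order_trans[OF zero_le_power2] by fastforce
  qed
  have le1: "E k \<le> 1" for k
    unfolding E_def by (rule energy_bounds(2)[OF submass_B sum_mass[OF lab_limit]])
  obtain L where "E \<longlonglongrightarrow> L" using incseq_convergent[OF mono allI[OF le1]] by blast
  then have "Cauchy E" by (rule LIMSEQ_imp_Cauchy)
  then obtain K where K: "\<And>k l. k \<ge> K \<Longrightarrow> l \<ge> K \<Longrightarrow> norm (E k - E l) < e\<^sup>2"
    using CauchyD[of E "e\<^sup>2"] e by auto
  have le: "L1_norm (\<lambda>z. approx l z - approx k z) \<le> e" if "K \<le> k" "k \<le> l" for k l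
  proof (rule power2_le_imp_le)
    have "E l - E k \<le> e\<^sup>2" using K[of l k] that by simp
    then show "(L1_norm (\<lambda>z. approx l z - approx k z))\<^sup>2 \<le> e\<^sup>2"
      using inc[OF that(2)] by linarith
  qed (use e in simp)
  show ?thesis
  proof (intro exI[of _ K] allI impI)
    fix k l assume kl: "K \<le> k" "K \<le> l"
    show "L1_norm (\<lambda>z. approx k z - approx l z) \<le> e"
    proof (cases "k \<le> l")
      case True
      then show ?thesis using le[of k l] kl by (simp add: abs_minus_commute)
    next
      case False
      then show ?thesis using le[of l k] kl by simp
    qed
  qed
qed

lemma limit_orderon:
  obtains V where "V \<in> orderons" "(\<lambda>k. L1_norm (\<lambda>z. approx k z - V z)) \<longlonglongrightarrow> 0"
proof -
  obtain r where lim: "(\<lambda>k. L1_norm (\<lambda>z. approx k z - truncated_limit (\<lambda>i. approx (r i)) z)) \<longlonglongrightarrow> 0"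
    using L1_Cauchy_limit[OF approx_unit approx_Cauchy] by blast
  define T where "T = truncated_limit (\<lambda>i. approx (r i))"
  define V where "V = restrict T square2"
  have T: "unit_kernel T" unfolding T_def by (rule unit_kernel_truncated_limit[OF approx_unit])
  have eq: "V z = T z" if "z \<in> square2" for z using that by (simp add: V_def)
  have T01: "T z \<in> {0..1}" for z by (simp add: T_def truncated_limit_def)
  have "V \<in> square2 \<rightarrow>\<^sub>E {0..1}" unfolding V_def using T01 by (intro restrict_PiE_iff[THEN iffD2] ballI)
  moreover have "V \<in> borel_measurable square2_measure"
  proof (rule measurable_cong[THEN iffD2])
    show "T \<in> borel_measurable square2_measure" using T by (simp add: unit_kernel_def kernel_def)
    show "V z = T z" if "z \<in> space square2_measure" for z by (rule eq) (use that in simp)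
  qed
  moreover have "V (u, v) = V (v, u)" if uv: "u \<in> unit_square" "v \<in> unit_square" for u v
  proof -
    have "approx k (u, v) = approx k (v, u)" for k
      using B_commute[OF limit_cells_less[OF uv(1)] limit_cells_less[OF uv(2)], of k]
      by (simp add: approx_def step_def weight_def average_def mult.commute)
    then have "T (u, v) = T (v, u)" by (simp add: T_def truncated_limit_def)
    then show ?thesis using uv by (simp add: V_def)
  qed
  ultimately have V: "V \<in> orderons" by (simp add: orderons_def)
  have "L1_norm (\<lambda>z. approx k z - V z) = L1_norm (\<lambda>z. approx k z - T z)" for k
  proof (rule Bochner_Integration.integral_cong[OF refl])
    fix z assume z: "z \<in> space square2_measure"
    have "V z = T z" by (rule eq) (use z in simp)
    then show "\<bar>approx k z - V z\<bar> = \<bar>approx k z - T z\<bar>" by simp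
  qed
  then show ?thesis using that[OF V] lim by (simp add: T_def)
qed

definition deviation :: "nat \<Rightarrow> nat \<Rightarrow> real" where
  "deviation k n = (\<Sum>i<4 ^ k. \<Sum>j<4 ^ k.
     \<bar>block (c n k) (W n) i j - weight k i j * (mass (c n k) i * mass (c n k) j)\<bar>)"

text \<open>The chain from \<open>W n\<close> over its averages and the pulled back limit step kernel to the pulled back limit.\<close>

lemma distance_estimate:
  assumes V: "kernel V" and f: "f \<in> mp_bijections"
  shows "cut_shift_dist (W n) V \<le> Shift f + cut_norm (\<lambda>z. W n z - projection (c n k) (W n) z)
    + deviation k n
    + 2 * area {p\<in>unit_square. c n k p \<noteq> limit_cells k (f p)}
    + L1_norm (\<lambda>z. approx k z - V z)"
proof -
  let ?P = "projection (c n k) (W n)"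
  have kP: "kernel ?P" by (rule step_kernel[OF lab])
  note kU = kernel_pullback(1)[OF f approx_kernel] and kV = kernel_pullback(1)[OF f V]
  have "cut_shift_dist (W n) V \<le> Shift f + cut_norm (\<lambda>z. W n z - pullback V f z)"
    by (rule cut_shift_dist_upper[OF kernel_W V f])
  also have "cut_norm (\<lambda>z. W n z - pullback V f z) \<le> cut_norm (\<lambda>z. W n z - ?P z) + cut_norm (\<lambda>z. ?P z - pullback V f z)"
    by (rule cut_norm_triangle[OF kernel_W kP kV])
  also have "cut_norm (\<lambda>z. ?P z - pullback V f z)
      \<le> cut_norm (\<lambda>z. ?P z - pullback (approx k) f z) + cut_norm (\<lambda>z. pullback (approx k) f z - pullback V f z)"
    by (rule cut_norm_triangle[OF kP kU kV])
  also have "cut_norm (\<lambda>z. ?P z - pullback (approx k) f z) \<le> L1_norm (\<lambda>z. ?P z - pullback (approx k) f z)"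
    by (rule cut_norm_le_L1[OF kernel_diff[OF kP kU]])
  also have "\<dots> \<le> deviation k n
    + 2 * area {p\<in>unit_square. c n k p \<noteq> limit_cells k (f p)}"
    unfolding approx_def deviation_def by (rule step_comparison[OF lab lab_limit f block_submass[OF unit lab] weight_bounds])
  also have "cut_norm (\<lambda>z. pullback (approx k) f z - pullback V f z) \<le> L1_norm (\<lambda>z. pullback (approx k) f z - pullback V f z)"
    by (rule cut_norm_le_L1[OF kernel_diff[OF kU kV]])
  also have "\<dots> = (\<integral>z. pullback (\<lambda>z. \<bar>approx k z - V z\<bar>) f z \<partial>square2_measure)"
    by (intro Bochner_Integration.integral_cong refl) (simp add: pullback_def case_prod_beta)
  also have "\<dots> = L1_norm (\<lambda>z. approx k z - V z)"
    by (rule kernel_pullback(2)[OF f kernel_abs[OF kernel_diff[OF approx_kernel V]]])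
  finally show ?thesis by simp
qed

lemma deviation_tendsto: "deviation k \<longlonglongrightarrow> 0"
proof -
  have "(\<lambda>n. \<Sum>i<4 ^ k. \<Sum>j<4 ^ k. \<bar>block (c n k) (W n) i j - weight k i j * (mass (c n k) i * mass (c n k) j)\<bar>)
      \<longlonglongrightarrow> (\<Sum>i<4 ^ k. \<Sum>j<4 ^ k. \<bar>B k i j - weight k i j * (mass (limit_cells k) i * mass (limit_cells k) j)\<bar>)"
    by (intro tendsto_sum tendsto_rabs tendsto_diff tendsto_mult tendsto_const block_tendsto mass_tendsto) auto
  also have "(\<Sum>i<4 ^ k. \<Sum>j<4 ^ k. \<bar>B k i j - weight k i j * (mass (limit_cells k) i * mass (limit_cells k) j)\<bar>) = 0"
    unfolding weight_def by (simp add: average_mult_mass[OF submass_B])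
  finally show ?thesis unfolding deviation_def[abs_def] .
qed

text \<open>The level with small cut norm depends on \<open>n\<close> but lies in a fixed window of levels, so it suffices that
  all other error terms are small simultaneously for the finitely many levels of the window.\<close>

lemma converges:
  "\<exists>V\<in>orderons. (\<lambda>n. cut_shift_dist (W n) V) \<longlonglongrightarrow> 0"
proof -
  obtain V where V: "V \<in> orderons" and lim: "(\<lambda>k. L1_norm (\<lambda>z. approx k z - V z)) \<longlonglongrightarrow> 0"
    by (rule limit_orderon)
  have kV: "kernel V" using V by (rule orderon_kernel)
  have "(\<lambda>n. cut_shift_dist (W n) V) \<longlonglongrightarrow> 0"
  proof (rule LIMSEQ_I)
    fix \<epsilon> :: real assume \<epsilon>: "\<epsilon> > 0"
    \<comment> \<open>The distance estimate has five terms; the mismatched area counts twice, so they add up to \<open>6 * e\<close>.\<close>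
    define e where "e = \<epsilon> / 8"
    have e: "e > 0" using \<epsilon> by (simp add: e_def)
    obtain K0 where K0: "\<And>k. k \<ge> K0 \<Longrightarrow> L1_norm (\<lambda>z. approx k z - V z) \<le> e"
    proof -
      obtain K0 where "\<forall>k\<ge>K0. norm (L1_norm (\<lambda>z. approx k z - V z) - 0) < e"
        using LIMSEQ_D[OF lim e] by blast
      then show ?thesis using that[of K0] by (simp add: less_imp_le)
    qed
    obtain K :: nat where "4 / e\<^sup>2 < K" using reals_Archimedean2 by blast
    then have "4 < e\<^sup>2 * K" using e by (simp add: pos_divide_less_eq mult.commute)
    then have K: "K > 0" "4 / K \<le> e\<^sup>2"
      by (cases "K = 0"; simp add: pos_divide_le_eq)+
    obtain M :: nat where "1 / e < M" using reals_Archimedean2 by blast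
    then have "1 < e * M" using e by (simp add: pos_divide_less_eq mult.commute)
    then have M: "M > 0" "1 / M \<le> e"
      by (cases "M = 0"; simp add: pos_divide_le_eq)+
    define good where "good k n \<longleftrightarrow>
       (\<exists>f\<in>mp_bijections. Shift f \<le> 1 / M \<and> area {p\<in>unit_square. c n k p \<noteq> limit_cells k (f p)} \<le> e) \<and>
       deviation k n \<le> e" for k n
    have good: "eventually (good k) sequentially" for k
    proof -
      obtain \<delta> where \<delta>: "\<delta> > 0" and match: "\<forall>c c'. labelling (4 ^ k) c \<and> labelling (4 ^ k) c' \<and>
         (\<forall>i<4 ^ k. \<forall>j<M. \<bar>area (strip_cell M c i j) - area (strip_cell M c' i j)\<bar> \<le> \<delta>)
         \<longrightarrow> (\<exists>f\<in>mp_bijections. Shift f \<le> 1 / M \<and> area {p\<in>unit_square. c p \<noteq> c' (f p)} \<le> e)"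
        using matching_bijection[OF M(1) e, of "4 ^ k"] by (elim exE conjE)
      have "eventually (\<lambda>n. \<bar>area (strip_cell M (c n k) i j) - area (strip_cell M (limit_cells k) i j)\<bar> \<le> \<delta>) sequentially"
        if ij: "i < 4 ^ k" "j < M" for i j
        using tendstoD[OF strip_tendsto[OF ij] \<delta>] by eventually_elim (simp add: dist_real_def less_imp_le)
      then have "eventually (\<lambda>n. \<forall>i\<in>{..<4 ^ k}. \<forall>j\<in>{..<M}.
          \<bar>area (strip_cell M (c n k) i j) - area (strip_cell M (limit_cells k) i j)\<bar> \<le> \<delta>) sequentially"
        by (intro eventually_ball_finite ballI) auto
      moreover have "eventually (\<lambda>n. deviation k n < e) sequentially"
        by (rule order_tendstoD(2)[OF deviation_tendsto e])
      ultimately show ?thesis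
      proof eventually_elim
        fix n
        assume s: "\<forall>i\<in>{..<4 ^ k}. \<forall>j\<in>{..<M}.
          \<bar>area (strip_cell M (c n k) i j) - area (strip_cell M (limit_cells k) i j)\<bar> \<le> \<delta>"
          and b: "deviation k n < e"
        have "\<exists>f\<in>mp_bijections. Shift f \<le> 1 / M \<and> area {p\<in>unit_square. c n k p \<noteq> limit_cells k (f p)} \<le> e"
          by (rule match[rule_format]) (use lab lab_limit s in auto)
        then show "good k n" using b unfolding good_def by simp
      qed
    qed
    then have "eventually (\<lambda>n. \<forall>k\<in>{K0..<K0 + K}. good k n) sequentially"
      by (intro eventually_ball_finite ballI) auto
    then obtain N where N: "\<And>n k. n \<ge> N \<Longrightarrow> k \<in> {K0..<K0 + K} \<Longrightarrow> good k n"
      unfolding eventually_sequentially by blast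
    show "\<exists>no. \<forall>n\<ge>no. norm (cut_shift_dist (W n) V - 0) < \<epsilon>"
    proof (intro exI[of _ N] allI impI)
      fix n assume n: "N \<le> n"
      obtain k where k: "k \<in> {K0..<K0 + K}" and sq: "(cut_norm (\<lambda>z. W n z - projection (c n k) (W n) z))\<^sup>2 \<le> 4 / K"
        using regular_filtration_window[OF unit[of n] filtration[of n] K(1), of K0] by blast
      have cn: "cut_norm (\<lambda>z. W n z - projection (c n k) (W n) z) \<le> e"
        by (rule power2_le_imp_le) (use sq K(2) e in auto)
      obtain f where f: "f \<in> mp_bijections" and sh: "Shift f \<le> 1 / M"
        and mis: "area {p\<in>unit_square. c n k p \<noteq> limit_cells k (f p)} \<le> e"
        and dev: "deviation k n \<le> e"
        using N[OF n k] unfolding good_def by blast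
      have "L1_norm (\<lambda>z. approx k z - V z) \<le> e" using K0 k by simp
      then have "cut_shift_dist (W n) V \<le> 6 * e"
        using distance_estimate[OF kV f, of n k] sh M(2) cn mis dev by linarith
      also have "\<dots> < \<epsilon>" using \<epsilon> by (simp add: e_def)
      finally show "norm (cut_shift_dist (W n) V - 0) < \<epsilon>"
        using cut_shift_dist_nonneg[OF kernel_W kV, of n] by simp
    qed
  qed
  then show ?thesis using V by blast
qed

end

section \<open>Compactness\<close>

lemma orderons_seq_compact:
  fixes W :: "nat \<Rightarrow> point \<times> point \<Rightarrow> real"
  assumes W: "\<And>n. W n \<in> orderons"
  shows "\<exists>V r. V \<in> orderons \<and> strict_mono r \<and> (\<lambda>n. cut_shift_dist (W (r n)) V) \<longlonglongrightarrow> 0"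
proof -
  have "\<exists>c. \<forall>n. regular_filtration (W n) (c n)"
    using regular_filtration_exists[OF orderon_unit_kernel[OF W]] by (intro choice allI)
  then obtain c where c: "\<And>n. regular_filtration (W n) (c n)" by blast
  have lab: "labelling (4 ^ k) (c n k)" for n k using c[of n] by (simp add: regular_filtration_def)
  obtain r F B where r: "strict_mono r" and F: "\<And>k i x. (\<lambda>n. cell_cdf (c (r n) k) i x) \<longlonglongrightarrow> F k i x"
    and B: "\<And>k i j. i < 4 ^ k \<Longrightarrow> j < 4 ^ k \<Longrightarrow> (\<lambda>n. block (c (r n) k) (W (r n)) i j) \<longlonglongrightarrow> B k i j"
    using profile_subsequence[of c W, OF lab orderon_unit_kernel[OF W]] by blast
  interpret profile_limit "\<lambda>n. W (r n)" "\<lambda>n. c (r n)" F B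
    by unfold_locales (use W c F B in auto)
  show ?thesis using converges r by blast
qed

theorem theorem1p1:
  shows "Metric_space orderon_classes class_dist \<and>
         compact_space (Metric_space.mtopology orderon_classes class_dist)"
  using Metric_space_orderon_classes compact_orderon_classes[OF orderons_seq_compact] by blast

end
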